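(* The cohomology groups $H^3(\mathcal E(\mathbb R^{2n},\mathscr V_\bullet))$ and $H^3(\mathcal D'(\mathbb R^{2n},\mathscr V_\bullet))$ both vanish; that is, both maps $\mathscr D_2:\mathcal E(\mathbb R^{2n},\mathscr V_2)\to\mathcal E(\mathbb R^{2n},\mathscr V_3)$ and $\mathscr D_2:\mathcal D'(\mathbb R^{2n},\mathscr V_2)\to\mathcal D'(\mathbb R^{2n},\mathscr V_3)$ are surjective.
   Context: Let $n$ be a positive integer and $m=\lfloor n/2\rfloor$. Let $W$ be a complex vector space with basis $f_1,\dots,f_m$; for $\alpha=\{\alpha_1<\dots<\alpha_h\}\subset\{1,\dots,m\}$ put $f_\alpha=f_{\alpha_1}\wedge\cdots\wedge f_{\alpha_h}$ ($f_\emptyset=1$), a basis of $\wedge^\bullet W$. Let $\varepsilon_j v=f_j\wedge v$, and let $\iota_j f_\alpha=0$ if $j\notin\alpha$, $\iota_j f_\alpha=(-1)^{t+1}f_{\alpha\setminus\{j\}}$ if $j=\alpha_t$. Put $\gamma_{2j-1}=\varepsilon_j-\iota_j$, $\gamma_{2j}=-\mathbf i(\varepsilon_j+\iota_j)$ for $1\le j\le m$ and, if $n=2m+1$, $\gamma_{n}f_\alpha=-\mathbf i(-1)^{\#\alpha}f_\alpha$. The spinor modules are $\mathbb S^+=\wedge^{\rm even}W$, $\mathbb S^-=\wedge^{\rm odd}W$ for $n$ even, and $\mathbb S^+=\mathbb S^-=\wedge^\bullet W$ for $n$ odd. Then $\gamma_j:\mathbb S^\pm\to\mathbb S^\mp$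 and $\gamma_j\gamma_k+\gamma_k\gamma_j=-2\delta_{jk}\mathbf 1$. Write points of $\mathbb R^{2n}$ as $\mathbf x=(\mathbf x_0,\mathbf x_1)$ with $\mathbf x_A=(x_{A1},\dots,x_{An})$, $A=0,1$, let $\partial_{Aj}=\partial/\partial x_{Aj}$, and $\nabla_A=\sum_{j=1}^n\gamma_j\partial_{Aj}$. Let $\mathscr V_0=\mathbb S^+$, $\mathscr V_1=\mathbb C^2\otimes\mathbb S^-$, $\mathscr V_2=\mathbb C^2\otimes\mathbb S^-$, $\mathscr V_3=\mathbb S^+$; elements of $\mathscr V_1,\mathscr V_2$ are written as columns $(g_0,g_1)^T$. The Dirac complex $\mathscr V_0\xrightarrow{\mathscr D_0}\mathscr V_1\xrightarrow{\mathscr D_1}\mathscr V_2\xrightarrow{\mathscr D_2}\mathscr V_3\to0$ (at the level of functions or distributions) has operators $(\mathscr D_0f)_A=\nabla_Af$; $(\mathscr D_1g)_A=\nabla_0\nabla_Ag_1-\nabla_1\nabla_Ag_0$ for $A=0,1$; $\mathscr D_2h=\nabla_0h_1-\nabla_1h_0$. $\mathcal E(\mathbb R^{2n},V)$ is the space of smooth $V$-valued functions on $\mathbb R^{2n}$, $\mathcal D(\mathbb R^{2n},V)$ the space of compactly supported ones, and $\mathcal D'(\mathbb R^{2n},V)$ the space of $V$-valued distributions (dual of $\mathcal D(\mathbb R^{2n},V)$). $H^q$ is the $q$-th cohomology $\ker\mathscr D_q/\operatorname{Im}\mathscr D_{q-1}$ of the complex (with $\mathscr D_3=0$). *)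

theory Defs
  imports "HOL-Analysis.Analysis"
begin

section \<open>The spinor modules\<close>

text \<open>
  The dimension \<open>n\<close> is \<open>CARD('n)\<close>, where the finite index type \<open>'n\<close> carries a linear order, so
  that its elements are canonically numbered \<open>1, \<dots>, n\<close> (see \<open>bij_betw_coord\<close>). Every \<open>n \<ge> 1\<close>
  occurs: the numeral types are such index types.
\<close>

definition coord :: "'n::{finite,linorder} \<Rightarrow> nat" where
  "coord j = card {i. i \<le> j}"

lemma bij_betw_coord: "bij_betw (coord :: 'n \<Rightarrow> nat) UNIV {1..CARD('n::{finite,linorder})}"
proof -
  have less: "coord i < coord j" if "i < j" for i j :: 'n
    unfolding coord_def
  proof (rule psubset_card_mono)
    have "j \<in> {k. k \<le> j} - {k. k \<le> i}" using that by (simp add: not_le)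
    moreover have "{k. k \<le> i} \<subseteq> {k. k \<le> j}" using that by auto
    ultimately show "{k. k \<le> i} \<subset> {k. k \<le> j}" by blast
  qed simp
  have inj: "inj (coord :: 'n \<Rightarrow> nat)"
    by (rule injI) (metis less less_irrefl neqE)
  have "1 \<le> coord j \<and> coord j \<le> CARD('n)" for j :: 'n
  proof -
    have "card {j} \<le> card {i. i \<le> j}" by (rule card_mono) auto
    moreover have "card {i. i \<le> j} \<le> CARD('n)" by (rule card_mono) auto
    ultimately show ?thesis by (simp add: coord_def)
  qed
  then have "range (coord :: 'n \<Rightarrow> nat) \<subseteq> {1..CARD('n)}" by auto
  moreover have "card (range (coord :: 'n \<Rightarrow> nat)) = CARD('n)"
    using inj by (rule card_image)
  ultimately have "range (coord :: 'n \<Rightarrow> nat) = {1..CARD('n)}"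
    by (intro card_subset_eq) auto
  with inj show ?thesis by (simp add: bij_betw_def)
qed

text \<open>
  The type of subsets \<open>\<alpha>\<close> of \<open>{1..m}\<close>, \<open>m = \<lfloor>n/2\<rfloor>\<close>, which index the basis \<open>f\<^sub>\<alpha>\<close> of the exterior
  algebra of \<open>W\<close>. The exterior algebra itself is the coordinate space \<open>complex ^ 'n subsets\<close>.
\<close>

typedef 'n subsets = "Pow {1..CARD('n::finite) div 2} :: nat set set"
  morphisms elems Subset
  by blast

instance subsets :: (finite) finite
proof
  have "range (elems :: 'a subsets \<Rightarrow> nat set) = Pow {1..CARD('a) div 2}"
    by (rule type_definition.Rep_range[OF type_definition_subsets])
  then have "finite (range (elems :: 'a subsets \<Rightarrow> nat set))" by simp
  then show "finite (UNIV :: 'a subsets set)"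
    by (rule finite_imageD) (simp add: inj_on_def elems_inject)
qed

definition basis_form :: "nat set \<Rightarrow> complex ^ ('n::finite) subsets" where
  "basis_form \<alpha> = axis (Subset \<alpha>) 1"

text \<open>The linear map sending each basis element \<open>f\<^sub>\<alpha>\<close> to \<open>F \<alpha>\<close>.\<close>

definition lin_ext ::
  "(nat set \<Rightarrow> complex ^ ('n::finite) subsets) \<Rightarrow> complex ^ 'n subsets \<Rightarrow> complex ^ 'n subsets" where
  "lin_ext F v = (\<Sum>\<alpha>\<in>UNIV. (v $ \<alpha>) *s F (elems \<alpha>))"

text \<open>
  Exterior multiplication by \<open>f\<^sub>j\<close>: the sign is the one needed to move \<open>f\<^sub>j\<close> past the factors
  \<open>f\<^sub>i\<close>, \<open>i < j\<close>, of \<open>f\<^sub>\<alpha>\<close>. In the contraction, \<open>j\<close> is the \<open>t\<close>-th smallest element of \<open>\<alpha>\<close> for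
  \<open>t = card {i \<in> \<alpha>. i \<le> j}\<close>.
\<close>

definition ext_mult :: "nat \<Rightarrow> complex ^ ('n::finite) subsets \<Rightarrow> complex ^ 'n subsets" where
  "ext_mult j = lin_ext (\<lambda>\<alpha>. if j \<in> \<alpha> then 0
     else ((-1) ^ card {i \<in> \<alpha>. i < j}) *s basis_form (insert j \<alpha>))"

definition contraction :: "nat \<Rightarrow> complex ^ ('n::finite) subsets \<Rightarrow> complex ^ 'n subsets" where
  "contraction j = lin_ext (\<lambda>\<alpha>. if j \<in> \<alpha>
     then ((-1) ^ (card {i \<in> \<alpha>. i \<le> j} + 1)) *s basis_form (\<alpha> - {j}) else 0)"

text \<open>For \<open>k = 2j - 1\<close> and \<open>k = 2j\<close> alike, \<open>j = (k + 1) div 2\<close>.\<close>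

definition gamma :: "nat \<Rightarrow> complex ^ ('n::finite) subsets \<Rightarrow> complex ^ 'n subsets" where
  "gamma k v =
     (if odd CARD('n) \<and> k = CARD('n)
        then lin_ext (\<lambda>\<alpha>. (- \<i> * (-1) ^ card \<alpha>) *s basis_form \<alpha>) v
      else if odd k then ext_mult ((k + 1) div 2) v - contraction ((k + 1) div 2) v
      else (- \<i>) *s (ext_mult ((k + 1) div 2) v + contraction ((k + 1) div 2) v))"

definition spinor_plus :: "(complex ^ ('n::finite) subsets) set" where
  "spinor_plus = {v. even CARD('n) \<longrightarrow> (\<forall>\<alpha>. odd (card (elems \<alpha>)) \<longrightarrow> v $ \<alpha> = 0)}"

definition spinor_minus :: "(complex ^ ('n::finite) subsets) set" where
  "spinor_minus = {v. even CARD('n) \<longrightarrow> (\<forall>\<alpha>. even (card (elems \<alpha>)) \<longrightarrow> v $ \<alpha> = 0)}"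

text \<open>
  \<open>\<complex>\<^sup>2 \<otimes> \<And>W\<close> has coordinates indexed by pairs \<open>(A, \<alpha>)\<close>, where the index \<open>A\<close> ranges over the two
  elements \<open>0\<close> and \<open>1\<close> of the numeral type \<open>2\<close>. The entries of the column \<open>(g\<^sub>0, g\<^sub>1)\<^sup>T\<close> are
  \<open>component 0 g\<close> and \<open>component 1 g\<close>; \<open>inject A v\<close> is the column with \<open>v\<close> in place \<open>A\<close> and \<open>0\<close>
  in the other place.
\<close>

definition component ::
  "2 \<Rightarrow> complex ^ (2 \<times> ('n::finite) subsets) \<Rightarrow> complex ^ 'n subsets" where
  "component A g = (\<chi> \<alpha>. g $ (A, \<alpha>))"

definition inject ::
  "2 \<Rightarrow> complex ^ ('n::finite) subsets \<Rightarrow> complex ^ (2 \<times> 'n subsets)" where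
  "inject A v = (\<chi> p. if fst p = A then v $ snd p else 0)"

definition V2 :: "(complex ^ (2 \<times> ('n::finite) subsets)) set" where
  "V2 = {g. \<forall>A. component A g \<in> spinor_minus}"

definition V3 :: "(complex ^ ('n::finite) subsets) set" where
  "V3 = spinor_plus"

section \<open>Smooth functions, test functions and distributions\<close>

definition pd :: "'a \<Rightarrow> ('a::euclidean_space \<Rightarrow> 'b::euclidean_space) \<Rightarrow> 'a \<Rightarrow> 'b" where
  "pd b f x = frechet_derivative f (at x) b"

fun pds :: "'a list \<Rightarrow> ('a::euclidean_space \<Rightarrow> 'b::euclidean_space) \<Rightarrow> 'a \<Rightarrow> 'b" where
  "pds [] f = f"
| "pds (b # bs) f = pd b (pds bs f)"

definition smooth :: "('a::euclidean_space \<Rightarrow> 'b::euclidean_space) \<Rightarrow> bool" where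
  "smooth f \<longleftrightarrow> (\<forall>bs. set bs \<subseteq> Basis \<longrightarrow> pds bs f differentiable_on UNIV)"

definition supp :: "('a::topological_space \<Rightarrow> 'b::zero) \<Rightarrow> 'a set" where
  "supp f = closure {x. f x \<noteq> 0}"

definition smooth_functions :: "'b set \<Rightarrow> ('a::euclidean_space \<Rightarrow> 'b::euclidean_space) set" where
  "smooth_functions V = {f. smooth f \<and> range f \<subseteq> V}"

definition test_functions :: "'b set \<Rightarrow> ('a::euclidean_space \<Rightarrow> 'b::euclidean_space) set" where
  "test_functions V = {f \<in> smooth_functions V. compact (supp f)}"

definition C_norm :: "nat \<Rightarrow> ('a::euclidean_space \<Rightarrow> 'b::euclidean_space) \<Rightarrow> real" where
  "C_norm N f = (\<Sum>bs | set bs \<subseteq> Basis \<and> length bs \<le> N. SUP x. norm (pds bs f x))"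

text \<open>
  The dual of \<open>test_functions V\<close>: complex linear functionals that are continuous for the usual
  inductive limit topology, i.e. that satisfy a \<open>C\<^sup>N\<close> estimate on the test functions supported in
  any given compact set. A distribution is a total HOL function; its irrelevant values outside
  \<open>test_functions V\<close> are fixed to be \<open>0\<close>, so that equality of distributions is equality of functions.
\<close>

definition distributions ::
  "(complex ^ ('k::finite)) set \<Rightarrow> (('a::euclidean_space \<Rightarrow> complex ^ 'k) \<Rightarrow> complex) set" where
  "distributions V = {u.
     (\<forall>\<phi>\<in>test_functions V. \<forall>\<psi>\<in>test_functions V. u (\<lambda>x. \<phi> x + \<psi> x) = u \<phi> + u \<psi>) \<and>
     (\<forall>c. \<forall>\<phi>\<in>test_functions V. u (\<lambda>x. c *s \<phi> x) = c * u \<phi>) \<and>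
     (\<forall>K. compact K \<longrightarrow> (\<exists>C N. \<forall>\<phi>\<in>test_functions V. supp \<phi> \<subseteq> K \<longrightarrow>
        norm (u \<phi>) \<le> C * C_norm N \<phi>)) \<and>
     (\<forall>\<phi>. \<phi> \<notin> test_functions V \<longrightarrow> u \<phi> = 0)}"

section \<open>The operator \<open>\<D>\<^sub>2\<close>\<close>

text \<open>Points of \<open>\<real>\<^sup>2\<^sup>n\<close> have coordinates \<open>x $ A $ j\<close>; \<open>direction A j\<close> is the unit vector of \<open>x\<^sub>A\<^sub>j\<close>.\<close>

definition direction :: "2 \<Rightarrow> 'n \<Rightarrow> real ^ ('n::finite) ^ 2" where
  "direction A j = axis A (axis j 1)"

definition nabla ::
  "2 \<Rightarrow> (real ^ ('n::{finite,linorder}) ^ 2 \<Rightarrow> complex ^ 'n subsets)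
     \<Rightarrow> real ^ ('n::{finite,linorder}) ^ 2 \<Rightarrow> complex ^ 'n subsets" where
  "nabla A f x = (\<Sum>j\<in>UNIV. gamma (coord j) (pd (direction A j) f x))"

definition D2 ::
  "(real ^ ('n::{finite,linorder}) ^ 2 \<Rightarrow> complex ^ (2 \<times> 'n subsets))
     \<Rightarrow> real ^ ('n::{finite,linorder}) ^ 2 \<Rightarrow> complex ^ 'n subsets" where
  "D2 h x = nabla 0 (component 1 \<circ> h) x - nabla 1 (component 0 \<circ> h) x"

text \<open>
  On distributions, the operations are the transposes of operations on test functions with respect
  to the bilinear pairing \<open>\<integral> \<Sum>\<^sub>k f\<^sub>k \<phi>\<^sub>k\<close>, hence they extend those on functions:
  \<open>\<langle>\<partial>u, \<phi>\<rangle> = - \<langle>u, \<partial>\<phi>\<rangle>\<close>, \<open>\<langle>Lu, \<phi>\<rangle> = \<langle>u, L\<^sup>T\<phi>\<rangle>\<close> for a linear map \<open>L\<close>, and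
  \<open>\<langle>h\<^sub>A, \<phi>\<rangle> = \<langle>h, inject A \<phi>\<rangle>\<close>.
\<close>

definition dist_pd ::
  "'a \<Rightarrow> (('a::euclidean_space \<Rightarrow> 'b::euclidean_space) \<Rightarrow> complex) \<Rightarrow> ('a \<Rightarrow> 'b) \<Rightarrow> complex" where
  "dist_pd b u \<phi> = - u (pd b \<phi>)"

definition dist_lin ::
  "(complex ^ 'k \<Rightarrow> complex ^ 'l) \<Rightarrow> (('a \<Rightarrow> complex ^ ('k::finite)) \<Rightarrow> complex)
     \<Rightarrow> ('a \<Rightarrow> complex ^ ('l::finite)) \<Rightarrow> complex" where
  "dist_lin L u \<phi> = u (\<lambda>x. transpose (matrix L) *v \<phi> x)"

definition dist_component ::
  "2 \<Rightarrow> (('a \<Rightarrow> complex ^ (2 \<times> ('n::finite) subsets)) \<Rightarrow> complex)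
     \<Rightarrow> ('a \<Rightarrow> complex ^ 'n subsets) \<Rightarrow> complex" where
  "dist_component A h \<phi> = h (inject A \<circ> \<phi>)"

definition dist_nabla ::
  "2 \<Rightarrow> ((real ^ ('n::{finite,linorder}) ^ 2 \<Rightarrow> complex ^ 'n subsets) \<Rightarrow> complex)
     \<Rightarrow> (real ^ ('n::{finite,linorder}) ^ 2 \<Rightarrow> complex ^ 'n subsets) \<Rightarrow> complex" where
  "dist_nabla A u \<phi> =
     (\<Sum>j\<in>UNIV. dist_lin (gamma (coord j)) (dist_pd (direction A j) u) \<phi>)"

definition dist_D2 ::
  "((real ^ ('n::{finite,linorder}) ^ 2 \<Rightarrow> complex ^ (2 \<times> 'n subsets)) \<Rightarrow> complex)
     \<Rightarrow> (real ^ ('n::{finite,linorder}) ^ 2 \<Rightarrow> complex ^ 'n subsets) \<Rightarrow> complex" where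
  "dist_D2 h \<phi> = (if \<phi> \<in> test_functions V3
     then dist_nabla 0 (dist_component 1 h) \<phi> - dist_nabla 1 (dist_component 0 h) \<phi> else 0)"

section \<open>Cohomology\<close>

text \<open>
  The quotient of the space \<open>Z\<close> of cocycles by the space \<open>B\<close> of coboundaries, as a set of classes.
  In degree 3 the outgoing operator is zero, so every element is a cocycle.
\<close>

definition cohomology :: "('a \<Rightarrow> 'b::minus) set \<Rightarrow> ('a \<Rightarrow> 'b) set \<Rightarrow> ('a \<Rightarrow> 'b) set set" where
  "cohomology Z B = Z // {(u, v). u \<in> Z \<and> v \<in> Z \<and> u - v \<in> B}"

definition H3_smooth ::
  "(real ^ ('n::{finite,linorder}) ^ 2 \<Rightarrow> complex ^ 'n subsets) set set" where
  "H3_smooth = cohomology (smooth_functions V3) (D2 ` smooth_functions V2)"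

definition H3_distributions ::
  "((real ^ ('n::{finite,linorder}) ^ 2 \<Rightarrow> complex ^ 'n subsets) \<Rightarrow> complex) set set" where
  "H3_distributions = cohomology (distributions V3) (dist_D2 ` distributions V2)"

end

theory Submission
  imports Defs
begin

text \<open>
  Since \<open>\<nabla>\<^sub>A \<nabla>\<^sub>A = - \<Delta>\<^sub>A\<close>, the column \<open>h = (\<nabla>\<^sub>1 u, - \<nabla>\<^sub>0 u)\<close> satisfies \<open>\<D>\<^sub>2 h = \<Delta> u\<close>,
  so it suffices that the Laplacian of \<open>\<real>\<^sup>2\<^sup>n\<close> is onto, on smooth functions and on distributions.

  Let \<open>\<rho>\<close> be a radial mollifier and \<open>x \<rho>(x) = \<nabla>\<sigma>(x)\<close>, and write \<open>\<rho>\<^sub>t\<close>, \<open>\<sigma>\<^sub>t\<close> for the rescaled functions.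
  Then \<open>d/dt \<rho>\<^sub>t = - t \<Delta> \<sigma>\<^sub>t\<close>, and integrating over \<open>0 \<le> t \<le> T\<close> gives
  \<open>f = \<rho>\<^sub>T * f + K\<^sub>T (\<Delta> f)\<close> with the compactly supported averaging operator
  \<open>K\<^sub>T g = \<integral> t (\<sigma>\<^sub>t * g) dt\<close>, which commutes with \<open>\<Delta>\<close>. This identity replaces the fundamental solution.
  For harmonic \<open>f\<close> it is a mean value property, whence interior estimates and the
  approximation of functions harmonic on a ball of radius \<open>R\<close> by their Taylor polynomials on a ball of
  radius \<open>c R\<close>. On a small ball \<open>\<Delta> u = f\<close> is solved by \<open>u = K\<^sub>1 (\<chi> g)\<close>, where \<open>g\<close> is the fixed point of
  the contraction \<open>g \<mapsto> \<chi> f + \<rho>\<^sub>1 * (\<chi> g)\<close>, and on large balls by scaling. A Mittag-Leffler argument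
  then gives functions \<open>v\<^sub>k\<close> converging locally uniformly to some \<open>v\<close> with \<open>\<Delta> v\<^sub>k = f\<close> on growing balls;
  passing to the limit in \<open>v\<^sub>k = \<rho>\<^sub>1 * v\<^sub>k + K\<^sub>1 (\<Delta> v\<^sub>k)\<close> shows that \<open>v\<close> is smooth. A distribution \<open>F\<close>
  equals \<open>\<Delta> (F \<circ> K\<^sub>1) + F \<circ> (\<rho>\<^sub>1 * \<cdot>)\<close>, and the last term is a smooth function.
\<close>

subsection \<open>Iterated partial derivatives\<close>

text \<open>As a convolution kernel, \<open>parametrix\<close> is as singular as the fundamental
  solution that it replaces. After rescaling y to t y its integrand is continuous down to t = 0, so
  no singular integral ever has to be estimated. The price is the term rho_T * f, which is not
  small: the contraction works only because an average of a function with tiny support is controlled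
  by the volume of that support. In the passage from balls to the whole space, the approximation
  holds on a fraction c of the radius that is fixed before the function and the accuracy, so radii
  growing like c^(-n) outrun the loss. For distributions the identity is read by transposition; the
  remainder is a function whose Laplace equation is already solved, so no second exhaustion is
  needed. The spinor constraint only asks some coordinates to vanish. The Laplacian acts on each
  coordinate separately, so a coordinate projection restores the constraint afterwards.
  Distributions feel the gamma maps through their transposes, hence the Clifford relations appear
  twice.\<close>

lemma pds_append: "pds (as @ bs) f = pds as (pds bs f)"
  by (induction as) auto

lemma pds_snoc: "pds (bs @ [b]) f = pds bs (pd b f)"
  by (simp add: pds_append)

lemma pd_eq: "(f has_derivative f') (at x) \<Longrightarrow> pd b f x = f' b"
  unfolding pd_def using frechet_derivative_at by metis

text \<open>The expanded form matches the hypothesis of \<open>has_derivative_integral\<close> and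
  turns later smoothness proofs into inductions over partial derivatives.\<close>

lemma has_derivative_pd:
  assumes "f differentiable (at x)"
  shows "(f has_derivative (\<lambda>h. \<Sum>i\<in>Basis. (h \<bullet> i) *\<^sub>R pd i f x)) (at x)"
proof -
  have 1: "(f has_derivative frechet_derivative f (at x)) (at x)"
    using assms frechet_derivative_works by blast
  interpret bounded_linear "frechet_derivative f (at x)"
    using 1 by (rule has_derivative_bounded_linear)
  have "frechet_derivative f (at x) = (\<lambda>h. \<Sum>i\<in>Basis. (h \<bullet> i) *\<^sub>R pd i f x)"
  proof
    fix h
    have "frechet_derivative f (at x) h
        = frechet_derivative f (at x) (\<Sum>i\<in>Basis. (h \<bullet> i) *\<^sub>R i)"
      by (simp add: euclidean_representation)
    also have "\<dots> = (\<Sum>i\<in>Basis. (h \<bullet> i) *\<^sub>R pd i f x)"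
      by (simp add: sum scale pd_def)
    finally show "frechet_derivative f (at x) h = (\<Sum>i\<in>Basis. (h \<bullet> i) *\<^sub>R pd i f x)" .
  qed
  then show ?thesis using 1 by simp
qed

text \<open>\<open>frechet_derivative\<close> chooses among the derivatives at x. Functions that
  agree near x have the same derivatives there, so the choices coincide.\<close>

lemma pd_cong_open:
  assumes "open S" "x \<in> S" "\<And>y. y \<in> S \<Longrightarrow> f y = g y"
  shows "pd b f x = pd b g x"
proof -
  have "((f has_derivative D) (at x)) = ((g has_derivative D) (at x))" for D
    using has_derivative_transform_within_open[of f D x UNIV S g]
      has_derivative_transform_within_open[of g D x UNIV S f] assms by auto
  then show ?thesis unfolding pd_def frechet_derivative_def by simp
qed

lemma pds_cong_open:
  assumes "open S" "x \<in> S" "\<And>y. y \<in> S \<Longrightarrow> f y = g y"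
  shows "pds bs f x = pds bs g x"
  using assms(2)
proof (induction bs arbitrary: x)
  case (Cons b bs)
  show ?case unfolding pds.simps by (rule pd_cong_open[OF assms(1) Cons.prems Cons.IH])
qed (use assms in auto)

lemma pd_const [simp]: "pd b (\<lambda>x. c) = (\<lambda>x. 0)"
  by (rule ext, rule pd_eq[THEN trans]) (auto intro: derivative_eq_intros)

lemma pds_zero [simp]: "pds bs (\<lambda>x. 0) = (\<lambda>x. 0)"
  by (induction bs) auto

lemma sum_inner_Basis [simp]:
  fixes b :: "'a::euclidean_space" and F :: "'a \<Rightarrow> 'b::real_vector"
  assumes "b \<in> Basis"
  shows "(\<Sum>i\<in>Basis. (b \<bullet> i) *\<^sub>R F i) = F b"
proof -
  have "(\<Sum>i\<in>Basis. (b \<bullet> i) *\<^sub>R F i) = (\<Sum>i\<in>Basis. if i = b then F i else 0)"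
    by (rule sum.cong) (use assms in \<open>auto simp: inner_Basis\<close>)
  then show ?thesis using assms by simp
qed

subsection \<open>Smooth functions\<close>

text \<open>The graded notion carries the inductions, since \<open>smooth\<close> has no order to
  induct on. Mind the count: level n asks that derivatives of order n are still differentiable, so
  level 0 is plain differentiability.\<close>

definition smooth_upto :: "nat \<Rightarrow> ('a::euclidean_space \<Rightarrow> 'b::euclidean_space) \<Rightarrow> bool" where
  "smooth_upto n f \<longleftrightarrow>
     (\<forall>bs. set bs \<subseteq> Basis \<and> length bs \<le> n \<longrightarrow> pds bs f differentiable_on UNIV)"

lemma smooth_iff_upto: "smooth f \<longleftrightarrow> (\<forall>n. smooth_upto n f)"
  unfolding smooth_def smooth_upto_def by auto

lemma differentiable_on_UNIV: "f differentiable_on UNIV \<longleftrightarrow> (\<forall>x. f differentiable (at x))"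
  by (simp add: differentiable_on_def)

lemma smooth_upto_0: "smooth_upto 0 f \<longleftrightarrow> f differentiable_on UNIV"
  unfolding smooth_upto_def by auto

text \<open>Peels off the derivative that is applied first, which is the last entry of the list, so
  that an induction hypothesis can be used for \<open>pd b f\<close>.\<close>

lemma smooth_upto_Suc:
  "smooth_upto (Suc n) f \<longleftrightarrow> f differentiable_on UNIV \<and> (\<forall>b\<in>Basis. smooth_upto n (pd b f))"
proof safe
  assume *: "smooth_upto (Suc n) f"
  show "f differentiable_on UNIV"
    using * unfolding smooth_upto_def by (metis pds.simps(1) le0 list.size(3) list.set(1) empty_subsetI)
  fix b :: 'a assume "b \<in> Basis"
  then show "smooth_upto n (pd b f)"
    using * unfolding smooth_upto_def
    by (auto simp flip: pds_snoc)
next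
  assume *: "f differentiable_on UNIV" "\<forall>b\<in>Basis. smooth_upto n (pd b f)"
  show "smooth_upto (Suc n) f" unfolding smooth_upto_def
  proof safe
    fix bs :: "'a list" assume bs: "set bs \<subseteq> Basis" "length bs \<le> Suc n"
    show "pds bs f differentiable_on UNIV"
    proof (cases bs rule: rev_cases)
      case (snoc cs c)
      then have "smooth_upto n (pd c f)" using * bs by auto
      then show ?thesis using bs snoc by (auto simp: pds_snoc smooth_upto_def)
    qed (use * in auto)
  qed
qed

lemma smooth_upto_mono: "smooth_upto n f \<Longrightarrow> m \<le> n \<Longrightarrow> smooth_upto m f"
  unfolding smooth_upto_def by auto

text \<open>Accepts any formula for the derivative, so a chain or product rule can be fed in without
  computing partial derivatives first.\<close>

lemma smooth_upto_SucI:
  assumes "\<And>x. (f has_derivative f' x) (at x)" "\<And>b. b \<in> Basis \<Longrightarrow> smooth_upto n (\<lambda>x. f' x b)"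
  shows "smooth_upto (Suc n) f"
proof -
  have "pd b f = (\<lambda>x. f' x b)" for b using assms(1) by (auto intro: pd_eq)
  then show ?thesis using assms
    by (auto simp: smooth_upto_Suc differentiable_on_UNIV differentiable_def)
qed

lemma smooth_upto_0I:
  assumes "\<And>x. (f has_derivative f' x) (at x)"
  shows "smooth_upto 0 f"
  using assms by (auto simp: smooth_upto_0 differentiable_on_UNIV differentiable_def)

lemma smooth_differentiable: "smooth f \<Longrightarrow> f differentiable (at x)"
  unfolding smooth_iff_upto using smooth_upto_0 differentiable_on_UNIV by blast

lemma smooth_has_derivative:
  "smooth f \<Longrightarrow> (f has_derivative (\<lambda>h. \<Sum>i\<in>Basis. (h \<bullet> i) *\<^sub>R pd i f x)) (at x)"
  by (rule has_derivative_pd) (rule smooth_differentiable)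

lemma smooth_pd: "smooth f \<Longrightarrow> b \<in> Basis \<Longrightarrow> smooth (pd b f)"
  unfolding smooth_iff_upto using smooth_upto_Suc by blast

lemma smooth_pds: "smooth f \<Longrightarrow> set bs \<subseteq> Basis \<Longrightarrow> smooth (pds bs f)"
  by (induction bs) (auto intro: smooth_pd)

lemma smooth_continuous_on: "smooth f \<Longrightarrow> continuous_on S f"
  by (meson continuous_on_subset differentiable_imp_continuous_on differentiable_on_UNIV
      smooth_differentiable subset_UNIV)

lemma continuous_on_smooth_comp:
  "smooth f \<Longrightarrow> continuous_on S g \<Longrightarrow> continuous_on S (\<lambda>x. f (g x))"
  using continuous_on_compose2[OF smooth_continuous_on[of f UNIV]] by blast

lemma smooth_upto_const: "smooth_upto n (\<lambda>x. c)"
proof (induction n arbitrary: c)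
  case 0 show ?case by (rule smooth_upto_0I) (rule has_derivative_const)
next
  case (Suc n) show ?case by (rule smooth_upto_SucI) (rule has_derivative_const, rule Suc)
qed

lemma smooth_const [intro, simp]: "smooth (\<lambda>x. c)"
  by (simp add: smooth_iff_upto smooth_upto_const)

lemma smooth_upto_imp_deriv:
  "smooth_upto n f \<Longrightarrow> (f has_derivative (\<lambda>h. \<Sum>i\<in>Basis. (h \<bullet> i) *\<^sub>R pd i f x)) (at x)"
  using has_derivative_pd smooth_upto_mono[of n f 0] by (auto simp: smooth_upto_0 differentiable_on_UNIV)

lemma smooth_upto_add:
  "smooth_upto n f \<Longrightarrow> smooth_upto n g \<Longrightarrow> smooth_upto n (\<lambda>x. f x + g x)"
proof (induction n arbitrary: f g)
  case 0
  then show ?case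
    by (auto simp: smooth_upto_0 intro: differentiable_on_add)
next
  case (Suc n)
  have *: "\<And>b. b \<in> Basis \<Longrightarrow> smooth_upto n (pd b f)" "\<And>b. b \<in> Basis \<Longrightarrow> smooth_upto n (pd b g)"
    using Suc by (auto simp: smooth_upto_Suc)
  show ?case
    apply (rule smooth_upto_SucI)
     apply (rule has_derivative_add)
      apply (rule smooth_upto_imp_deriv[OF Suc.prems(1)])
     apply (rule smooth_upto_imp_deriv[OF Suc.prems(2)])
    using Suc.IH * by simp
qed

lemma smooth_upto_bilinear:
  assumes "bounded_bilinear B"
  shows "smooth_upto n f \<Longrightarrow> smooth_upto n g \<Longrightarrow> smooth_upto n (\<lambda>x. B (f x) (g x))"
proof (induction n arbitrary: f g)
  case 0
  show ?case
    by (rule smooth_upto_0I, rule bounded_bilinear.FDERIV[OF assms])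
       (rule smooth_upto_imp_deriv[OF 0(1)], rule smooth_upto_imp_deriv[OF 0(2)])
next
  case (Suc n)
  have *: "\<And>b. b \<in> Basis \<Longrightarrow> smooth_upto n (pd b f)" "\<And>b. b \<in> Basis \<Longrightarrow> smooth_upto n (pd b g)"
    "smooth_upto n f" "smooth_upto n g"
    using Suc smooth_upto_mono[of "Suc n" _ n] by (auto simp: smooth_upto_Suc)
  show ?case
    apply (rule smooth_upto_SucI, rule bounded_bilinear.FDERIV[OF assms])
      apply (rule smooth_upto_imp_deriv[OF Suc.prems(1)])
     apply (rule smooth_upto_imp_deriv[OF Suc.prems(2)])
    using Suc.IH * by (simp add: smooth_upto_add)
qed

lemma smooth_bilinear:
  "bounded_bilinear B \<Longrightarrow> smooth f \<Longrightarrow> smooth g \<Longrightarrow> smooth (\<lambda>x. B (f x) (g x))"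
  by (simp add: smooth_iff_upto smooth_upto_bilinear)

lemma smooth_add: "smooth f \<Longrightarrow> smooth g \<Longrightarrow> smooth (\<lambda>x. f x + g x)"
  by (simp add: smooth_iff_upto smooth_upto_add)

lemma smooth_scaleR: "smooth f \<Longrightarrow> smooth g \<Longrightarrow> smooth (\<lambda>x. f x *\<^sub>R g x)"
  by (rule smooth_bilinear[OF bounded_bilinear_scaleR])

lemma smooth_mult: "smooth f \<Longrightarrow> smooth g \<Longrightarrow> smooth (\<lambda>x. f x * g x :: real)"
  by (rule smooth_bilinear[OF bounded_bilinear_mult])

lemma smooth_upto_linear:
  assumes "bounded_linear L"
  shows "smooth_upto n f \<Longrightarrow> smooth_upto n (\<lambda>x. L (f x))"
proof (induction n arbitrary: f)
  case 0
  show ?case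
    by (rule smooth_upto_0I, rule bounded_linear.has_derivative[OF assms])
       (rule smooth_upto_imp_deriv[OF 0])
next
  case (Suc n)
  then have *: "\<And>b. b \<in> Basis \<Longrightarrow> smooth_upto n (pd b f)"
    by (auto simp: smooth_upto_Suc)
  show ?case
    apply (rule smooth_upto_SucI, rule bounded_linear.has_derivative[OF assms])
     apply (rule smooth_upto_imp_deriv[OF Suc.prems(1)])
    using Suc.IH * by simp
qed

lemma smooth_linear: "bounded_linear L \<Longrightarrow> smooth f \<Longrightarrow> smooth (\<lambda>x. L (f x))"
  by (simp add: smooth_iff_upto smooth_upto_linear)

lemma smooth_minus: "smooth f \<Longrightarrow> smooth (\<lambda>x. - f x)"
  by (rule smooth_linear[OF bounded_linear_minus[OF bounded_linear_ident]])

lemma smooth_diff: "smooth f \<Longrightarrow> smooth g \<Longrightarrow> smooth (\<lambda>x. f x - g x)"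
  using smooth_add[of f "\<lambda>x. - g x"] smooth_minus[of g] by simp

lemma smooth_sum: "(\<And>i. i \<in> I \<Longrightarrow> smooth (f i)) \<Longrightarrow> smooth (\<lambda>x. \<Sum>i\<in>I. f i x)"
  by (induction I rule: infinite_finite_induct) (auto intro: smooth_add)

lemma pd_linear:
  assumes "bounded_linear L" "f differentiable (at x)"
  shows "pd b (\<lambda>x. L (f x)) x = L (pd b f x)"
  using bounded_linear.has_derivative[OF assms(1)] assms(2)
  by (metis (mono_tags) frechet_derivative_works pd_eq)

lemma pd_add:
  assumes "f differentiable (at x)" "g differentiable (at x)"
  shows "pd b (\<lambda>x. f x + g x) x = pd b f x + pd b g x"
  by (rule pd_eq[THEN trans, OF has_derivative_add])
     (use assms in \<open>auto simp: frechet_derivative_works pd_def\<close>)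

lemma pd_diff:
  assumes "f differentiable (at x)" "g differentiable (at x)"
  shows "pd b (\<lambda>x. f x - g x) x = pd b f x - pd b g x"
  by (rule pd_eq[THEN trans, OF has_derivative_diff])
     (use assms in \<open>auto simp: frechet_derivative_works pd_def\<close>)

lemma pd_bilinear:
  assumes "bounded_bilinear B" "f differentiable (at x)" "g differentiable (at x)"
  shows "pd b (\<lambda>x. B (f x) (g x)) x = B (f x) (pd b g x) + B (pd b f x) (g x)"
  by (rule pd_eq[THEN trans, OF bounded_bilinear.FDERIV[OF assms(1)]])
     (use assms in \<open>auto simp: frechet_derivative_works pd_def\<close>)

lemma pd_sum:
  assumes "\<And>i. i \<in> I \<Longrightarrow> f i differentiable (at x)"
  shows "pd b (\<lambda>x. \<Sum>i\<in>I. f i x) x = (\<Sum>i\<in>I. pd b (f i) x)"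
  by (rule pd_eq[THEN trans, OF has_derivative_sum])
     (use assms in \<open>auto simp: frechet_derivative_works pd_def\<close>)

lemma pds_linear:
  assumes "bounded_linear L" "smooth f" "set bs \<subseteq> Basis"
  shows "pds bs (\<lambda>x. L (f x)) = (\<lambda>x. L (pds bs f x))"
  using assms(3)
proof (induction bs)
  case (Cons b bs)
  then have *: "pds bs (\<lambda>x. L (f x)) = (\<lambda>x. L (pds bs f x))" "set bs \<subseteq> Basis" by auto
  show ?case unfolding pds.simps *(1)
    by (rule ext, subst pd_linear[OF assms(1)]) (auto simp: smooth_differentiable smooth_pds assms *(2))
qed simp

lemma pds_add:
  assumes "smooth f" "smooth g" "set bs \<subseteq> Basis"
  shows "pds bs (\<lambda>x. f x + g x) = (\<lambda>x. pds bs f x + pds bs g x)"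
  using assms(3)
proof (induction bs)
  case (Cons b bs)
  then have *: "pds bs (\<lambda>x. f x + g x) = (\<lambda>x. pds bs f x + pds bs g x)" "set bs \<subseteq> Basis" by auto
  show ?case unfolding pds.simps *(1)
    by (rule ext, subst pd_add) (auto simp: smooth_differentiable smooth_pds assms *(2))
qed simp

lemma pds_sum:
  assumes "\<And>i. i \<in> I \<Longrightarrow> smooth (f i)" "set bs \<subseteq> Basis"
  shows "pds bs (\<lambda>x. \<Sum>i\<in>I. f i x) = (\<lambda>x. \<Sum>i\<in>I. pds bs (f i) x)"
  using assms(2)
proof (induction bs)
  case (Cons b bs)
  then have *: "pds bs (\<lambda>x. \<Sum>i\<in>I. f i x) = (\<lambda>x. \<Sum>i\<in>I. pds bs (f i) x)" "set bs \<subseteq> Basis" by auto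
  show ?case unfolding pds.simps *(1)
    by (rule ext, subst pd_sum) (auto simp: smooth_differentiable smooth_pds assms *(2))
qed simp

section \<open>Composition with translations and dilations\<close>

lemma affine_has_derivative:
  "((\<lambda>x. p + c *\<^sub>R x :: 'a::real_normed_vector) has_derivative (\<lambda>h. c *\<^sub>R h)) (at x)"
  by (auto intro!: derivative_eq_intros)

lemma has_derivative_affine:
  fixes f :: "'a::euclidean_space \<Rightarrow> 'b::euclidean_space"
  assumes "f differentiable (at (p + c *\<^sub>R x))"
  shows "((\<lambda>x. f (p + c *\<^sub>R x)) has_derivative
     (\<lambda>h. \<Sum>i\<in>Basis. (h \<bullet> i) *\<^sub>R (c *\<^sub>R pd i f (p + c *\<^sub>R x)))) (at x)"
proof -
  have "((\<lambda>x. f (p + c *\<^sub>R x)) has_derivative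
      (\<lambda>h. \<Sum>i\<in>Basis. ((c *\<^sub>R h) \<bullet> i) *\<^sub>R pd i f (p + c *\<^sub>R x))) (at x)"
    by (rule has_derivative_compose[OF affine_has_derivative has_derivative_pd[OF assms]])
  then show ?thesis by (simp add: mult.commute)
qed

lemma pd_affine:
  fixes f :: "'a::euclidean_space \<Rightarrow> 'b::euclidean_space"
  assumes "f differentiable (at (p + c *\<^sub>R x))" "b \<in> Basis"
  shows "pd b (\<lambda>x. f (p + c *\<^sub>R x)) x = c *\<^sub>R pd b f (p + c *\<^sub>R x)"
  using pd_eq[OF has_derivative_affine[OF assms(1)], of b] by (simp only: sum_inner_Basis[OF assms(2)])

lemma smooth_upto_affine:
  fixes f :: "'a::euclidean_space \<Rightarrow> 'b::euclidean_space"
  shows "smooth_upto n f \<Longrightarrow> smooth_upto n (\<lambda>x. f (p + c *\<^sub>R x))"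
proof (induction n arbitrary: f)
  case 0
  show ?case
    by (rule smooth_upto_0I, rule has_derivative_affine)
       (use 0 in \<open>auto simp: smooth_upto_0 differentiable_on_UNIV\<close>)
next
  case (Suc n)
  then have *: "\<And>b. b \<in> Basis \<Longrightarrow> smooth_upto n (pd b f)"
    by (auto simp: smooth_upto_Suc)
  show ?case
    apply (rule smooth_upto_SucI, rule has_derivative_affine)
    subgoal for x using Suc.prems by (simp add: smooth_upto_Suc differentiable_on_UNIV)
    subgoal for b
      by (simp only: sum_inner_Basis, rule smooth_upto_linear[OF bounded_linear_scaleR_right])
        (rule Suc.IH, rule *)
    done
qed

lemma smooth_affine:
  fixes f :: "'a::euclidean_space \<Rightarrow> 'b::euclidean_space"
  shows "smooth f \<Longrightarrow> smooth (\<lambda>x. f (p + c *\<^sub>R x))"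
  by (simp add: smooth_iff_upto smooth_upto_affine)

lemma pds_affine:
  fixes f :: "'a::euclidean_space \<Rightarrow> 'b::euclidean_space"
  assumes "smooth f" "set bs \<subseteq> Basis"
  shows "pds bs (\<lambda>x. f (p + c *\<^sub>R x)) = (\<lambda>x. c ^ length bs *\<^sub>R pds bs f (p + c *\<^sub>R x))"
  using assms(2)
proof (induction bs)
  case (Cons b bs)
  have sm: "smooth (pds bs f)" using Cons smooth_pds assms by auto
  show ?case
  proof
    fix x
    have "pd b (\<lambda>x. c ^ length bs *\<^sub>R pds bs f (p + c *\<^sub>R x)) x
       = c ^ length bs *\<^sub>R pd b (\<lambda>x. pds bs f (p + c *\<^sub>R x)) x"
      by (rule pd_linear[OF bounded_linear_scaleR_right])
         (rule smooth_differentiable, rule smooth_affine, rule sm)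
    then show "pds (b # bs) (\<lambda>x. f (p + c *\<^sub>R x)) x
        = c ^ length (b # bs) *\<^sub>R pds (b # bs) f (p + c *\<^sub>R x)"
      using Cons by (simp add: pd_affine smooth_differentiable sm)
  qed
qed simp

lemma smooth_inner: "smooth (\<lambda>x::'a::euclidean_space. x \<bullet> v)"
proof -
  have "smooth_upto n (\<lambda>x::'a. x \<bullet> v)" for n
  proof (cases n)
    case 0 show ?thesis unfolding 0 by (rule smooth_upto_0I) (auto intro!: derivative_eq_intros)
  next
    case (Suc m) show ?thesis unfolding Suc
      by (rule smooth_upto_SucI[of _ "\<lambda>x h. h \<bullet> v"])
         (auto intro!: derivative_eq_intros smooth_upto_const)
  qed
  then show ?thesis by (simp add: smooth_iff_upto)
qed

lemma pd_inner: "pd b (\<lambda>x::'a::euclidean_space. x \<bullet> v) = (\<lambda>x. b \<bullet> v)"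
  by (rule ext, rule pd_eq[THEN trans]) (auto intro!: derivative_eq_intros)

subsection \<open>Differentiation under the integral sign\<close>

lemma continuous_on_slice:
  assumes "continuous_on (U \<times> S) (\<lambda>(x, z). f x z)" "x \<in> U"
  shows "continuous_on S (f x)"
proof -
  have pair: "continuous_on S (\<lambda>z. (x, z))"
    by (intro continuous_on_Pair continuous_on_const continuous_on_id)
  have "continuous_on S ((\<lambda>(x, z). f x z) \<circ> (\<lambda>z. (x, z)))"
    by (rule continuous_on_compose[OF pair], rule continuous_on_subset[OF assms(1)])
       (use assms(2) in blast)
  then show ?thesis by (simp add: o_def)
qed

text \<open>\<open>leibniz_rule\<close> wants the derivative as one continuous field of bounded
  linear maps. The field is assembled from its coordinates, and its integral is brought back to
  coordinates by evaluating at h.\<close>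

lemma has_derivative_integral:
  fixes F :: "'x::euclidean_space \<Rightarrow> 'z::euclidean_space \<Rightarrow> 'b::euclidean_space"
  assumes U: "open U" "convex U" "x0 \<in> U"
    and D: "\<And>x z. x \<in> U \<Longrightarrow> z \<in> cbox a b \<Longrightarrow>
       ((\<lambda>x. F x z) has_derivative (\<lambda>h. \<Sum>i\<in>Basis. (h \<bullet> i) *\<^sub>R G i x z)) (at x)"
    and cF: "\<And>x. x \<in> U \<Longrightarrow> continuous_on (cbox a b) (F x)"
    and cG: "\<And>i. i \<in> Basis \<Longrightarrow> continuous_on (U \<times> cbox a b) (\<lambda>(x, z). G i x z)"
  shows "((\<lambda>x. integral (cbox a b) (F x)) has_derivative
     (\<lambda>h. \<Sum>i\<in>Basis. (h \<bullet> i) *\<^sub>R integral (cbox a b) (G i x0))) (at x0)"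
proof -
  define fx where "fx x z = Blinfun (\<lambda>h. \<Sum>i\<in>Basis. (h \<bullet> i) *\<^sub>R G i x z)" for x z
  have bl: "bounded_linear (\<lambda>h. \<Sum>i\<in>Basis. (h \<bullet> i) *\<^sub>R G i x z)" for x z
    by (intro bounded_linear_intros)
  have app: "blinfun_apply (fx x z) = (\<lambda>h. \<Sum>i\<in>Basis. (h \<bullet> i) *\<^sub>R G i x z)" for x z
    unfolding fx_def by (rule bounded_linear_Blinfun_apply[OF bl])
  have cfx: "continuous_on (U \<times> cbox a b) (\<lambda>(x, z). fx x z)"
    by (rule continuous_on_blinfun_componentwise) (use cG in \<open>auto simp: app case_prod_unfold\<close>)
  have cfx0: "continuous_on (cbox a b) (fx x0)"
    by (rule continuous_on_slice[OF cfx U(3)])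
  have "((\<lambda>x. integral (cbox a b) (F x)) has_derivative integral (cbox a b) (fx x0)) (at x0 within U)"
  proof (rule leibniz_rule[OF _ _ cfx U(3,2)])
    show "((\<lambda>x. F x t) has_derivative blinfun_apply (fx x t)) (at x within U)"
      if "x \<in> U" "t \<in> cbox a b" for x t
      unfolding app by (rule has_derivative_at_withinI, rule D[OF that])
  qed (intro integrable_continuous cF)
  then have 1: "((\<lambda>x. integral (cbox a b) (F x)) has_derivative integral (cbox a b) (fx x0)) (at x0)"
    using U at_within_open by metis
  have cGz: "continuous_on (cbox a b) (G i x0)" if "i \<in> Basis" for i
    by (rule continuous_on_slice[OF cG[OF that] U(3)])
  have "blinfun_apply (integral (cbox a b) (fx x0)) h
      = (\<Sum>i\<in>Basis. (h \<bullet> i) *\<^sub>R integral (cbox a b) (G i x0))" for h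
  proof -
    have "blinfun_apply (integral (cbox a b) (fx x0)) h = integral (cbox a b) (\<lambda>z. fx x0 z h)"
      by (rule blinfun_apply_integral, rule integrable_continuous[OF cfx0])
    also have "\<dots> = (\<Sum>i\<in>Basis. integral (cbox a b) (\<lambda>z. (h \<bullet> i) *\<^sub>R G i x0 z))"
      unfolding app
      by (rule integral_sum)
         (auto intro!: integrable_continuous continuous_on_scaleR continuous_on_const cGz)
    finally show ?thesis by simp
  qed
  then have "blinfun_apply (integral (cbox a b) (fx x0))
      = (\<lambda>h. \<Sum>i\<in>Basis. (h \<bullet> i) *\<^sub>R integral (cbox a b) (G i x0))" by (rule ext)
  with 1 show ?thesis by (rule back_subst)
qed

section \<open>Derivatives along lines and symmetry of second derivatives\<close>

lemma pd_scaleR: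
  assumes "smooth f" "b \<in> Basis"
  shows "pd b (\<lambda>x. c *\<^sub>R f x) = (\<lambda>x. c *\<^sub>R pd b f x)"
  using pd_linear[OF bounded_linear_scaleR_right smooth_differentiable[OF assms(1)]] by auto

lemma smooth_line_derivative:
  assumes "smooth f"
  shows "((\<lambda>t. f (x + t *\<^sub>R v)) has_vector_derivative
     (\<Sum>i\<in>Basis. (v \<bullet> i) *\<^sub>R pd i f (x + t *\<^sub>R v))) (at t within S)"
proof -
  have 1: "((\<lambda>t. x + t *\<^sub>R v) has_derivative (\<lambda>h. h *\<^sub>R v)) (at t)"
    by (auto intro!: derivative_eq_intros)
  have "((\<lambda>t. f (x + t *\<^sub>R v)) has_vector_derivative
     (\<Sum>i\<in>Basis. (v \<bullet> i) *\<^sub>R pd i f (x + t *\<^sub>R v))) (at t)"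
    using has_derivative_compose[OF 1 smooth_has_derivative[OF assms]]
    by (simp add: has_vector_derivative_def scaleR_sum_right)
  then show ?thesis by (rule has_vector_derivative_at_within)
qed

lemma pd_line_derivative:
  assumes "smooth f" "b \<in> Basis"
  shows "((\<lambda>t. f (x + t *\<^sub>R b)) has_vector_derivative pd b f (x + t *\<^sub>R b)) (at t within S)"
  using smooth_line_derivative[OF assms(1), of x b] assms(2) by simp

text \<open>Differentiate f(x + t b) - f(x) = int_0^t (pd b f)(x + s b) ds in the direction a, under
  the integral on the right, and then in t at t = 0.\<close>

lemma pd_commute:
  assumes f: "smooth f" and ab: "a \<in> Basis" "b \<in> Basis"
  shows "pd a (pd b f) x = pd b (pd a f) x"
proof -
  have smb: "smooth (pd b f)" and sma: "smooth (pd a f)" and smab: "smooth (pd a (pd b f))"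
    using f ab smooth_pd by auto
  have ftc: "integral (cbox 0 t) (\<lambda>s. pd b f (x + s *\<^sub>R b)) = f (x + t *\<^sub>R b) - f x"
    if "0 \<le> t" for t :: real and x
  proof -
    have "((\<lambda>s. pd b f (x + s *\<^sub>R b)) has_integral (f (x + t *\<^sub>R b) - f (x + 0 *\<^sub>R b))) {0..t}"
      using that by (intro fundamental_theorem_of_calculus pd_line_derivative f ab)
    then show ?thesis by (simp add: integral_unique)
  qed
  have D: "((\<lambda>x. integral (cbox 0 t) (\<lambda>s. pd b f (x + s *\<^sub>R b))) has_derivative
     (\<lambda>h. \<Sum>i\<in>Basis. (h \<bullet> i) *\<^sub>R integral (cbox 0 t) (\<lambda>s. pd i (pd b f) (x + s *\<^sub>R b)))) (at x)"
    for t :: real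
    apply (rule has_derivative_integral[of UNIV])
         apply auto[3]
    subgoal for x s
      using has_derivative_affine[OF smooth_differentiable[OF smb], of "s *\<^sub>R b" 1 x]
      by (simp add: add.commute)
     apply (intro continuous_on_smooth_comp[OF smb] continuous_intros)
    unfolding case_prod_unfold
    by (intro continuous_on_smooth_comp[OF smooth_pd[OF smb]] continuous_intros) auto
  have eq: "integral {0..t} (\<lambda>s. pd a (pd b f) (x + s *\<^sub>R b)) = pd a f (x + t *\<^sub>R b) - pd a f x"
    if "0 \<le> t" for t :: real
  proof -
    have "pd a (\<lambda>x. f (x + t *\<^sub>R b) - f x) x = integral {0..t} (\<lambda>s. pd a (pd b f) (x + s *\<^sub>R b))"
      using pd_eq[OF D, of a t] ftc[OF that] ab by simp
    moreover have "pd a (\<lambda>x. f (x + t *\<^sub>R b) - f x) x = pd a f (x + t *\<^sub>R b) - pd a f x"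
    proof -
      have "smooth (\<lambda>x. f (x + t *\<^sub>R b))" using smooth_affine[OF f, of "t *\<^sub>R b" 1] by (simp add: add.commute)
      moreover have "pd a (\<lambda>x. f (x + t *\<^sub>R b)) x = pd a f (x + t *\<^sub>R b)"
        using pd_affine[OF smooth_differentiable[OF f], where b=a and p="t *\<^sub>R b" and c=1 and x=x] ab by (simp add: add.commute)
      ultimately show ?thesis by (simp add: pd_diff smooth_differentiable f)
    qed
    ultimately show ?thesis by simp
  qed
  \<comment> \<open>The integral identity is available for t >= 0 only, so the derivative at 0 is
    taken within {0..1}, where it is still unique.\<close>
  have "((\<lambda>t. integral {0..t} (\<lambda>s. pd a (pd b f) (x + s *\<^sub>R b))) has_vector_derivative
      pd a (pd b f) (x + 0 *\<^sub>R b)) (at 0 within {0..1})"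
    by (rule integral_has_vector_derivative) (auto intro!: continuous_on_smooth_comp[OF smab] continuous_intros)
  then have "((\<lambda>t. pd a f (x + t *\<^sub>R b) - pd a f x) has_vector_derivative
      pd a (pd b f) (x + 0 *\<^sub>R b)) (at 0 within {0..1})"
    by (rule has_vector_derivative_transform[rotated 2]) (auto simp: eq)
  moreover have "((\<lambda>t. pd a f (x + t *\<^sub>R b) - pd a f x) has_vector_derivative
      pd b (pd a f) (x + 0 *\<^sub>R b) - 0) (at 0 within {0..1})"
    by (intro has_vector_derivative_diff has_vector_derivative_const pd_line_derivative sma ab)
  ultimately show ?thesis
    using vector_derivative_unique_within_closed_interval[of 0 1 "0::real"] by fastforce
qed

subsection \<open>Averaging operators\<close>

text \<open>The integration variable may live in another space than x: a multiple m z of z gives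
  mollification, and pairs z = (t, y) give the double integral of the parametrix, so the lemmas
  below cover both.\<close>

definition avg :: "('z::euclidean_space \<Rightarrow> real) \<Rightarrow> ('z \<Rightarrow> 'a::euclidean_space) \<Rightarrow> 'z \<Rightarrow> 'z
    \<Rightarrow> ('a \<Rightarrow> 'b::euclidean_space) \<Rightarrow> 'a \<Rightarrow> 'b" where
  "avg k m a b f x = integral (cbox a b) (\<lambda>z. k z *\<^sub>R f (x - m z))"

context
  fixes k :: "'z::euclidean_space \<Rightarrow> real" and m :: "'z \<Rightarrow> 'a::euclidean_space" and a b :: 'z
  assumes k: "continuous_on (cbox a b) k" and m: "continuous_on (cbox a b) m"
begin

lemma avg_integrable:
  fixes f :: "'a \<Rightarrow> 'b::euclidean_space"
  assumes "continuous_on UNIV f"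
  shows "(\<lambda>z. k z *\<^sub>R f (x - m z)) integrable_on (cbox a b)"
  by (intro integrable_continuous continuous_intros k m continuous_on_compose2[OF assms]) auto

lemma avg_has_derivative:
  fixes f :: "'a \<Rightarrow> 'b::euclidean_space"
  assumes f: "smooth f"
  shows "(avg k m a b f has_derivative (\<lambda>h. \<Sum>i\<in>Basis. (h \<bullet> i) *\<^sub>R avg k m a b (pd i f) x)) (at x)"
  unfolding avg_def[abs_def]
  apply (rule has_derivative_integral[of UNIV])
       apply auto[3]
  subgoal for x z
    using has_derivative_scaleR_right[OF has_derivative_affine[OF smooth_differentiable[OF f], of "- m z" 1 x], of "k z"]
    by (simp add: scaleR_sum_right mult.commute)
   apply (intro continuous_on_smooth_comp[OF f] continuous_intros k m)
  unfolding case_prod_unfold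
  apply (intro continuous_intros continuous_on_smooth_comp[OF smooth_pd[OF f]])
  by (auto intro!: continuous_on_compose2[OF k] continuous_on_compose2[OF m] continuous_intros)

lemma smooth_avg:
  fixes f :: "'a \<Rightarrow> 'b::euclidean_space"
  assumes "smooth f"
  shows "smooth (avg k m a b f)"
proof -
  have "smooth f \<Longrightarrow> smooth_upto n (avg k m a b f)" for n and f :: "'a \<Rightarrow> 'b"
  proof (induction n arbitrary: f)
    case 0 show ?case by (rule smooth_upto_0I, rule avg_has_derivative, rule 0)
  next
    case (Suc n)
    show ?case by (rule smooth_upto_SucI, rule avg_has_derivative, rule Suc)
       (use Suc in \<open>auto intro: smooth_pd\<close>)
  qed
  then show ?thesis using assms by (simp add: smooth_iff_upto)
qed

lemma pd_avg:
  fixes f :: "'a \<Rightarrow> 'b::euclidean_space"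
  assumes "smooth f" "i \<in> Basis"
  shows "pd i (avg k m a b f) = avg k m a b (pd i f)"
  using pd_eq[OF avg_has_derivative[OF assms(1)], of i] assms(2) by (auto simp: fun_eq_iff)

lemma pds_avg:
  fixes f :: "'a \<Rightarrow> 'b::euclidean_space"
  assumes "smooth f" "set bs \<subseteq> Basis"
  shows "pds bs (avg k m a b f) = avg k m a b (pds bs f)"
  using assms(2)
  by (induction bs) (auto simp: pd_avg smooth_pds assms)

text \<open>The bound on f is asked for only where k is nonzero: the kernels live on a ball inside
  the box of integration, and estimates on balls need this gain.\<close>

lemma norm_avg_le:
  fixes f :: "'a \<Rightarrow> 'b::euclidean_space"
  assumes "continuous_on UNIV f" "\<And>z. z \<in> cbox a b \<Longrightarrow> k z \<noteq> 0 \<Longrightarrow> norm (f (x - m z)) \<le> S"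
  shows "norm (avg k m a b f x) \<le> integral (cbox a b) (\<lambda>z. \<bar>k z\<bar>) * S"
proof -
  have "norm (avg k m a b f x) \<le> integral (cbox a b) (\<lambda>z. \<bar>k z\<bar> * S)"
    unfolding avg_def
  proof (rule integral_norm_bound_integral[OF avg_integrable[OF assms(1)]])
    show "(\<lambda>z. \<bar>k z\<bar> * S) integrable_on cbox a b"
      by (intro integrable_continuous continuous_intros k)
    show "norm (k z *\<^sub>R f (x - m z)) \<le> \<bar>k z\<bar> * S" if "z \<in> cbox a b" for z
      using assms(2)[OF that] by (cases "k z = 0") (auto intro: mult_left_mono)
  qed
  then show ?thesis by simp
qed

lemma avg_diff:
  fixes f :: "'a \<Rightarrow> 'b::euclidean_space"
  assumes "continuous_on UNIV f" "continuous_on UNIV g"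
  shows "avg k m a b (\<lambda>x. f x - g x) x = avg k m a b f x - avg k m a b g x"
  unfolding avg_def
  by (subst integral_diff[symmetric]) (auto simp: scaleR_diff_right avg_integrable assms)

lemma avg_add:
  fixes f :: "'a \<Rightarrow> 'b::euclidean_space"
  assumes "continuous_on UNIV f" "continuous_on UNIV g"
  shows "avg k m a b (\<lambda>x. f x + g x) x = avg k m a b f x + avg k m a b g x"
  unfolding avg_def
  by (subst integral_add[symmetric]) (auto simp: scaleR_add_right avg_integrable assms)

lemma avg_sum:
  fixes f :: "'i \<Rightarrow> 'a \<Rightarrow> 'b::euclidean_space"
  assumes "finite I" "\<And>i. i \<in> I \<Longrightarrow> continuous_on UNIV (f i)"
  shows "avg k m a b (\<lambda>x. \<Sum>i\<in>I. f i x) x = (\<Sum>i\<in>I. avg k m a b (f i) x)"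
  unfolding avg_def
  by (subst integral_sum[symmetric]) (auto simp: scaleR_sum_right avg_integrable assms)

lemma avg_linear:
  fixes f :: "'a \<Rightarrow> 'b::euclidean_space" and L :: "'b \<Rightarrow> 'c::euclidean_space"
  assumes "continuous_on UNIV f" "bounded_linear L"
  shows "avg k m a b (\<lambda>x. L (f x)) x = L (avg k m a b f x)"
proof -
  interpret L: bounded_linear L by fact
  show ?thesis
  unfolding avg_def
  by (subst integral_linear[OF avg_integrable[OF assms(1)] assms(2), symmetric])
     (simp add: o_def L.scaleR)
qed

end

section \<open>Integrals of derivatives, and convolution with smooth kernels\<close>

lemma pd_zero_outside:
  fixes f :: "'a::euclidean_space \<Rightarrow> 'b::euclidean_space"
  assumes "closed K" "\<And>x. x \<notin> K \<Longrightarrow> f x = 0" "x \<notin> K"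
  shows "pd i f x = 0"
  using pd_cong_open[of "- K" x f "\<lambda>x. 0" i] assms by auto

lemma pds_zero_outside:
  fixes f :: "'a::euclidean_space \<Rightarrow> 'b::euclidean_space"
  assumes "closed K" "\<And>x. x \<notin> K \<Longrightarrow> f x = 0" "x \<notin> K"
  shows "pds bs f x = 0"
  using pds_cong_open[of "- K" x f "\<lambda>x. 0" bs] assms by auto

text \<open>All translates of F have the same integral. Differentiating this constant with respect
  to the shift t at t = 0 gives the claim.\<close>

lemma integral_pd_zero:
  fixes F :: "'a::euclidean_space \<Rightarrow> 'b::euclidean_space"
  assumes F: "smooth F" and z: "\<And>x. x \<notin> cbox a b \<Longrightarrow> F x = 0" and i: "i \<in> Basis"
  shows "integral (cbox a b) (pd i F) = 0"
proof -
  \<comment> \<open>One unit of room on each side, so that the translates by at most 1 keep their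
    supports in a single box.\<close>
  define a' b' where "a' = a - One" and "b' = b + One"
  have sub: "cbox (a - t *\<^sub>R i) (b - t *\<^sub>R i) \<subseteq> cbox a' b'" if "\<bar>t\<bar> \<le> 1" for t
    using that i unfolding a'_def b'_def subset_box
    by (auto simp: inner_Basis inner_diff_left inner_add_left)
  have I: "integral (cbox a' b') (\<lambda>y. F (y + t *\<^sub>R i)) = integral (cbox a b) F" if "t \<in> ball 0 1" for t
  proof (rule integral_unique)
    have "(F has_integral integral (cbox a b) F) (cbox a b)"
      by (intro integrable_integral integrable_continuous smooth_continuous_on F)
    then have "((F \<circ> (+) (t *\<^sub>R i)) has_integral integral (cbox a b) F) (cbox (a - t *\<^sub>R i) (b - t *\<^sub>R i))"
      by (simp add: has_integral_shift_cbox_iff)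
    then have "((F \<circ> (+) (t *\<^sub>R i)) has_integral integral (cbox a b) F) (cbox a' b')"
      apply (rule has_integral_on_superset)
       apply (use sub[of t] that in \<open>auto intro!: z simp: mem_box inner_diff_left inner_add_left algebra_simps\<close>)
      done
    then show "((\<lambda>y. F (y + t *\<^sub>R i)) has_integral integral (cbox a b) F) (cbox a' b')"
      by (simp add: o_def add.commute)
  qed
  have D: "((\<lambda>t. integral (cbox a' b') (\<lambda>y. F (y + t *\<^sub>R i))) has_derivative
     (\<lambda>h. \<Sum>j\<in>Basis. (h \<bullet> j) *\<^sub>R integral (cbox a' b') (\<lambda>y. pd i F (y + 0 *\<^sub>R i)))) (at (0::real))"
    apply (rule has_derivative_integral[of UNIV _ _ _ _ "\<lambda>_ t y. pd i F (y + t *\<^sub>R i)"])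
         apply auto[3]
    subgoal for t y using pd_line_derivative[OF F i, of y t UNIV] by (simp add: has_vector_derivative_def)
     apply (intro continuous_on_smooth_comp[OF F] continuous_intros)
    unfolding case_prod_unfold
    by (intro continuous_on_smooth_comp[OF smooth_pd[OF F i]] continuous_intros)
  have "((\<lambda>t. integral (cbox a b) F) has_derivative
     (\<lambda>h. \<Sum>j\<in>Basis. (h \<bullet> j) *\<^sub>R integral (cbox a' b') (\<lambda>y. pd i F (y + 0 *\<^sub>R i)))) (at (0::real))"
    by (rule has_derivative_transform_within_open[OF D, of "ball 0 1"]) (use I in auto)
  then have "(\<lambda>h. \<Sum>j\<in>Basis. (h \<bullet> j) *\<^sub>R integral (cbox a' b') (\<lambda>y. pd i F (y + 0 *\<^sub>R i))) = (\<lambda>h::real. 0)"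
    by (rule has_derivative_unique) (rule has_derivative_const)
  from fun_cong[OF this, of 1] have "integral (cbox a' b') (pd i F) = 0" by simp
  moreover have "(pd i F has_integral integral (cbox a b) (pd i F)) (cbox a' b')"
    apply (rule has_integral_on_superset[of _ _ "cbox a b"])
      apply (intro integrable_integral integrable_continuous smooth_continuous_on smooth_pd F i)
     apply (rule pd_zero_outside[of "cbox a b"], use z in auto)[1]
    using sub[of 0] by auto
  ultimately show ?thesis by (simp add: integral_unique)
qed

lemma integral_reflect_shift:
  fixes F :: "'a::euclidean_space \<Rightarrow> 'b::euclidean_space"
  assumes "F integrable_on cbox a b" "\<And>y. y \<notin> cbox a b \<Longrightarrow> F y = 0"
    "cbox (x - b) (x - a) \<subseteq> cbox p q"
  shows "((\<lambda>z. F (x - z)) has_integral integral (cbox a b) F) (cbox p q)"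
proof -
  have "((\<lambda>z. F ((-1) *\<^sub>R z + x)) has_integral (1 / (\<bar>-1\<bar> ^ DIM('a))) *\<^sub>R integral (cbox a b) F)
     ((\<lambda>z. (1 / (-1)) *\<^sub>R z + -((1 / (-1)) *\<^sub>R x)) ` cbox a b)"
    by (rule has_integral_affinity) (use assms in auto)
  moreover have "((\<lambda>z. (1 / (-1)) *\<^sub>R z + -((1 / (-1)) *\<^sub>R x)) ` cbox a b) = cbox (x - b) (x - a)"
  proof -
    have "y \<in> cbox (x - b) (x - a) \<Longrightarrow> y = x - (x - y) \<and> x - y \<in> cbox a b" for y
      by (auto simp: mem_box inner_diff_left algebra_simps)
    moreover have "y \<in> cbox a b \<Longrightarrow> x - y \<in> cbox (x - b) (x - a)" for y
      by (auto simp: mem_box inner_diff_left)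
    ultimately have "(\<lambda>z. x - z) ` cbox a b = cbox (x - b) (x - a)" by blast
    then show ?thesis by (simp add: image_def)
  qed
  ultimately have "((\<lambda>z. F (x - z)) has_integral integral (cbox a b) F) (cbox (x - b) (x - a))"
    by simp
  then show ?thesis
    by (rule has_integral_on_superset)
       (use assms in \<open>auto intro!: assms(2) simp: mem_box inner_diff_left algebra_simps\<close>)
qed

text \<open>The substitution y = x - z moves the point x from f into the kernel, so that derivatives
  can fall on a smooth k while f is merely continuous.\<close>

lemma conv_eq:
  fixes f :: "'a::euclidean_space \<Rightarrow> 'b::euclidean_space"
  assumes "continuous_on UNIV k" "\<And>y. y \<notin> cbox a b \<Longrightarrow> k y = 0" "continuous_on UNIV f"
    "cbox (x - b) (x - a) \<subseteq> cbox p q"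
  shows "avg k (\<lambda>y. y) a b f x = integral (cbox p q) (\<lambda>z. k (x - z) *\<^sub>R f z)"
proof -
  have "(\<lambda>y. k y *\<^sub>R f (x - y)) integrable_on cbox a b"
    by (rule avg_integrable[OF continuous_on_subset[OF assms(1)] continuous_on_id assms(3)]) simp
  from integral_reflect_shift[OF this _ assms(4)] assms(2)
  show ?thesis unfolding avg_def by (simp add: integral_unique)
qed

text \<open>For f supported in a box, the domain of integration no longer depends on x. This allows
  a bound by the volume of the support, and Riemann sums in \<open>dist_moll\<close>.\<close>

lemma conv_eq_support:
  fixes f :: "'a::euclidean_space \<Rightarrow> 'b::euclidean_space"
  assumes k: "continuous_on UNIV k" "\<And>y. y \<notin> cbox a b \<Longrightarrow> k y = 0"
    and f: "continuous_on UNIV f" "\<And>x. x \<notin> cbox p q \<Longrightarrow> f x = 0"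
  shows "(\<lambda>z. k (x - z) *\<^sub>R f z) integrable_on cbox p q"
    "avg k (\<lambda>y. y) a b f x = integral (cbox p q) (\<lambda>z. k (x - z) *\<^sub>R f z)"
proof -
  show int: "(\<lambda>z. k (x - z) *\<^sub>R f z) integrable_on cbox p q"
    by (intro integrable_continuous continuous_intros continuous_on_compose2[OF k(1)]
        continuous_on_subset[OF f(1)]) auto
  have "bounded (cbox (x - b) (x - a) \<union> cbox p q)" by simp
  then obtain r where r: "cbox (x - b) (x - a) \<union> cbox p q \<subseteq> cbox (- r) r"
    by (rule bounded_subset_cbox_symmetric)
  have "avg k (\<lambda>y. y) a b f x = integral (cbox (- r) r) (\<lambda>z. k (x - z) *\<^sub>R f z)"
    by (rule conv_eq[OF k f(1)]) (use r in auto)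
  also have "\<dots> = integral (cbox p q) (\<lambda>z. k (x - z) *\<^sub>R f z)"
    by (rule integral_unique, rule has_integral_on_superset[OF integrable_integral[OF int]])
       (use r f(2) in auto)
  finally show "avg k (\<lambda>y. y) a b f x = integral (cbox p q) (\<lambda>z. k (x - z) *\<^sub>R f z)" .
qed

lemma conv_has_derivative:
  fixes f :: "'a::euclidean_space \<Rightarrow> 'b::euclidean_space"
  assumes k: "smooth k" "\<And>y. y \<notin> cbox a b \<Longrightarrow> k y = 0" and f: "continuous_on UNIV f"
  shows "(avg k (\<lambda>y. y) a b f has_derivative
     (\<lambda>h. \<Sum>i\<in>Basis. (h \<bullet> i) *\<^sub>R avg (pd i k) (\<lambda>y. y) a b f x)) (at x)"
proof -
  have ck: "continuous_on UNIV k" by (rule smooth_continuous_on[OF k(1)])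
  have ck': "continuous_on UNIV (pd i k)" if "i \<in> Basis" for i
    by (rule smooth_continuous_on[OF smooth_pd[OF k(1) that]])
  have z': "pd i k y = 0" if "y \<notin> cbox a b" for i y
    by (rule pd_zero_outside[of "cbox a b"]) (use k that in auto)
  \<comment> \<open>Differentiation under the integral needs one box for all points near x; the
    extra unit makes it serve the whole ball of radius 1.\<close>
  define p q where "p = x - b - One" and "q = x - a + One"
  have sub: "cbox (y - b) (y - a) \<subseteq> cbox p q" if "y \<in> ball x 1" for y
  proof -
    have *: "\<bar>(y - x) \<bullet> i\<bar> \<le> 1" if "i \<in> Basis" for i
      using Basis_le_norm[OF that, of "y - x"] \<open>y \<in> ball x 1\<close> by (auto simp: dist_norm norm_minus_commute)
    show ?thesis unfolding subset_box p_def q_def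
      using * by (fastforce simp: inner_diff_left inner_add_left abs_le_iff)
  qed
  have D: "((\<lambda>y. integral (cbox p q) (\<lambda>z. k (y - z) *\<^sub>R f z)) has_derivative
      (\<lambda>h. \<Sum>i\<in>Basis. (h \<bullet> i) *\<^sub>R integral (cbox p q) (\<lambda>z. pd i k (x - z) *\<^sub>R f z))) (at x)"
    apply (rule has_derivative_integral[of UNIV])
         apply auto[3]
    subgoal for x z
      using has_derivative_scaleR_left[OF has_derivative_affine[OF smooth_differentiable[OF k(1)], of "- z" 1 x], of "f z"]
      by (simp add: scaleR_sum_left)
     apply (intro continuous_intros continuous_on_smooth_comp[OF k(1)] continuous_on_subset[OF f], simp)
    unfolding case_prod_unfold
    by (intro continuous_intros continuous_on_smooth_comp[OF smooth_pd[OF k(1)]]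
      continuous_on_compose2[OF f]) auto
  have "(avg k (\<lambda>y. y) a b f has_derivative
      (\<lambda>h. \<Sum>i\<in>Basis. (h \<bullet> i) *\<^sub>R integral (cbox p q) (\<lambda>z. pd i k (x - z) *\<^sub>R f z))) (at x)"
    by (rule has_derivative_transform_within_open[OF D, of "ball x 1"])
       (use conv_eq[OF ck k(2) f sub] in auto)
  moreover have "integral (cbox p q) (\<lambda>z. pd i k (x - z) *\<^sub>R f z) = avg (pd i k) (\<lambda>y. y) a b f x"
    if "i \<in> Basis" for i
    using conv_eq[OF ck'[OF that] z' f sub[of x]] by simp
  ultimately show ?thesis by simp
qed

lemma smooth_conv:
  fixes f :: "'a::euclidean_space \<Rightarrow> 'b::euclidean_space"
  assumes "smooth k" "\<And>y. y \<notin> cbox a b \<Longrightarrow> k y = 0" and f: "continuous_on UNIV f"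
  shows "smooth (avg k (\<lambda>y. y) a b f)"
proof -
  have "smooth k \<Longrightarrow> (\<And>y. y \<notin> cbox a b \<Longrightarrow> k y = 0) \<Longrightarrow> smooth_upto n (avg k (\<lambda>y. y) a b f)" for n k
  proof (induction n arbitrary: k)
    case 0 show ?case by (rule smooth_upto_0I, rule conv_has_derivative) (use 0 f in auto)
  next
    case (Suc n)
    have "smooth_upto n (avg (pd i k) (\<lambda>y. y) a b f)" if "i \<in> Basis" for i
      by (rule Suc.IH[OF smooth_pd[OF Suc.prems(1) that]])
        (rule pd_zero_outside[OF closed_cbox Suc.prems(2)], auto)
    then show ?case
      using smooth_upto_SucI[OF conv_has_derivative[OF Suc.prems f]] by simp
  qed
  then show ?thesis using assms by (simp add: smooth_iff_upto)
qed

lemma pd_conv: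
  fixes f :: "'a::euclidean_space \<Rightarrow> 'b::euclidean_space"
  assumes "smooth k" "\<And>y. y \<notin> cbox a b \<Longrightarrow> k y = 0" "continuous_on UNIV f" "i \<in> Basis"
  shows "pd i (avg k (\<lambda>y. y) a b f) = avg (pd i k) (\<lambda>y. y) a b f"
proof
  fix x
  have "pd i (avg k (\<lambda>y. y) a b f) x
      = (\<Sum>j\<in>Basis. (i \<bullet> j) *\<^sub>R avg (pd j k) (\<lambda>y. y) a b f x)"
    by (rule pd_eq[OF conv_has_derivative]) (use assms in auto)
  then show "pd i (avg k (\<lambda>y. y) a b f) x = avg (pd i k) (\<lambda>y. y) a b f x"
    using assms(4) by simp
qed

lemma pds_conv:
  fixes f :: "'a::euclidean_space \<Rightarrow> 'b::euclidean_space"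
  assumes k: "smooth k" "\<And>y. y \<notin> cbox a b \<Longrightarrow> k y = 0" and f: "continuous_on UNIV f"
    and bs: "set bs \<subseteq> Basis"
  shows "pds bs (avg k (\<lambda>y. y) a b f) = avg (pds bs k) (\<lambda>y. y) a b f"
  using bs
proof (induction bs)
  case (Cons i bs)
  have "pds bs k y = 0" if "y \<notin> cbox a b" for y
    by (rule pds_zero_outside[OF closed_cbox k(2) that])
  then show ?case
    using Cons pd_conv[OF smooth_pds[OF k(1)] _ f] by auto
qed simp

subsection \<open>A radial bump function\<close>

text \<open>The functions p(1/s) exp(-1/s), extended by 0 to s <= 0, are closed under
  differentiation, with p passing to X^2 (p - p'). This closes the induction for smoothness.\<close>

definition exp_inv :: "real poly \<Rightarrow> real \<Rightarrow> real" where
  "exp_inv p s = (if 0 < s then poly p (inverse s) * exp (- inverse s) else 0)"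

lemma poly_exp_tendsto_0: "((\<lambda>u. poly p u * exp (- u)) \<longlongrightarrow> 0) (at_top :: real filter)"
proof -
  have "((\<lambda>u. \<Sum>i\<le>degree p. coeff p i * (u ^ i / exp u)) \<longlongrightarrow> (\<Sum>i\<le>degree p. coeff p i * 0)) (at_top :: real filter)"
    by (intro tendsto_sum tendsto_mult tendsto_const tendsto_power_div_exp_0)
  then show ?thesis
    by (simp add: poly_altdef exp_minus sum_distrib_right divide_inverse mult.assoc)
qed

lemma exp_inv_has_derivative:
  "(exp_inv p has_real_derivative exp_inv (monom 1 2 * (p - pderiv p)) s) (at s)"
proof -
  consider "s < 0" | "s = 0" | "s > 0" by linarith
  then show ?thesis
  proof cases
    case 1
    have "((\<lambda>_. 0) has_real_derivative 0) (at s)" by simp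
    then have "(exp_inv p has_real_derivative 0) (at s)"
      by (rule has_field_derivative_transform_within_open[of _ _ _ "{..<0}"])
         (use 1 in \<open>auto simp: exp_inv_def\<close>)
    then show ?thesis using 1 by (simp add: exp_inv_def)
  next
    case 2
    have "((\<lambda>h. exp_inv p h / h) \<longlongrightarrow> 0) (at_right 0)"
    proof -
      \<comment> \<open>\<open>pCons 0 p\<close> is X p: the factor 1/h of the difference quotient
        is absorbed into the polynomial.\<close>
      have "((\<lambda>h. poly (pCons 0 p) (inverse h) * exp (- inverse h)) \<longlongrightarrow> 0) (at_right (0::real))"
        by (rule filterlim_compose[OF poly_exp_tendsto_0 filterlim_inverse_at_top_right])
      moreover have "\<forall>\<^sub>F h in at_right 0. poly (pCons 0 p) (inverse h) * exp (- inverse h) = exp_inv p h / h"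
        by (rule eventually_at_right_less[THEN eventually_mono]) (auto simp: exp_inv_def field_simps)
      ultimately show ?thesis by (rule Lim_transform_eventually)
    qed
    moreover have "((\<lambda>h. exp_inv p h / h) \<longlongrightarrow> 0) (at_left 0)"
    proof (rule Lim_transform_eventually[OF tendsto_const])
      show "\<forall>\<^sub>F h in at_left 0. 0 = exp_inv p h / h"
        by (auto simp: eventually_at_filter exp_inv_def)
    qed
    ultimately have "((\<lambda>h. exp_inv p h / h) \<longlongrightarrow> 0) (at 0)"
      by (simp add: filterlim_split_at)
    then show ?thesis unfolding 2 DERIV_def by (simp add: exp_inv_def)
  next
    case 3
    have "((\<lambda>s. poly p (inverse s) * exp (- inverse s)) has_real_derivative
        exp_inv (monom 1 2 * (p - pderiv p)) s) (at s)"
      using 3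
      by (auto intro!: derivative_eq_intros poly_DERIV[THEN DERIV_chain2]
          simp: exp_inv_def poly_monom power2_eq_square algebra_simps)
    then show ?thesis
      by (rule has_field_derivative_transform_within_open[of _ _ _ "{0<..}"])
         (use 3 in \<open>auto simp: exp_inv_def\<close>)
  qed
qed

lemma exp_inv_comp_has_derivative:
  fixes q :: "'a::euclidean_space \<Rightarrow> real"
  assumes "(q has_derivative q') (at x)"
  shows "((\<lambda>x. exp_inv p (q x)) has_derivative
     (\<lambda>h. exp_inv (monom 1 2 * (p - pderiv p)) (q x) * q' h)) (at x)"
  using has_derivative_compose[OF assms exp_inv_has_derivative[unfolded has_field_derivative_def]] .

lemma smooth_exp_inv_comp:
  fixes q :: "'a::euclidean_space \<Rightarrow> real"
  assumes "smooth q"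
  shows "smooth (\<lambda>x. exp_inv p (q x))"
proof -
  have "smooth_upto n (\<lambda>x. exp_inv p (q x))" for n p
  proof (induction n arbitrary: p)
    case 0 show ?case
      by (rule smooth_upto_0I, rule exp_inv_comp_has_derivative, rule smooth_has_derivative[OF assms])
  next
    case (Suc n)
    show ?case
    proof (rule smooth_upto_SucI, rule exp_inv_comp_has_derivative, rule smooth_has_derivative[OF assms])
      fix b :: 'a assume b: "b \<in> Basis"
      have "smooth_upto n (pd b q)" using smooth_pd[OF assms b] by (simp add: smooth_iff_upto)
      then show "smooth_upto n (\<lambda>x. exp_inv (monom 1 2 * (p - pderiv p)) (q x) * (\<Sum>i\<in>Basis. (b \<bullet> i) *\<^sub>R pd i q x))"
        unfolding sum_inner_Basis[OF b] by (intro smooth_upto_bilinear[OF bounded_bilinear_mult] Suc.IH)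
    qed
  qed
  then show ?thesis by (simp add: smooth_iff_upto)
qed

lemma smooth_ident: "smooth (\<lambda>x. x)"
proof -
  have "smooth_upto (Suc n) (\<lambda>x::'a::euclidean_space. x)" for n
    by (rule smooth_upto_SucI[OF has_derivative_ident smooth_upto_const])
  then show ?thesis using smooth_upto_mono[of "Suc _"] by (meson le_Suc_eq order_refl smooth_iff_upto)
qed

lemma smooth_one_minus_norm: "smooth (\<lambda>x::'a::euclidean_space. 1 - x \<bullet> x)"
  by (intro smooth_diff smooth_const smooth_bilinear[OF bounded_bilinear_inner] smooth_ident)

text \<open>The polynomial X^2 makes the profile the derivative of \<open>exp_inv 1\<close>, so that
  x times the bump is an explicit gradient.\<close>

definition pre_rho :: "'a::euclidean_space \<Rightarrow> real" where
  "pre_rho x = exp_inv (monom 1 2) (1 - x \<bullet> x)"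

definition rho_mass :: "'a::euclidean_space itself \<Rightarrow> real" where
  "rho_mass _ = integral (cbox (- One) One) (pre_rho :: 'a \<Rightarrow> real)"

definition rho :: "'a::euclidean_space \<Rightarrow> real" where
  "rho x = pre_rho x / rho_mass TYPE('a)"

text \<open>The normalisation makes \<open>sigma\<close> a radial potential: its gradient is \<open>rho x *\<^sub>R x\<close>.\<close>

definition sigma :: "'a::euclidean_space \<Rightarrow> real" where
  "sigma x = - exp_inv 1 (1 - x \<bullet> x) / (2 * rho_mass TYPE('a))"

lemma smooth_pre_rho: "smooth pre_rho"
  unfolding pre_rho_def[abs_def] by (rule smooth_exp_inv_comp[OF smooth_one_minus_norm])

lemma rho_mass_pos: "rho_mass TYPE('a::euclidean_space) > 0"
proof -
  have nn: "pre_rho x \<ge> 0" for x :: 'a by (auto simp: pre_rho_def exp_inv_def poly_monom)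
  have "integral (cbox (- One) One) (pre_rho :: 'a \<Rightarrow> real) \<ge> 0"
    by (intro integral_nonneg integrable_continuous smooth_continuous_on smooth_pre_rho) (rule nn)
  moreover have "integral (cbox (- One) One) (pre_rho :: 'a \<Rightarrow> real) \<noteq> 0"
  proof
    assume "integral (cbox (- One) One) (pre_rho :: 'a \<Rightarrow> real) = 0"
    then have "\<forall>x\<in>cbox (-One) One. pre_rho (x::'a) = 0"
      by (subst (asm) integral_cbox_eq_0_iff)
         (auto intro: smooth_continuous_on smooth_pre_rho nn simp: box_ne_empty)
    then have "pre_rho (0::'a) = 0" by (simp add: mem_box)
    then show False by (simp add: pre_rho_def exp_inv_def poly_monom)
  qed
  ultimately show ?thesis unfolding rho_mass_def by simp
qed

lemma smooth_rho: "smooth rho"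
  unfolding rho_def[abs_def] divide_inverse
  by (intro smooth_mult smooth_const smooth_pre_rho)

lemma smooth_sigma: "smooth sigma"
  unfolding sigma_def[abs_def] divide_inverse
  by (intro smooth_mult smooth_minus smooth_const smooth_exp_inv_comp smooth_one_minus_norm)

lemma rho_nonneg: "rho x \<ge> 0"
  using rho_mass_pos[where 'a='a] by (auto simp: rho_def pre_rho_def exp_inv_def poly_monom)

lemma inner_lt_1: "0 < 1 - x \<bullet> x \<Longrightarrow> norm (x::'a::euclidean_space) < 1"
  by (simp add: power2_norm_eq_inner[symmetric] abs_square_less_1)

lemma rho_support: "rho x \<noteq> 0 \<Longrightarrow> norm x < 1"
  by (auto simp: rho_def pre_rho_def exp_inv_def split: if_splits intro: inner_lt_1)

lemma sigma_support: "sigma x \<noteq> 0 \<Longrightarrow> norm x < 1"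
  by (auto simp: sigma_def exp_inv_def split: if_splits intro: inner_lt_1)

lemma norm_le_cbox: "norm x \<le> 1 \<Longrightarrow> x \<in> cbox (- One) (One::'a::euclidean_space)"
  using Basis_le_norm[of _ x] by (fastforce simp: mem_box abs_le_iff)

lemma rho_outside: "y \<notin> cbox (- One) One \<Longrightarrow> rho y = 0"
  using rho_support norm_le_cbox by force

lemma sigma_outside: "y \<notin> cbox (- One) One \<Longrightarrow> sigma y = 0"
  using sigma_support norm_le_cbox by force

lemma integral_rho: "integral (cbox (- One) One) (rho :: 'a::euclidean_space \<Rightarrow> real) = 1"
  using rho_mass_pos[where 'a='a] unfolding rho_def[abs_def] by (simp add: rho_mass_def)

lemma pd_sigma:
  assumes "i \<in> Basis"
  shows "pd i sigma x = (x \<bullet> i) * rho x"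
proof -
  have 1: "((\<lambda>x::'a. 1 - x \<bullet> x) has_derivative (\<lambda>h. - (2 * (h \<bullet> x)))) (at x)"
    by (auto intro!: derivative_eq_intros simp: inner_commute)
  have eq: "sigma = (\<lambda>x::'a. exp_inv 1 (1 - x \<bullet> x) * (- (1 / (2 * rho_mass TYPE('a)))))"
    by (simp add: sigma_def fun_eq_iff)
  have "pd i sigma x = exp_inv (monom 1 2 * (1 - pderiv 1)) (1 - x \<bullet> x) * - (2 * (i \<bullet> x))
      * (- (1 / (2 * rho_mass TYPE('a))))"
    unfolding eq by (rule pd_eq[OF has_derivative_mult_left[OF exp_inv_comp_has_derivative[OF 1]]])
  then show ?thesis
    by (simp add: rho_def pre_rho_def inner_commute)
qed

subsection \<open>The Laplacian and the mean value identity\<close>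

definition lap :: "('a::euclidean_space \<Rightarrow> 'b::euclidean_space) \<Rightarrow> 'a \<Rightarrow> 'b" where
  "lap f x = (\<Sum>i\<in>Basis. pd i (pd i f) x)"

lemma smooth_lap: "smooth f \<Longrightarrow> smooth (lap f)"
  unfolding lap_def[abs_def] by (intro smooth_sum smooth_pd)

text \<open>Convolution with rho rescaled to radius t, written after the substitution that leaves
  the kernel fixed. In this form t = 0 is allowed and gives f back.\<close>

definition moll :: "real \<Rightarrow> ('a::euclidean_space \<Rightarrow> 'b::euclidean_space) \<Rightarrow> 'a \<Rightarrow> 'b" where
  "moll t = avg rho (\<lambda>y. t *\<^sub>R y) (- One) One"

text \<open>The integrals over t and y form one average over a product box, so the general lemmas on
  \<open>avg\<close> apply directly.\<close>

definition parametrix :: "real \<Rightarrow> ('a::euclidean_space \<Rightarrow> 'b::euclidean_space) \<Rightarrow> 'a \<Rightarrow> 'b" where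
  "parametrix T = avg (\<lambda>(t, y). t * sigma y) (\<lambda>(t, y). t *\<^sub>R y) (0, - One) (T, One)"

lemma moll_weight:
  "continuous_on (cbox (- One) One) rho" "continuous_on (cbox (- One) One) (\<lambda>y. t *\<^sub>R y)"
  by (rule smooth_continuous_on[OF smooth_rho]) (intro continuous_intros)

lemma parametrix_weight:
  "continuous_on (cbox (0, - One) (T, One)) (\<lambda>(t, y). t * sigma y)"
  "continuous_on (cbox (0, - One) (T, One)) (\<lambda>(t, y). t *\<^sub>R y)"
  unfolding case_prod_unfold
  by (intro continuous_intros continuous_on_smooth_comp[OF smooth_sigma])+

lemma moll_0: "moll 0 f (x::'a::euclidean_space) = f x"
  using integral_linear[OF _ bounded_linear_scaleR_left[of "f x"], of "rho :: 'a \<Rightarrow> real" "cbox (- One) One"]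
  by (simp add: moll_def avg_def integral_rho o_def integrable_continuous smooth_continuous_on smooth_rho)

text \<open>The t-derivative brings down -y, and y times rho y is the gradient of sigma. Integration
  by parts in y moves this gradient onto the derivatives of f at x - t y, which yields the Laplacian
  and the factor t.\<close>

lemma moll_derivative:
  fixes f :: "'a::euclidean_space \<Rightarrow> 'b::euclidean_space"
  assumes f: "smooth f"
  shows "((\<lambda>t. moll t f x) has_vector_derivative
     - integral (cbox (- One) One) (\<lambda>y. (t * sigma y) *\<^sub>R lap f (x - t *\<^sub>R y))) (at t within S)"
proof -
  let ?B = "cbox (- One) One :: 'a set"
  have D: "((\<lambda>t. integral ?B (\<lambda>y. rho y *\<^sub>R f (x - t *\<^sub>R y))) has_derivative
     (\<lambda>h. \<Sum>j\<in>Basis. (h \<bullet> j) *\<^sub>R integral ?B (\<lambda>y. rho y *\<^sub>R (\<Sum>i\<in>Basis. ((- y) \<bullet> i) *\<^sub>R pd i f (x - t *\<^sub>R y))))) (at t)"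
    apply (rule has_derivative_integral[of UNIV _ _ _ _ "\<lambda>_ t y. rho y *\<^sub>R (\<Sum>i\<in>Basis. ((- y) \<bullet> i) *\<^sub>R pd i f (x - t *\<^sub>R y))"])
         apply auto[3]
    subgoal for t y
      using has_derivative_scaleR_right[OF smooth_line_derivative[OF f, of x "- y" t UNIV, unfolded has_vector_derivative_def], of "rho y"]
      by (simp add: scaleR_sum_right mult.left_commute)
     apply (intro continuous_intros continuous_on_smooth_comp[OF f] smooth_continuous_on smooth_rho)
    unfolding case_prod_unfold
    by (intro continuous_intros continuous_on_smooth_comp[OF smooth_pd[OF f]] continuous_on_smooth_comp[OF smooth_rho])
  have parts: "integral ?B (\<lambda>y. pd i sigma y *\<^sub>R pd i f (x - t *\<^sub>R y)) =
      integral ?B (\<lambda>y. (t * sigma y) *\<^sub>R pd i (pd i f) (x - t *\<^sub>R y))" if i: "i \<in> Basis" for i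
  proof -
    have smf: "smooth (\<lambda>y. pd i f (x - t *\<^sub>R y))"
      using smooth_affine[OF smooth_pd[OF f i], of x "- t"] by simp
    have "pd i (\<lambda>y. sigma y *\<^sub>R pd i f (x - t *\<^sub>R y)) y =
       sigma y *\<^sub>R (- t *\<^sub>R pd i (pd i f) (x - t *\<^sub>R y)) + pd i sigma y *\<^sub>R pd i f (x - t *\<^sub>R y)" for y
      using pd_bilinear[OF bounded_bilinear_scaleR smooth_differentiable[OF smooth_sigma] smooth_differentiable[OF smf], of i y]
        pd_affine[OF smooth_differentiable[OF smooth_pd[OF f i]] i, of x "- t" y] by simp
    then have "pd i (\<lambda>y. sigma y *\<^sub>R pd i f (x - t *\<^sub>R y)) = (\<lambda>y. pd i sigma y *\<^sub>R pd i f (x - t *\<^sub>R y)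
        - (t * sigma y) *\<^sub>R pd i (pd i f) (x - t *\<^sub>R y))" by (auto simp: mult.commute)
    moreover have "integral ?B (pd i (\<lambda>y. sigma y *\<^sub>R pd i f (x - t *\<^sub>R y))) = 0"
      by (rule integral_pd_zero[OF smooth_scaleR[OF smooth_sigma smf] _ i]) (simp add: sigma_outside)
    ultimately have "integral ?B (\<lambda>y. pd i sigma y *\<^sub>R pd i f (x - t *\<^sub>R y)
        - (t * sigma y) *\<^sub>R pd i (pd i f) (x - t *\<^sub>R y)) = 0" by simp
    then show ?thesis
      by (subst (asm) integral_diff)
         (auto intro!: integrable_continuous continuous_intros continuous_on_smooth_comp[OF smooth_pd[OF f i]]
           continuous_on_smooth_comp[OF smooth_pd[OF smooth_pd[OF f i] i]]
           continuous_on_smooth_comp[OF smooth_pd[OF smooth_sigma i]] continuous_on_smooth_comp[OF smooth_sigma])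
  qed
  have "integral ?B (\<lambda>y. rho y *\<^sub>R (\<Sum>i\<in>Basis. ((- y) \<bullet> i) *\<^sub>R pd i f (x - t *\<^sub>R y)))
      = integral ?B (\<lambda>y. - (\<Sum>i\<in>Basis. pd i sigma y *\<^sub>R pd i f (x - t *\<^sub>R y)))"
    by (rule integral_cong) (simp add: pd_sigma scaleR_sum_right mult.commute sum_negf)
  also have "\<dots> = - (\<Sum>i\<in>Basis. integral ?B (\<lambda>y. pd i sigma y *\<^sub>R pd i f (x - t *\<^sub>R y)))"
    unfolding integral_neg
    by (subst integral_sum)
       (auto intro!: integrable_continuous continuous_intros continuous_on_smooth_comp[OF smooth_pd[OF f]]
           continuous_on_smooth_comp[OF smooth_pd[OF smooth_sigma]])
  also have "\<dots> = - (\<Sum>i\<in>Basis. integral ?B (\<lambda>y. (t * sigma y) *\<^sub>R pd i (pd i f) (x - t *\<^sub>R y)))"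
    using parts by simp
  also have "\<dots> = - integral ?B (\<lambda>y. (t * sigma y) *\<^sub>R lap f (x - t *\<^sub>R y))"
    unfolding lap_def scaleR_sum_right
    by (subst integral_sum)
       (auto intro!: integrable_continuous continuous_intros continuous_on_smooth_comp[OF smooth_pd[OF smooth_pd[OF f]]]
           continuous_on_smooth_comp[OF smooth_sigma])
  finally have eq: "integral ?B (\<lambda>y. rho y *\<^sub>R (\<Sum>i\<in>Basis. ((- y) \<bullet> i) *\<^sub>R pd i f (x - t *\<^sub>R y)))
      = - integral ?B (\<lambda>y. (t * sigma y) *\<^sub>R lap f (x - t *\<^sub>R y))" .
  show ?thesis
    using has_derivative_at_withinI[OF D] unfolding eq has_vector_derivative_def moll_def avg_def
    by simp
qed

theorem moll_parametrix:
  fixes f :: "'a::euclidean_space \<Rightarrow> 'b::euclidean_space"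
  assumes f: "smooth f" and T: "0 \<le> T"
  shows "f x = moll T f x + parametrix T (lap f) x"
proof -
  let ?g = "\<lambda>t. integral (cbox (- One) One) (\<lambda>y. (t * sigma y) *\<^sub>R lap f (x - t *\<^sub>R y))"
  have "((\<lambda>t. - ?g t) has_integral (moll T f x - moll 0 f x)) {0..T}"
    using T by (intro fundamental_theorem_of_calculus moll_derivative f)
  from has_integral_neg[OF this] have "integral {0..T} ?g = f x - moll T f x"
    by (simp add: moll_0 integral_unique)
  moreover have "parametrix T (lap f) x = integral {0..T} ?g"
    unfolding parametrix_def avg_def
    apply (subst integral_prod_continuous)
    subgoal unfolding case_prod_unfold
      by (intro continuous_intros continuous_on_smooth_comp[OF smooth_lap[OF f]] continuous_on_smooth_comp[OF smooth_sigma])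
    by simp
  ultimately show ?thesis by simp
qed

lemma lap_pd: "smooth f \<Longrightarrow> i \<in> Basis \<Longrightarrow> lap (pd i f) x = pd i (lap f) x"
proof -
  assume f: "smooth f" and i: "i \<in> Basis"
  have "pd j (pd j (pd i f)) x = pd i (pd j (pd j f)) x" if "j \<in> Basis" for j
  proof -
    have "pd j (pd i f) = pd i (pd j f)" using pd_commute[OF f that i] by blast
    then show ?thesis using pd_commute[OF smooth_pd[OF f that] that i] by simp
  qed
  then show ?thesis
    unfolding lap_def[abs_def]
    by (subst pd_sum) (auto intro!: smooth_differentiable smooth_pd f)
qed

lemma lap_cong_open:
  assumes "open S" "x \<in> S" "\<And>y. y \<in> S \<Longrightarrow> f y = g y"
  shows "lap f x = lap g x"
  using pds_cong_open[OF assms(1,2), of f g "[i, i]" for i] assms(3) by (simp add: lap_def)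

lemma lap_add: "smooth f \<Longrightarrow> smooth g \<Longrightarrow> lap (\<lambda>x. f x + g x) x = lap f x + lap g x"
  using pds_add[of f g "[i, i]" for i] by (simp add: lap_def sum.distrib)

lemma lap_linear: "bounded_linear L \<Longrightarrow> smooth f \<Longrightarrow> lap (\<lambda>x. L (f x)) x = L (lap f x)"
  using pds_linear[of L f "[i, i]" for i] by (simp add: lap_def linear_sum[OF bounded_linear.linear])

lemma lap_diff: "smooth f \<Longrightarrow> smooth g \<Longrightarrow> lap (\<lambda>x. f x - g x) x = lap f x - lap g x"
  using lap_add[of f "\<lambda>x. - g x" x] lap_linear[OF bounded_linear_minus[OF bounded_linear_ident], of g x]
    smooth_minus[of g] by simp

lemma lap_affine:
  fixes f :: "'a::euclidean_space \<Rightarrow> 'b::euclidean_space"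
  shows "smooth f \<Longrightarrow> lap (\<lambda>x. f (p + c *\<^sub>R x)) x = c\<^sup>2 *\<^sub>R lap f (p + c *\<^sub>R x)"
  using pds_affine[of f "[i, i]" p c for i] by (simp add: lap_def scaleR_sum_right power2_eq_square)

lemma lap_avg:
  fixes f :: "'a::euclidean_space \<Rightarrow> 'b::euclidean_space"
  assumes "continuous_on (cbox a b) k" "continuous_on (cbox a b) m" "smooth f"
  shows "lap (avg k m a b f) x = avg k m a b (lap f) x"
  unfolding lap_def[abs_def]
  using pds_avg[OF assms, of "[i, i]" for i]
  by (subst avg_sum[OF assms(1,2)]) (auto intro!: smooth_continuous_on smooth_pd assms)

lemma avg_cong:
  assumes "\<And>z. z \<in> cbox a b \<Longrightarrow> k z \<noteq> 0 \<Longrightarrow> f (x - m z) = g (x - m z)"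
  shows "avg k m a b f x = avg k m a b g x"
  unfolding avg_def by (rule integral_cong) (metis assms scaleR_zero_left)

text \<open>The weight is nonzero only for 0 < t <= T and norm y < 1, so only points strictly within
  T of x are seen. This locality lets equations that hold on a ball be used inside it.\<close>

lemma parametrix_cong:
  fixes f :: "'a::euclidean_space \<Rightarrow> 'b::euclidean_space"
  assumes T: "0 < T" and "\<And>y. y \<in> ball x T \<Longrightarrow> f y = g y"
  shows "parametrix T f x = parametrix T g x"
  unfolding parametrix_def
proof (rule avg_cong)
  fix z :: "real \<times> 'a" assume "z \<in> cbox (0, - One) (T, One)" "(case z of (t, y) \<Rightarrow> t * sigma y) \<noteq> 0"
  then obtain t y where z: "z = (t, y)" "0 \<le> t" "t \<le> T" "t \<noteq> 0" "sigma y \<noteq> 0"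
    by (cases z) (auto simp: cbox_Pair_eq)
  have "t * norm y < T"
  proof -
    have "t * norm y < t * 1" using z sigma_support[of y] by (intro mult_strict_left_mono) auto
    then show ?thesis using z by linarith
  qed
  then have "x - t *\<^sub>R y \<in> ball x T" using z by (simp add: dist_norm)
  then show "f (x - (case z of (t, y) \<Rightarrow> t *\<^sub>R y)) = g (x - (case z of (t, y) \<Rightarrow> t *\<^sub>R y))"
    using assms(2) z by simp
qed

lemma moll_cong:
  fixes f :: "'a::euclidean_space \<Rightarrow> 'b::euclidean_space"
  assumes T: "0 < T" and "\<And>y. y \<in> ball x T \<Longrightarrow> f y = g y"
  shows "moll T f x = moll T g x"
  unfolding moll_def
proof (rule avg_cong)
  fix y :: 'a assume "rho y \<noteq> 0"
  then have "x - T *\<^sub>R y \<in> ball x T" using T rho_support[of y] by (simp add: dist_norm)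
  then show "f (x - T *\<^sub>R y) = g (x - T *\<^sub>R y)" by (rule assms(2))
qed

lemma parametrix_zero [simp]: "parametrix T (\<lambda>x. 0) x = 0"
  by (simp add: parametrix_def avg_def)

subsection \<open>Interior estimates for harmonic functions\<close>

text \<open>Differentiating f(x - c y) in y produces -c, hence the factor on the left.\<close>

lemma avg_by_parts:
  fixes f :: "'a::euclidean_space \<Rightarrow> 'b::euclidean_space"
  assumes k: "smooth k" "\<And>y. y \<notin> cbox a b \<Longrightarrow> k y = 0" and f: "smooth f" and i: "i \<in> Basis"
  shows "c *\<^sub>R avg k (\<lambda>y. c *\<^sub>R y) a b (pd i f) x = avg (pd i k) (\<lambda>y. c *\<^sub>R y) a b f x"
proof -
  have smf: "smooth (\<lambda>y. f (x - c *\<^sub>R y))"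
    using smooth_affine[OF f, of x "- c"] by simp
  have "pd i (\<lambda>y. k y *\<^sub>R f (x - c *\<^sub>R y)) y = k y *\<^sub>R (- c *\<^sub>R pd i f (x - c *\<^sub>R y)) + pd i k y *\<^sub>R f (x - c *\<^sub>R y)" for y
    using pd_bilinear[OF bounded_bilinear_scaleR smooth_differentiable[OF k(1)] smooth_differentiable[OF smf], of i y]
      pd_affine[OF smooth_differentiable[OF f] i, of x "- c" y] by simp
  then have "pd i (\<lambda>y. k y *\<^sub>R f (x - c *\<^sub>R y)) = (\<lambda>y. pd i k y *\<^sub>R f (x - c *\<^sub>R y)
      - c *\<^sub>R (k y *\<^sub>R pd i f (x - c *\<^sub>R y)))" by (auto simp: mult.commute)
  moreover have "integral (cbox a b) (pd i (\<lambda>y. k y *\<^sub>R f (x - c *\<^sub>R y))) = 0"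
    by (rule integral_pd_zero[OF smooth_scaleR[OF k(1) smf] _ i]) (simp add: k)
  ultimately have "integral (cbox a b) (\<lambda>y. pd i k y *\<^sub>R f (x - c *\<^sub>R y)
      - c *\<^sub>R (k y *\<^sub>R pd i f (x - c *\<^sub>R y))) = 0" by simp
  then show ?thesis
    unfolding avg_def
    by (subst (asm) integral_diff)
       (auto simp del: scaleR_scaleR intro!: integrable_continuous continuous_on_scaleR continuous_on_const
           continuous_on_diff continuous_on_id continuous_on_smooth_comp[OF f]
           continuous_on_smooth_comp[OF smooth_pd[OF f i]]
           smooth_continuous_on[OF smooth_pd[OF k(1) i]] smooth_continuous_on[OF k(1)])
qed

text \<open>One constant for all directions; the summand 1 makes it positive, so that it can be
  divided by.\<close>

definition rho_grad :: "'a::euclidean_space itself \<Rightarrow> real" where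
  "rho_grad _ = 1 + (\<Sum>i\<in>Basis. integral (cbox (- One) One) (\<lambda>y::'a. \<bar>pd i rho y\<bar>))"

lemma rho_grad:
  "rho_grad TYPE('a::euclidean_space) > 0"
  "i \<in> Basis \<Longrightarrow> integral (cbox (- One) One) (\<lambda>y::'a. \<bar>pd i rho y\<bar>) \<le> rho_grad TYPE('a)"
proof -
  have nn: "0 \<le> integral (cbox (- One) One) (\<lambda>y::'a. \<bar>pd i rho y\<bar>)" if "i \<in> Basis" for i
    by (intro integral_nonneg integrable_continuous continuous_intros)
       (auto intro: smooth_continuous_on smooth_pd smooth_rho that)
  then have "0 \<le> (\<Sum>i\<in>Basis. integral (cbox (- One) One) (\<lambda>y::'a. \<bar>pd i rho y\<bar>))"
    by (intro sum_nonneg)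
  then show "rho_grad TYPE('a) > 0" by (simp add: rho_grad_def)
  assume "i \<in> Basis"
  then have "integral (cbox (- One) One) (\<lambda>y::'a. \<bar>pd i rho y\<bar>)
     \<le> (\<Sum>i\<in>Basis. integral (cbox (- One) One) (\<lambda>y::'a. \<bar>pd i rho y\<bar>))"
    by (intro member_le_sum nn) auto
  then show "integral (cbox (- One) One) (\<lambda>y::'a. \<bar>pd i rho y\<bar>) \<le> rho_grad TYPE('a)"
    by (simp add: rho_grad_def)
qed

text \<open>A derivative of a harmonic function is harmonic and so equals its own average over the
  ball. Integration by parts then puts the derivative on rho at the cost of 1/r.\<close>

lemma harmonic_pd_bound:
  fixes w :: "'a::euclidean_space \<Rightarrow> 'b::euclidean_space"
  assumes w: "smooth w" and i: "i \<in> Basis" and r: "0 < r"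
    and h: "\<And>y. y \<in> ball x r \<Longrightarrow> lap w y = 0"
    and S: "\<And>y. y \<in> cball x r \<Longrightarrow> norm (w y) \<le> S"
  shows "norm (pd i w x) \<le> rho_grad TYPE('a) / r * S"
proof -
  have S0: "0 \<le> S" using S[of x] r by (meson centre_in_cball less_imp_le norm_ge_zero order_trans)
  have "parametrix r (lap (pd i w)) x = parametrix r (\<lambda>x. 0) x"
  proof (rule parametrix_cong[OF r])
    fix y assume "y \<in> ball x r"
    then show "lap (pd i w) y = 0"
      unfolding lap_pd[OF w i]
      using pd_cong_open[of "ball x r" y "lap w" "\<lambda>x. 0" i] h by simp
  qed
  then have "pd i w x = moll r (pd i w) x"
    using moll_parametrix[OF smooth_pd[OF w i], where T=r and x=x] r by simp
  then have "r *\<^sub>R pd i w x = avg (pd i rho) (\<lambda>y. r *\<^sub>R y) (- One) One w x"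
    using avg_by_parts[OF smooth_rho rho_outside w i, where c=r and x=x] by (simp add: moll_def)
  moreover have "norm (avg (pd i rho) (\<lambda>y. r *\<^sub>R y) (- One) One w x) \<le>
     integral (cbox (- One) One) (\<lambda>y::'a. \<bar>pd i rho y\<bar>) * S"
  proof (rule norm_avg_le)
    fix y :: 'a assume "pd i rho y \<noteq> 0"
    then have "norm y \<le> 1"
      using pd_zero_outside[of "cball 0 1" rho y i] rho_support by force
    then have "x - r *\<^sub>R y \<in> cball x r" using r by (simp add: dist_norm mult_left_le)
    then show "norm (w (x - r *\<^sub>R y)) \<le> S" by (rule S)
  qed (auto intro!: smooth_continuous_on[OF smooth_pd[OF smooth_rho i]] smooth_continuous_on[OF w] continuous_intros)
  ultimately have "r * norm (pd i w x) \<le> integral (cbox (- One) One) (\<lambda>y::'a. \<bar>pd i rho y\<bar>) * S"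
    using r by (metis abs_of_pos norm_scaleR)
  also have "\<dots> \<le> rho_grad TYPE('a) * S" by (intro mult_right_mono rho_grad i S0)
  finally show ?thesis using r by (simp add: field_simps)
qed

lemma harmonic_pds:
  assumes "smooth w" "set bs \<subseteq> Basis" "open U" "\<And>y. y \<in> U \<Longrightarrow> lap w y = 0" "y \<in> U"
  shows "lap (pds bs w) y = 0"
  using assms(2,5)
proof (induction bs arbitrary: y)
  case (Cons b bs)
  then have "lap (pd b (pds bs w)) y = pd b (lap (pds bs w)) y"
    by (intro lap_pd smooth_pds assms) auto
  also have "\<dots> = pd b (\<lambda>x. 0) y"
    by (rule pd_cong_open[OF assms(3)]) (use Cons in auto)
  finally show ?case by simp
qed (use assms in auto)

text \<open>Each derivative gives up a layer of width h. This width stays free because it will be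
  matched to the number of derivatives.\<close>

lemma harmonic_pds_bound:
  fixes w :: "'a::euclidean_space \<Rightarrow> 'b::euclidean_space"
  assumes w: "smooth w" and h: "0 < (h::real)" and "set bs \<subseteq> Basis"
    and lap: "\<And>y. y \<in> ball 0 R \<Longrightarrow> lap w y = 0"
    and S: "\<And>y. y \<in> ball 0 R \<Longrightarrow> norm (w y) \<le> S"
    and "norm x + real (length bs) * h < R"
  shows "norm (pds bs w x) \<le> (rho_grad TYPE('a) / h) ^ length bs * S"
  using assms(3,6)
proof (induction bs arbitrary: x)
  case (Cons b bs)
  let ?S = "(rho_grad TYPE('a) / h) ^ length bs * S"
  have sub: "norm y + real (length bs) * h < R" if "y \<in> cball x h" for y
  proof -
    have "norm y \<le> norm x + h" using that norm_triangle_ineq2[of y x] by (simp add: dist_norm norm_minus_commute)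
    then show ?thesis using Cons.prems by (simp add: algebra_simps)
  qed
  have "norm (pd b (pds bs w) x) \<le> rho_grad TYPE('a) / h * ?S"
  proof (rule harmonic_pd_bound[OF _ _ h])
    show "smooth (pds bs w)" using Cons by (intro smooth_pds w) auto
    show "b \<in> Basis" using Cons by auto
    fix y assume "y \<in> ball x h"
    then have "norm y < R" using sub[of y] h by (smt (verit) ball_subset_cball in_mono mult_nonneg_nonneg of_nat_0_le_iff)
    then show "lap (pds bs w) y = 0"
      by (intro harmonic_pds[OF w _ open_ball[of 0 R]] lap) (use Cons in auto)
  next
    show "norm (pds bs w y) \<le> ?S" if "y \<in> cball x h" for y
      using Cons sub[OF that] by auto
  qed
  then show ?case by (simp add: mult.assoc)
qed (use S in auto)

subsection \<open>Taylor polynomials of harmonic functions\<close>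

text \<open>\<open>taylor_term j w a x\<close> is the \<open>j\<close>-th derivative of \<open>t \<mapsto> w (a + t *\<^sub>R x)\<close> at \<open>0\<close>.\<close>

fun taylor_term :: "nat \<Rightarrow> ('a::euclidean_space \<Rightarrow> 'b::euclidean_space) \<Rightarrow> 'a \<Rightarrow> 'a \<Rightarrow> 'b" where
  "taylor_term 0 w a x = w a"
| "taylor_term (Suc j) w a x = (\<Sum>i\<in>Basis. (x \<bullet> i) *\<^sub>R taylor_term j (pd i w) a x)"

lemma smooth_taylor_term: "smooth (taylor_term j w a)"
proof (induction j arbitrary: w)
  case 0
  have "taylor_term 0 w a = (\<lambda>x. w a)" by auto
  then show ?case by simp
next
  case (Suc j)
  have "taylor_term (Suc j) w a = (\<lambda>x. \<Sum>i\<in>Basis. (x \<bullet> i) *\<^sub>R taylor_term j (pd i w) a x)" by auto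
  then show ?case by (simp only:) (intro smooth_sum smooth_scaleR smooth_inner Suc)
qed

lemma taylor_term_derivative:
  "smooth w \<Longrightarrow> ((\<lambda>t. taylor_term j w (t *\<^sub>R x) x) has_vector_derivative
     taylor_term (Suc j) w (t *\<^sub>R x) x) (at t)"
proof (induction j arbitrary: w)
  case 0
  then show ?case using smooth_line_derivative[of w 0 x t UNIV] by simp
next
  case (Suc j)
  have "((\<lambda>t. \<Sum>i\<in>Basis. (x \<bullet> i) *\<^sub>R taylor_term j (pd i w) (t *\<^sub>R x) x) has_vector_derivative
     (\<Sum>i\<in>Basis. (x \<bullet> i) *\<^sub>R taylor_term (Suc j) (pd i w) (t *\<^sub>R x) x)) (at t)"
    by (intro has_vector_derivative_sum bounded_linear.has_vector_derivative[OF bounded_linear_scaleR_right]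
        Suc.IH smooth_pd Suc.prems)
  then show ?case by simp
qed

lemma taylor_term_sum:
  assumes "\<And>k. k \<in> K \<Longrightarrow> smooth (f k)"
  shows "taylor_term j (\<lambda>x. \<Sum>k\<in>K. f k x) a x = (\<Sum>k\<in>K. taylor_term j (f k) a x)"
  using assms
proof (induction j arbitrary: f)
  case (Suc j)
  have "pd i (\<lambda>x. \<Sum>k\<in>K. f k x) = (\<lambda>x. \<Sum>k\<in>K. pd i (f k) x)" if "i \<in> Basis" for i
    using pd_sum[of K f _ i] Suc.prems by (auto intro: smooth_differentiable)
  then have "taylor_term (Suc j) (\<lambda>x. \<Sum>k\<in>K. f k x) a x
      = (\<Sum>i\<in>Basis. \<Sum>k\<in>K. (x \<bullet> i) *\<^sub>R taylor_term j (pd i (f k)) a x)"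
    using Suc by (simp add: smooth_pd scaleR_sum_right)
  also have "\<dots> = (\<Sum>k\<in>K. taylor_term (Suc j) (f k) a x)" by (subst sum.swap) simp
  finally show ?case .
qed simp

lemma taylor_term_zero:
  assumes "open U" "a \<in> U"
  shows "(\<And>y. y \<in> U \<Longrightarrow> w y = 0) \<Longrightarrow> taylor_term j w a x = 0"
proof (induction j arbitrary: w)
  case (Suc j)
  have "pd i w y = 0" if "y \<in> U" for i y
    using pd_cong_open[OF assms(1) that, of w "\<lambda>x. 0"] Suc.prems by simp
  then show ?case using Suc.IH by simp
qed (use assms in auto)

text \<open>A Taylor term is a homogeneous form. The factor counts the positions at which the
  direction k can occur, and all of them contribute equally because second derivatives
  commute.\<close>

lemma pd_taylor_term:
  fixes w :: "'a::euclidean_space \<Rightarrow> 'b::euclidean_space"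
  assumes "k \<in> Basis"
  shows "smooth w \<Longrightarrow> pd k (taylor_term (Suc j) w a) x = real (Suc j) *\<^sub>R taylor_term j (pd k w) a x"
proof (induction j arbitrary: w)
  case 0
  have "taylor_term (Suc 0) w a = (\<lambda>x. \<Sum>i\<in>Basis. (x \<bullet> i) *\<^sub>R pd i w a)" by auto
  moreover have "(\<dots> has_derivative (\<lambda>h. \<Sum>i\<in>Basis. (h \<bullet> i) *\<^sub>R pd i w a)) (at x)"
    by (auto intro!: derivative_eq_intros)
  ultimately show ?case using pd_eq[of "taylor_term (Suc 0) w a" _ x k] assms by simp
next
  case (Suc j)
  have sm: "smooth (\<lambda>x::'a. (x \<bullet> i) *\<^sub>R taylor_term (Suc j) (pd i w) a x)" for i
    by (intro smooth_scaleR smooth_inner smooth_taylor_term)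
  have prod: "pd k (\<lambda>x. (x \<bullet> i) *\<^sub>R taylor_term (Suc j) (pd i w) a x) x
      = (x \<bullet> i) *\<^sub>R pd k (taylor_term (Suc j) (pd i w) a) x + (k \<bullet> i) *\<^sub>R taylor_term (Suc j) (pd i w) a x" for i
    using pd_bilinear[OF bounded_bilinear_scaleR smooth_differentiable[OF smooth_inner]
        smooth_differentiable[OF smooth_taylor_term[of "Suc j" "pd i w" a]], where b=k and x=x]
    by (simp add: pd_inner del: taylor_term.simps)
  have eq: "taylor_term (Suc (Suc j)) w a = (\<lambda>x. \<Sum>i\<in>Basis. (x \<bullet> i) *\<^sub>R taylor_term (Suc j) (pd i w) a x)"
    by (rule ext) (rule taylor_term.simps)
  have com: "pd k (pd i w) = pd i (pd k w)" if "i \<in> Basis" for i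
    using pd_commute[OF Suc.prems assms that] by blast
  have "pd k (taylor_term (Suc (Suc j)) w a) x
      = (\<Sum>i\<in>Basis. (x \<bullet> i) *\<^sub>R pd k (taylor_term (Suc j) (pd i w) a) x + (k \<bullet> i) *\<^sub>R taylor_term (Suc j) (pd i w) a x)"
    unfolding eq by (subst pd_sum[OF smooth_differentiable[OF sm]]) (simp only: prod)
  also have "\<dots> = (\<Sum>i\<in>Basis. (x \<bullet> i) *\<^sub>R (real (Suc j) *\<^sub>R taylor_term j (pd i (pd k w)) a x))
      + taylor_term (Suc j) (pd k w) a x"
    using assms Suc.IH Suc.prems com by (simp add: sum.distrib smooth_pd del: taylor_term.simps)
  also have "\<dots> = real (Suc (Suc j)) *\<^sub>R taylor_term (Suc j) (pd k w) a x"
  proof -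
    have "(\<Sum>i\<in>Basis. (x \<bullet> i) *\<^sub>R (real (Suc j) *\<^sub>R taylor_term j (pd i (pd k w)) a x))
        = real (Suc j) *\<^sub>R taylor_term (Suc j) (pd k w) a x"
      by (simp add: scaleR_sum_right mult.commute)
    moreover have "real (Suc (Suc j)) = real (Suc j) + 1" by simp
    ultimately show ?thesis by (simp only: scaleR_left_distrib scaleR_one)
  qed
  finally show ?case .
qed

text \<open>By \<open>pd_taylor_term\<close>, used twice, the Laplacian of the term of degree k + 2
  is a multiple of the term of degree k of \<open>lap w\<close>, which vanishes near a.\<close>

lemma lap_taylor_term:
  fixes w :: "'a::euclidean_space \<Rightarrow> 'b::euclidean_space"
  assumes w: "smooth w" and "open U" "a \<in> U" "\<And>y. y \<in> U \<Longrightarrow> lap w y = 0"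
  shows "lap (taylor_term j w a) x = 0"
proof -
  consider "j = 0" | "j = Suc 0" | k where "j = Suc (Suc k)" by (metis not0_implies_Suc)
  then show ?thesis
  proof cases
    case 1
    have "taylor_term 0 w a = (\<lambda>x. w a)" by auto
    then show ?thesis unfolding 1 lap_def by simp
  next
    case 2
    have "pd i (taylor_term (Suc 0) w a) = (\<lambda>x. pd i w a)" if "i \<in> Basis" for i
      using pd_taylor_term[OF that w, of 0 a] by auto
    then show ?thesis unfolding 2 lap_def by simp
  next
    case 3
    have "pd i (pd i (taylor_term (Suc (Suc k)) w a)) x
        = (real (Suc (Suc k)) * real (Suc k)) *\<^sub>R taylor_term k (pd i (pd i w)) a x" if i: "i \<in> Basis" for i
    proof -
      have "pd i (taylor_term (Suc (Suc k)) w a) = (\<lambda>x. real (Suc (Suc k)) *\<^sub>R taylor_term (Suc k) (pd i w) a x)"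
        using pd_taylor_term[OF i w] by blast
      then show ?thesis
        using pd_taylor_term[OF i smooth_pd[OF w i]] i
        by (simp add: pd_scaleR[OF smooth_taylor_term] del: taylor_term.simps)
    qed
    then have "lap (taylor_term j w a) x = (real (Suc (Suc k)) * real (Suc k)) *\<^sub>R taylor_term k (lap w) a x"
      unfolding 3 lap_def[abs_def]
      by (subst taylor_term_sum) (auto intro!: smooth_pd w simp: scaleR_sum_right simp del: taylor_term.simps)
    also have "taylor_term k (lap w) a x = 0"
      using taylor_term_zero assms by blast
    finally show ?thesis by simp
  qed
qed

lemma norm_taylor_term_le:
  fixes w :: "'a::euclidean_space \<Rightarrow> 'b::euclidean_space"
  shows "(\<And>bs. set bs \<subseteq> Basis \<Longrightarrow> length bs = j \<Longrightarrow> norm (pds bs w a) \<le> M) \<Longrightarrow>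
    norm (taylor_term j w a x) \<le> (real DIM('a) * norm x) ^ j * M"
proof (induction j arbitrary: w)
  case 0
  then show ?case using "0"[of "[]"] by simp
next
  case (Suc j)
  have "norm (taylor_term j (pd i w) a x) \<le> (real DIM('a) * norm x) ^ j * M" if "i \<in> Basis" for i
    by (rule Suc.IH) (use Suc.prems[of "_ @ [i]"] that in \<open>auto simp: pds_snoc\<close>)
  then have "norm ((x \<bullet> i) *\<^sub>R taylor_term j (pd i w) a x) \<le> norm x * ((real DIM('a) * norm x) ^ j * M)"
    if "i \<in> Basis" for i
    using that by (auto intro!: mult_mono Basis_le_norm)
  from sum_norm_le[of Basis, OF this]
  have "norm (taylor_term (Suc j) w a x) \<le> (\<Sum>i\<in>(Basis::'a set). norm x * ((real DIM('a) * norm x) ^ j * M))"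
    by simp
  then show ?case by (simp add: mult_ac)
qed

text \<open>Taylor's formula with an intermediate point fails for vector values, so the scalar
  formula is applied to the component along the error itself.\<close>

lemma taylor_remainder:
  fixes w :: "'a::euclidean_space \<Rightarrow> 'b::euclidean_space"
  assumes w: "smooth w" and n: "0 < n"
    and B: "\<And>t. 0 \<le> t \<Longrightarrow> t \<le> 1 \<Longrightarrow> norm (taylor_term n w (t *\<^sub>R x) x) / fact n \<le> B"
  shows "norm (w x - (\<Sum>j<n. (1 / fact j) *\<^sub>R taylor_term j w 0 x)) \<le> B"
proof -
  define e where "e = w x - (\<Sum>j<n. (1 / fact j) *\<^sub>R taylor_term j w 0 x)"
  define u where "u = sgn e"
  have "\<exists>t>0. t < 1 \<and> (u \<bullet> w (1 *\<^sub>R x)) = (\<Sum>m<n. (u \<bullet> taylor_term m w (0 *\<^sub>R x) x) / fact m * 1 ^ m)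
      + (u \<bullet> taylor_term n w (t *\<^sub>R x) x) / fact n * 1 ^ n"
  proof (rule Maclaurin[of 1 n "\<lambda>m t. u \<bullet> taylor_term m w (t *\<^sub>R x) x" "\<lambda>t. u \<bullet> w (t *\<^sub>R x)"])
    show "\<forall>m t. m < n \<and> 0 \<le> t \<and> t \<le> 1 \<longrightarrow> DERIV (\<lambda>t. u \<bullet> taylor_term m w (t *\<^sub>R x) x) t :> u \<bullet> taylor_term (Suc m) w (t *\<^sub>R x) x"
      using bounded_linear.has_vector_derivative[OF bounded_linear_inner_right taylor_term_derivative[OF w]]
      by (simp add: has_real_derivative_iff_has_vector_derivative del: taylor_term.simps)
  qed (use n in auto)
  then obtain t where t: "0 < t" "t < 1"
    "u \<bullet> w x = (\<Sum>m<n. (u \<bullet> taylor_term m w 0 x) / fact m) + (u \<bullet> taylor_term n w (t *\<^sub>R x) x) / fact n"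
    by auto
  have "norm e = u \<bullet> e"
    by (cases "e = 0") (auto simp: u_def sgn_div_norm power2_norm_eq_inner[symmetric] power2_eq_square)
  also have "\<dots> = (u \<bullet> taylor_term n w (t *\<^sub>R x) x) / fact n"
    using t(3) by (simp add: e_def inner_diff_right inner_sum_right)
  also have "\<dots> \<le> (norm u * norm (taylor_term n w (t *\<^sub>R x) x)) / fact n"
    by (intro divide_right_mono norm_cauchy_schwarz) auto
  also have "\<dots> \<le> norm (taylor_term n w (t *\<^sub>R x) x) / fact n"
    by (intro divide_right_mono) (auto simp: u_def norm_sgn)
  also have "\<dots> \<le> B" using B t by auto
  finally show ?thesis unfolding e_def .
qed

text \<open>A single term of the exponential series; it stands in for Stirling's formula when n^n is
  absorbed into the factorial.\<close>

lemma power_self_le_fact: "real n ^ n \<le> exp (real n) * fact n"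
proof -
  have "real n ^ n /\<^sub>R fact n \<le> (\<Sum>k. real n ^ k /\<^sub>R fact k)"
    using sum_le_suminf[OF summable_exp_generic[of "real n"], of "{n}"] by simp
  then show ?thesis by (simp add: exp_def field_simps)
qed

text \<open>Interior estimates with n layers of width R/(2n) bound derivatives of order n by (2 n C
  / R)^n S. Since n^n <= e^n n!, the Taylor remainder for norm x <= c R is at most (2 c d C e)^n S
  <= 2^(-n) S. The fraction c is fixed before R, the accuracy and w.\<close>

theorem harmonic_approximation:
  obtains c where "0 < c" "c < 1"
    "\<And>R \<epsilon> w. \<lbrakk>0 < R; 0 < \<epsilon>; smooth (w :: 'a::euclidean_space \<Rightarrow> 'b::euclidean_space);
        \<And>x. x \<in> ball 0 R \<Longrightarrow> lap w x = 0\<rbrakk> \<Longrightarrow>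
      \<exists>p. smooth p \<and> (\<forall>x. lap p x = 0) \<and> (\<forall>x\<in>cball 0 (c * R). norm (w x - p x) \<le> \<epsilon>)"
proof -
  define d where "d = real DIM('a)"
  define C where "C = rho_grad TYPE('a)"
  \<comment> \<open>The entry 1/4 keeps the segment from 0 to x within R/4, which leaves room for
    layers of total width R/2. The other entry gives 2 c d C e <= 1/2.\<close>
  define c where "c = min (1/4) (1 / (4 * d * C * exp 1))"
  have d: "d \<ge> 1" unfolding d_def using DIM_positive[where 'a='a] by linarith
  have C: "C > 0" unfolding C_def by (rule rho_grad)
  have c: "0 < c" "c \<le> 1/4" "c * (4 * d * C * exp 1) \<le> 1"
    using d C by (auto simp: c_def min_def field_simps)
  show ?thesis
  proof (rule that[of c])
    fix R \<epsilon> :: real and w :: "'a \<Rightarrow> 'b"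
    assume R: "0 < R" and \<epsilon>: "0 < \<epsilon>" and w: "smooth w" and lap: "\<And>x. x \<in> ball 0 R \<Longrightarrow> lap w x = 0"
    have "bounded (w ` cball 0 R)"
      by (intro compact_imp_bounded compact_continuous_image smooth_continuous_on w) auto
    then obtain S where S: "S > 0" "\<And>x. x \<in> cball 0 R \<Longrightarrow> norm (w x) \<le> S"
      by (auto simp: bounded_pos)
    have "(\<lambda>n. (1/2) ^ n * S) \<longlonglongrightarrow> 0"
      by (intro tendsto_mult_left_zero LIMSEQ_realpow_zero) auto
    from LIMSEQ_D[OF this \<epsilon>] obtain n0 where "\<And>n. n \<ge> n0 \<Longrightarrow> (1/2) ^ n * S < \<epsilon>"
      using S(1) by auto
    then obtain n where n: "0 < n" "(1/2) ^ n * S < \<epsilon>" by (metis le_add2 less_add_one add_gr_0)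
    define p where "p x = (\<Sum>j<n. (1 / fact j) *\<^sub>R taylor_term j w 0 x)" for x
    have "smooth p" unfolding p_def[abs_def]
      by (intro smooth_sum smooth_linear[OF bounded_linear_scaleR_right] smooth_taylor_term)
    moreover have "lap p x = 0" for x
    proof -
      have trm: "pd i (pd i (\<lambda>x. (1 / fact j) *\<^sub>R taylor_term j w 0 x)) x
          = (1 / fact j) *\<^sub>R pd i (pd i (taylor_term j w 0)) x" if "i \<in> Basis" for i j
        using pds_linear[OF bounded_linear_scaleR_right[of "1 / fact j"] smooth_taylor_term[of j w 0], of "[i, i]"] that
        by simp
      have "pd i (pd i p) x = (\<Sum>j<n. (1 / fact j) *\<^sub>R pd i (pd i (taylor_term j w 0)) x)" if "i \<in> Basis" for i
        using pds_sum[of "{..<n}" "\<lambda>j x. (1 / fact j) *\<^sub>R taylor_term j w 0 x" "[i, i]"] that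
          trm
        by (simp add: p_def[abs_def] smooth_linear[OF bounded_linear_scaleR_right smooth_taylor_term])
      then have "lap p x = (\<Sum>j<n. (1 / fact j) *\<^sub>R lap (taylor_term j w 0) x)"
        unfolding lap_def by (simp add: scaleR_sum_right sum.swap[of _ Basis])
      then show ?thesis
        using lap_taylor_term[OF w open_ball[of 0 R] _ lap] R by simp
    qed
    moreover have "norm (w x - p x) \<le> \<epsilon>" if x: "x \<in> cball 0 (c * R)" for x
      unfolding p_def
    proof (rule taylor_remainder[OF w n(1)])
      fix t :: real assume t: "0 \<le> t" "t \<le> 1"
      define h where "h = R / (2 * n)"
      have h: "h > 0" using R n by (simp add: h_def)
      have tx: "norm (t *\<^sub>R x) \<le> c * R" using t x mult_right_mono[of t 1 "norm x"] by simp
      have cR: "c * R \<le> R / 4" using c R by simp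
      have "norm (taylor_term n w (t *\<^sub>R x) x) \<le> (d * norm x) ^ n * ((C / h) ^ n * S)"
        unfolding d_def
      proof (rule norm_taylor_term_le)
        fix bs :: "'a list" assume bs: "set bs \<subseteq> Basis" "length bs = n"
        have "norm (pds bs w (t *\<^sub>R x)) \<le> (C / h) ^ length bs * S"
          unfolding C_def
        proof (rule harmonic_pds_bound[OF w h bs(1) lap])
          have "real (length bs) * h = R / 2" using bs n by (simp add: h_def)
          then show "norm (t *\<^sub>R x) + real (length bs) * h < R" using tx cR R by linarith
        qed (use S(2) in auto)
        then show "norm (pds bs w (t *\<^sub>R x)) \<le> (C / h) ^ n * S" using bs by simp
      qed
      also have "\<dots> \<le> (d * (c * R)) ^ n * ((C / h) ^ n * S)"
        using x d C h S(1) by (intro mult_right_mono power_mono mult_left_mono) auto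
      also have "\<dots> = (2 * c * d * C) ^ n * (real n ^ n) * S"
        using R n by (simp add: h_def power_mult_distrib power_divide field_simps)
      also have "\<dots> \<le> (2 * c * d * C) ^ n * (exp (real n) * fact n) * S"
        using c d C S(1) by (intro mult_right_mono mult_left_mono power_self_le_fact) auto
      also have "\<dots> = (2 * c * d * C * exp 1) ^ n * S * fact n"
        by (simp add: power_mult_distrib exp_of_nat_mult[symmetric])
      also have "\<dots> \<le> (1/2) ^ n * S * fact n"
        using c d C S(1) by (intro mult_right_mono power_mono) (auto simp: mult_ac)
      also have "\<dots> \<le> \<epsilon> * fact n" using n by (intro mult_right_mono) auto
      finally show "norm (taylor_term n w (t *\<^sub>R x) x) / fact n \<le> \<epsilon>"
        by (simp add: field_simps)
    qed
    ultimately show "\<exists>p. smooth p \<and> (\<forall>x. lap p x = 0) \<and> (\<forall>x\<in>cball 0 (c * R). norm (w x - p x) \<le> \<epsilon>)"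
      by blast
  qed (use c in auto)
qed

subsection \<open>Local solvability\<close>

lemma moll_one: "moll 1 = avg rho (\<lambda>y. y) (- One) One"
  by (simp add: moll_def)

lemma integral_abs_rho: "integral (cbox (- One) One) (\<lambda>y::'a::euclidean_space. \<bar>rho y\<bar>) = 1"
  by (simp add: rho_nonneg integral_rho)

lemma smooth_moll_one:
  fixes f :: "'a::euclidean_space \<Rightarrow> 'b::euclidean_space"
  shows "continuous_on UNIV f \<Longrightarrow> smooth (moll 1 f)"
  unfolding moll_one by (rule smooth_conv[OF smooth_rho rho_outside])

lemma smooth_parametrix:
  fixes f :: "'a::euclidean_space \<Rightarrow> 'b::euclidean_space"
  shows "smooth f \<Longrightarrow> smooth (parametrix T f)"
  unfolding parametrix_def by (rule smooth_avg[OF parametrix_weight])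

lemma lap_parametrix:
  fixes f :: "'a::euclidean_space \<Rightarrow> 'b::euclidean_space"
  assumes "smooth f" "0 \<le> T"
  shows "lap (parametrix T f) x = f x - moll T f x"
  using moll_parametrix[OF assms, of x] lap_avg[OF parametrix_weight assms(1)]
  by (simp add: parametrix_def)

lemma norm_moll_one_le:
  fixes f :: "'a::euclidean_space \<Rightarrow> 'b::euclidean_space"
  assumes "continuous_on UNIV f" "\<And>y. norm y < 1 \<Longrightarrow> norm (f (x - y)) \<le> S"
  shows "norm (moll 1 f x) \<le> S"
  using norm_avg_le[OF moll_weight(1) continuous_on_id assms(1), of x S] assms(2) rho_support
  unfolding moll_one integral_abs_rho by fastforce

text \<open>Averaging at radius 1 smooths a function that is 1 up to radius 2, 0 from radius 3 on
  and linear in between, and moves these thresholds by at most 1.\<close>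

lemma cutoff_exists:
  obtains chi :: "'a::euclidean_space \<Rightarrow> real"
  where "smooth chi" "\<And>x. norm x \<le> 1 \<Longrightarrow> chi x = 1" "\<And>x. norm x \<ge> 4 \<Longrightarrow> chi x = 0"
    "\<And>x. \<bar>chi x\<bar> \<le> 1"
proof -
  define \<eta> :: "'a \<Rightarrow> real" where "\<eta> x = max 0 (min 1 (3 - norm x))" for x
  have c: "continuous_on UNIV \<eta>" unfolding \<eta>_def by (intro continuous_intros)
  show ?thesis
  proof (rule that[of "moll 1 \<eta>"])
    show "smooth (moll 1 \<eta>)" by (rule smooth_moll_one[OF c])
    fix x :: 'a
    show "\<bar>moll 1 \<eta> x\<bar> \<le> 1"
      using norm_moll_one_le[OF c, of x 1] by (simp add: \<eta>_def)
    show "moll 1 \<eta> x = 1" if "norm x \<le> 1"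
    proof -
      have "moll 1 \<eta> x = moll 1 (\<lambda>x. 1) x"
      proof (rule moll_cong)
        fix y assume "y \<in> ball x 1"
        then have "norm y \<le> 2"
          using that norm_triangle_ineq2[of y x] by (simp add: dist_norm norm_minus_commute)
        then show "\<eta> y = 1" by (simp add: \<eta>_def)
      qed simp
      then show ?thesis by (simp add: moll_one avg_def integral_rho)
    qed
    show "moll 1 \<eta> x = 0" if "norm x \<ge> 4"
    proof -
      have "moll 1 \<eta> x = moll 1 (\<lambda>x. 0) x"
      proof (rule moll_cong)
        fix y assume "y \<in> ball x 1"
        then have "norm y \<ge> 3"
          using that norm_triangle_ineq2[of x y] by (simp add: dist_norm norm_minus_commute)
        then show "\<eta> y = 0" by (simp add: \<eta>_def)
      qed simp
      then show ?thesis by (simp add: moll_one avg_def)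
    qed
  qed
qed

text \<open>Bounds the kernel by its supremum, so that the volume of the support of f enters instead
  of the total mass 1 of rho. This small factor makes the fixed point map a contraction.\<close>

lemma norm_conv_small_support:
  fixes f :: "'a::euclidean_space \<Rightarrow> 'b::euclidean_space"
  assumes f: "continuous_on UNIV f" and C: "\<And>y::'a. \<bar>rho y\<bar> \<le> C" and l: "0 < l"
    and z: "\<And>x. norm x \<ge> l \<Longrightarrow> f x = 0" and S: "\<And>x. norm (f x) \<le> S"
  shows "norm (moll 1 f x) \<le> C * (2 * l) ^ DIM('a) * S"
proof -
  let ?Q = "cbox (- l *\<^sub>R One) (l *\<^sub>R One) :: 'a set"
  have out: "f z = 0" if "z \<notin> ?Q" for z
  proof (cases "norm z \<ge> l")
    case False
    then have "z \<in> ?Q"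
      using Basis_le_norm[of _ z] by (fastforce simp: mem_box abs_le_iff)
    then show ?thesis using that by simp
  qed (simp add: z)
  have int: "(\<lambda>z. rho (x - z) *\<^sub>R f z) integrable_on ?Q"
    and eq: "moll 1 f x = integral ?Q (\<lambda>z. rho (x - z) *\<^sub>R f z)"
    unfolding moll_one
    by (rule conv_eq_support[OF smooth_continuous_on[OF smooth_rho] rho_outside f out], assumption+)+
  have C0: "0 \<le> C" using C[of 0] by linarith
  have S0: "0 \<le> S" using S[of 0] norm_ge_zero order_trans by blast
  have "norm (integral ?Q (\<lambda>z. rho (x - z) *\<^sub>R f z)) \<le> (C * S) * measure lborel ?Q"
  proof (rule has_integral_bound[OF _ integrable_integral[OF int]])
    show "norm (rho (x - z) *\<^sub>R f z) \<le> C * S" for z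
      using C[of "x - z"] S[of z] C0 by (auto intro!: mult_mono)
  qed (use C0 S0 in auto)
  moreover have "measure lborel ?Q = (2 * l) ^ DIM('a)"
    using l by (subst content_cbox') (auto simp: box_ne_empty)
  ultimately show ?thesis by (simp add: eq mult_ac)
qed

text \<open>If g = chi f + rho * (chi g), then by \<open>lap_parametrix\<close> the Laplacian of K_1
  (chi g) is chi g - rho * (chi g), which equals f where chi = 1. The radius l is chosen before
  f.\<close>

lemma lap_solvable_small_ball:
  obtains l where "0 < l"
    "\<And>f :: 'a::euclidean_space \<Rightarrow> 'b::euclidean_space. smooth f \<Longrightarrow>
       \<exists>u. smooth u \<and> (\<forall>x\<in>ball 0 l. lap u x = f x)"
proof -
  obtain chi1 :: "'a \<Rightarrow> real"
    where chi1: "smooth chi1" "\<And>x. norm x \<le> 1 \<Longrightarrow> chi1 x = 1" "\<And>x. norm x \<ge> 4 \<Longrightarrow> chi1 x = 0"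
      "\<And>x. \<bar>chi1 x\<bar> \<le> 1" using cutoff_exists by blast
  have "bounded (rho ` cball (0::'a) 1)"
    by (intro compact_imp_bounded compact_continuous_image smooth_continuous_on smooth_rho) auto
  then obtain C where C: "C > 0" "\<And>y::'a. norm y \<le> 1 \<Longrightarrow> \<bar>rho y\<bar> \<le> C"
    by (auto simp: bounded_pos)
  have C': "\<bar>rho y\<bar> \<le> C" for y :: 'a
    using C rho_support[of y] by (cases "rho y = 0") auto
  \<comment> \<open>The bound 8 l <= 1 lets (8 l)^DIM be replaced by 8 l, and C * (8 l) <= 1/2 then
    gives the contraction constant.\<close>
  define l where "l = min (1/8) (1 / (16 * C))"
  have l: "0 < l" "8 * l \<le> 1" "C * (8 * l) \<le> 1/2" using C(1) by (auto simp: l_def min_def field_simps)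
  have small: "C * (2 * (4 * l)) ^ DIM('a) \<le> 1/2"
  proof -
    have "(8 * l) ^ DIM('a) \<le> (8 * l) ^ 1" using l by (intro power_decreasing) (auto simp: Suc_leI)
    then have "C * (8 * l) ^ DIM('a) \<le> C * (8 * l)" using C(1) by (intro mult_left_mono) auto
    then show ?thesis using l by simp
  qed
  define chi where "chi x = chi1 (0 + (1 / l) *\<^sub>R x)" for x
  have chi: "smooth chi" "\<And>x. norm x \<le> l \<Longrightarrow> chi x = 1" "\<And>x. norm x \<ge> 4 * l \<Longrightarrow> chi x = 0" "\<And>x. \<bar>chi x\<bar> \<le> 1"
    unfolding chi_def[abs_def]
    using smooth_affine[OF chi1(1), of 0 "1 / l"] chi1(2-) l(1) by (simp_all add: field_simps)
  have cchi: "continuous_on UNIV chi" by (rule smooth_continuous_on[OF chi(1)])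
  show ?thesis
  proof (rule that[OF l(1)])
    fix f :: "'a \<Rightarrow> 'b" assume f: "smooth f"
    have cf: "continuous_on UNIV f" by (rule smooth_continuous_on[OF f])
    \<comment> \<open>The map acts on bounded continuous functions, a complete space. Smoothness of
      the fixed point is recovered afterwards, because averaging smooths a continuous
      function.\<close>
    define \<Phi> where "\<Phi> g x = chi x *\<^sub>R f x + moll 1 (\<lambda>y. chi y *\<^sub>R apply_bcontfun g y) x"
      for g :: "'a \<Rightarrow>\<^sub>C 'b" and x
    have c1: "continuous_on UNIV (\<lambda>y. chi y *\<^sub>R apply_bcontfun g y)" for g :: "'a \<Rightarrow>\<^sub>C 'b"
      by (intro continuous_intros cchi) auto
    have bd: "norm (moll 1 (\<lambda>y. chi y *\<^sub>R apply_bcontfun g y) x) \<le> 1/2 * norm g" for g :: "'a \<Rightarrow>\<^sub>C 'b" and x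
    proof -
      have "norm (moll 1 (\<lambda>y. chi y *\<^sub>R apply_bcontfun g y) x) \<le> C * (2 * (4 * l)) ^ DIM('a) * norm g"
      proof (rule norm_conv_small_support[OF c1 C'])
        show "norm (chi x *\<^sub>R apply_bcontfun g x) \<le> norm g" for x
          using chi(4)[of x] norm_bounded[of g x] mult_mono[of "\<bar>chi x\<bar>" 1 "norm (apply_bcontfun g x)" "norm g"] by simp
      qed (use l chi in auto)
      also have "\<dots> \<le> 1/2 * norm g" using small by (intro mult_right_mono) auto
      finally show ?thesis .
    qed
    obtain F where F: "\<And>x. norm x \<le> 4 * l \<Longrightarrow> norm (f x) \<le> F" "F > 0"
    proof -
      have "bounded (f ` cball 0 (4 * l))"
        by (intro compact_imp_bounded compact_continuous_image smooth_continuous_on f) auto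
      then obtain b where "b > 0" "\<forall>x\<in>cball 0 (4 * l). norm (f x) \<le> b"
        by (auto simp: bounded_pos)
      then show ?thesis by (intro that[of b]) auto
    qed
    have F': "norm (chi x *\<^sub>R f x) \<le> F" for x
    proof (cases "norm x \<le> 4 * l")
      case True
      then show ?thesis using F(1)[OF True] chi(4)[of x] mult_mono[of "\<bar>chi x\<bar>" 1 "norm (f x)" F] by simp
    qed (use chi(3)[of x] F(2) in auto)
    have bc: "\<Phi> g \<in> bcontfun" for g
    proof (rule bcontfun_normI)
      show "continuous_on UNIV (\<Phi> g)" unfolding \<Phi>_def
        by (intro continuous_intros cchi cf smooth_continuous_on[OF smooth_moll_one[OF c1]])
      show "norm (\<Phi> g x) \<le> F + 1/2 * norm g" for x
        unfolding \<Phi>_def using F'[of x] bd[of g x] by (intro norm_triangle_le) linarith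
    qed
    have contr: "dist (Bcontfun (\<Phi> g)) (Bcontfun (\<Phi> h)) \<le> 1/2 * dist g h" for g h
    proof (rule dist_bound)
      fix x
      have "moll 1 (\<lambda>y. chi y *\<^sub>R apply_bcontfun (g - h) y) x
          = moll 1 (\<lambda>y. chi y *\<^sub>R apply_bcontfun g y) x - moll 1 (\<lambda>y. chi y *\<^sub>R apply_bcontfun h y) x"
        unfolding moll_one
        by (subst avg_diff[OF moll_weight(1) continuous_on_id c1 c1, symmetric]) (simp add: scaleR_diff_right)
      then show "dist (apply_bcontfun (Bcontfun (\<Phi> g)) x) (apply_bcontfun (Bcontfun (\<Phi> h)) x) \<le> 1/2 * dist g h"
        using bd[of "g - h" x] by (simp add: Bcontfun_inverse[OF bc] \<Phi>_def dist_norm)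
    qed
    then have "\<exists>!g. Bcontfun (\<Phi> g) = g"
      by (intro banach_fix_type[of "1/2"]) auto
    then obtain G where "Bcontfun (\<Phi> G) = G" by blast
    then have "\<Phi> G = apply_bcontfun G" by (metis Bcontfun_inverse bc)
    then have g: "apply_bcontfun G = (\<lambda>x. chi x *\<^sub>R f x + moll 1 (\<lambda>y. chi y *\<^sub>R apply_bcontfun G y) x)"
      by (auto simp: \<Phi>_def fun_eq_iff)
    have "smooth (apply_bcontfun G)"
      by (subst g) (intro smooth_add smooth_scaleR chi f smooth_moll_one c1)
    then have sm: "smooth (\<lambda>y. chi y *\<^sub>R apply_bcontfun G y)" by (intro smooth_scaleR chi)
    have "lap (parametrix 1 (\<lambda>y. chi y *\<^sub>R apply_bcontfun G y)) x = f x" if "x \<in> ball 0 l" for x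
      using lap_parametrix[OF sm, of 1 x] fun_cong[OF g, of x] chi(2)[of x] that by simp
    then show "\<exists>u. smooth u \<and> (\<forall>x\<in>ball 0 l. lap u x = f x)"
      using smooth_parametrix[OF sm] by blast
  qed
qed

lemma lap_solvable_ball:
  fixes f :: "'a::euclidean_space \<Rightarrow> 'b::euclidean_space"
  assumes f: "smooth f"
  obtains u where "smooth u" "\<And>x. x \<in> ball 0 R \<Longrightarrow> lap u x = f x"
proof -
  obtain l where l: "0 < l" "\<And>f :: 'a \<Rightarrow> 'b. smooth f \<Longrightarrow>
       \<exists>u. smooth u \<and> (\<forall>x\<in>ball 0 l. lap u x = f x)" by (rule lap_solvable_small_ball) blast
  \<comment> \<open>R is arbitrary: |R| + 1 is positive and keeps s R at most l. The factor 1/s^2 in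
    the scaled right-hand side offsets the one from \<open>lap_affine\<close>.\<close>
  define s where "s = l / (\<bar>R\<bar> + 1)"
  have s: "s > 0" "s * R \<le> l"
  proof -
    show "s > 0" using l by (simp add: s_def)
    have "l * R \<le> l * (\<bar>R\<bar> + 1)" using l(1) by (intro mult_left_mono) auto
    then show "s * R \<le> l" by (simp add: s_def field_simps)
  qed
  have "smooth (\<lambda>x. (1 / s\<^sup>2) *\<^sub>R f (0 + (1 / s) *\<^sub>R x))"
    by (intro smooth_linear[OF bounded_linear_scaleR_right] smooth_affine f)
  then obtain u where u: "smooth u" "\<And>x. x \<in> ball 0 l \<Longrightarrow> lap u x = (1 / s\<^sup>2) *\<^sub>R f (0 + (1 / s) *\<^sub>R x)"
    using l(2) by blast
  show ?thesis
  proof (rule that)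
    show "smooth (\<lambda>x. u (0 + s *\<^sub>R x))" by (rule smooth_affine[OF u(1)])
    fix x :: 'a assume "x \<in> ball 0 R"
    then have "s * norm x < s * R" using s by simp
    then have "s * norm x < l" using s by linarith
    then have "s *\<^sub>R x \<in> ball 0 l" using s by simp
    then show "lap (\<lambda>x. u (0 + s *\<^sub>R x)) x = f x"
      using s(1) by (subst lap_affine[OF u(1)]) (simp add: u(2))
  qed
qed

subsection \<open>Global solvability\<close>

theorem lap_surj_smooth:
  fixes f :: "'a::euclidean_space \<Rightarrow> 'b::euclidean_space"
  assumes f: "smooth f"
  obtains u where "smooth u" "\<And>x. lap u x = f x"
proof -
  obtain c where c: "0 < c" "c < 1" and approx:
    "\<And>R \<epsilon> w. \<lbrakk>0 < R; 0 < \<epsilon>; smooth (w :: 'a \<Rightarrow> 'b); \<And>x. x \<in> ball 0 R \<Longrightarrow> lap w x = 0\<rbrakk> \<Longrightarrow>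
      \<exists>p. smooth p \<and> (\<forall>x. lap p x = 0) \<and> (\<forall>x\<in>cball 0 (c * R). norm (w x - p x) \<le> \<epsilon>)"
    by (rule harmonic_approximation) blast
  \<comment> \<open>Growth by 1/c compensates the loss in \<open>approx\<close>: c * R (Suc n) is R
    n.\<close>
  define R where "R n = (1 / c) ^ n" for n
  have R: "R n > 0" "R n \<le> R (Suc n)" for n using c by (auto simp: R_def field_simps)
  have Rmono: "R m \<le> R n" if "m \<le> n" for m n
    using R(2) that by (rule lift_Suc_mono_le)
  have Rlim: "\<exists>n. r \<le> c * R n" for r
  proof -
    obtain n where "r / c < R n"
      using real_arch_pow[of "1 / c" "r / c"] c by (auto simp: R_def)
    then show ?thesis using c by (auto simp: field_simps intro!: exI[of _ n])
  qed
  have "\<exists>v. \<forall>n. (smooth (v n) \<and> (\<forall>x\<in>ball 0 (R n). lap (v n) x = f x)) \<and>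
      (\<forall>x\<in>cball 0 (c * R n). norm (v (Suc n) x - v n x) \<le> (1/2) ^ n)"
  proof (rule dependent_nat_choice)
    show "\<exists>v. smooth v \<and> (\<forall>x\<in>ball 0 (R 0). lap v x = f x)"
      by (rule lap_solvable_ball[OF f, of "R 0"]) blast
    fix v n assume v: "smooth v \<and> (\<forall>x\<in>ball 0 (R n). lap v x = f x)"
    obtain u where u: "smooth u" "\<And>x. x \<in> ball 0 (R (Suc n)) \<Longrightarrow> lap u x = f x"
      by (rule lap_solvable_ball[OF f, of "R (Suc n)"]) blast
    \<comment> \<open>The difference v - u is harmonic on the smaller ball. Adding a globally
      harmonic p close to it changes no Laplacian and brings the new solution u + p close to
      v.\<close>
    have "\<exists>p. smooth p \<and> (\<forall>x. lap p x = 0) \<and> (\<forall>x\<in>cball 0 (c * R n). norm (v x - u x - p x) \<le> (1/2) ^ n)"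
    proof (rule approx[OF R(1)])
      show "smooth (\<lambda>x. v x - u x)" using v u by (intro smooth_diff) auto
      fix x :: 'a assume "x \<in> ball 0 (R n)"
      moreover have "x \<in> ball 0 (R (Suc n))" using R(2)[of n] calculation by simp
      ultimately show "lap (\<lambda>x. v x - u x) x = 0"
        using v u by (subst lap_diff) auto
    qed simp
    then obtain p where p: "smooth p" "\<And>x. lap p x = 0"
      "\<And>x. x \<in> cball 0 (c * R n) \<Longrightarrow> norm (v x - u x - p x) \<le> (1/2) ^ n" by blast
    have "smooth (\<lambda>x. u x + p x)" using u p by (intro smooth_add)
    moreover have "\<forall>x\<in>ball 0 (R (Suc n)). lap (\<lambda>x. u x + p x) x = f x"
      using u p by (auto simp: lap_add)
    moreover have "\<forall>x\<in>cball 0 (c * R n). norm (u x + p x - v x) \<le> (1/2) ^ n"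
    proof
      fix x :: 'a assume "x \<in> cball 0 (c * R n)"
      then show "norm (u x + p x - v x) \<le> (1/2) ^ n"
        using p(3)[of x] norm_minus_commute[of "v x - u x" "p x"] by (simp add: algebra_simps)
    qed
    ultimately show "\<exists>w. (smooth w \<and> (\<forall>x\<in>ball 0 (R (Suc n)). lap w x = f x)) \<and>
      (\<forall>x\<in>cball 0 (c * R n). norm (w x - v x) \<le> (1/2) ^ n)" by blast
  qed
  then obtain v where v: "\<And>n. smooth (v n)" "\<And>n x. x \<in> ball 0 (R n) \<Longrightarrow> lap (v n) x = f x"
    "\<And>n x. x \<in> cball 0 (c * R n) \<Longrightarrow> norm (v (Suc n) x - v n x) \<le> (1/2) ^ n"
    by blast
  \<comment> \<open>The partial sums of the geometric series are kept in closed form so that the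
    induction goes through; \<open>step'\<close> is the bound used afterwards.\<close>
  have step: "norm (v (n + k) x - v n x) \<le> 2 * (1/2) ^ n - 2 * (1/2) ^ (n + k)" if "norm x \<le> c * R n" for n k x
  proof (induction k)
    case (Suc k)
    have "c * R n \<le> c * R (n + k)" using Rmono[of n "n + k"] c by simp
    then have "norm (v (Suc (n + k)) x - v (n + k) x) \<le> (1/2) ^ (n + k)" using that v(3)[of x "n + k"] by simp
    then have "norm ((v (Suc (n + k)) x - v (n + k) x) + (v (n + k) x - v n x))
        \<le> (1/2) ^ (n + k) + (2 * (1/2) ^ n - 2 * (1/2) ^ (n + k))"
      using Suc by (intro norm_triangle_mono)
    then show ?case by simp
  qed simp
  have step': "norm (v (n + k) x - v n x) \<le> 2 * (1/2) ^ n" if "norm x \<le> c * R n" for n k x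
    using step[OF that, of k] by (smt (verit) zero_less_power half_gt_zero_iff zero_less_one)
  have half: "(\<lambda>n. 2 * (1/2) ^ n :: real) \<longlonglongrightarrow> 0"
    by (intro tendsto_mult_right_zero LIMSEQ_realpow_zero) auto
  have "convergent (\<lambda>n. v n x)" for x
  proof (rule Cauchy_convergent, rule metric_CauchyI)
    fix e :: real assume "e > 0"
    then obtain n1 where n1: "\<And>n. n \<ge> n1 \<Longrightarrow> 2 * (1/2) ^ n < e / 2"
      using LIMSEQ_D[OF half, of "e / 2"] by auto
    obtain n2 where n2: "norm x \<le> c * R n2" using Rlim by blast
    define n where "n = max n1 n2"
    have n: "norm x \<le> c * R n" "2 * (1/2) ^ n < e / 2"
      using n1[of n] n2 Rmono[of n2 n] c by (auto simp: n_def intro: order_trans)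
    have "dist (v m x) (v n x) < e / 2" if "m \<ge> n" for m
      using step'[OF n(1), of "m - n"] n(2) that by (simp add: dist_norm)
    then show "\<exists>M. \<forall>m\<ge>M. \<forall>n\<ge>M. dist (v m x) (v n x) < e"
      by (meson dist_triangle_half_l)
  qed
  then obtain V where V: "\<And>x. (\<lambda>n. v n x) \<longlonglongrightarrow> V x" unfolding convergent_def by metis
  have dV: "norm (V x - v n x) \<le> 2 * (1/2) ^ n" if "norm x \<le> c * R n" for n x
  proof (rule Lim_norm_ubound[OF _ tendsto_diff[OF V tendsto_const]])
    show "\<forall>\<^sub>F k in sequentially. norm (v k x - v n x) \<le> 2 * (1/2) ^ n"
      using eventually_ge_at_top[of n]
      by eventually_elim (use step'[OF that, of "_ - n"] in \<open>metis le_add_diff_inverse\<close>)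
  qed simp
  have cV: "continuous_on UNIV V"
  proof -
    have "isCont V x" for x
    proof -
      obtain n0 where n0: "norm x + 1 \<le> c * R n0" using Rlim by blast
      have "uniform_limit (ball x 1) v V sequentially"
      proof (rule uniform_limitI)
        fix e :: real assume "e > 0"
        have "\<forall>\<^sub>F n in sequentially. 2 * (1/2) ^ n < e"
          using order_tendstoD(2)[OF half \<open>e > 0\<close>] .
        then show "\<forall>\<^sub>F n in sequentially. \<forall>y\<in>ball x 1. dist (v n y) (V y) < e"
          using eventually_ge_at_top[of n0]
        proof eventually_elim
          case (elim n)
          show ?case
          proof
            fix y assume "y \<in> ball x 1"
            then have "norm y \<le> norm x + 1"
              using norm_triangle_ineq2[of y x] by (simp add: dist_norm norm_minus_commute)
            also have "\<dots> \<le> c * R n" using n0 Rmono[OF elim(2)] c by (meson mult_left_mono less_imp_le order_trans)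
            finally show "dist (v n y) (V y) < e"
              using dV[of y n] elim by (simp add: dist_norm norm_minus_commute)
          qed
        qed
      qed
      then have "continuous_on (ball x 1) V"
        by (rule uniform_limit_theorem[rotated])
           (auto intro!: always_eventually smooth_continuous_on v)
      then show ?thesis by (simp add: continuous_on_eq_continuous_at)
    qed
    then show ?thesis by (simp add: continuous_at_imp_continuous_on)
  qed
  have ev: "\<forall>\<^sub>F n in sequentially. \<forall>y\<in>ball x 1. lap (v n) y = f y" for x
  proof -
    obtain n0 where n0: "norm x + 1 \<le> c * R n0" using Rlim by blast
    show ?thesis using eventually_ge_at_top[of n0]
    proof eventually_elim
      case (elim n)
      have "c * R n0 \<le> R n" using Rmono[OF elim] c R(1)[of n0] mult_left_le_one_le[of "R n0" c] by linarith
      then have "y \<in> ball 0 (R n)" if "y \<in> ball x 1" for y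
        using that norm_triangle_ineq2[of y x] n0 by (simp add: dist_norm norm_minus_commute)
      then show ?case using v(2) by blast
    qed
  qed
  \<comment> \<open>At a fixed x the average sees \<open>v n\<close> on a bounded set only, where
    the convergence is uniform. So averages with any smooth kernel, derivatives of rho included,
    pass to the limit.\<close>
  have lim: "(\<lambda>n. avg k (\<lambda>y. y) (- One) One (v n) x) \<longlonglongrightarrow> avg k (\<lambda>y. y) (- One) One V x"
    if k: "smooth k" for k and x :: 'a
  proof -
    define I where "I = integral (cbox (- One) One) (\<lambda>z. \<bar>k z\<bar>)"
    have ck: "continuous_on (cbox (- One) One) k" by (rule smooth_continuous_on[OF k])
    obtain r where r: "\<And>y. y \<in> cbox (- One) One \<Longrightarrow> norm (y::'a) \<le> r"
      using bounded_cbox[of "- One" "One::'a"] by (auto simp: bounded_iff)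
    obtain n0 where n0: "norm x + r \<le> c * R n0" using Rlim by blast
    have "\<forall>\<^sub>F n in sequentially. norm (avg k (\<lambda>y. y) (- One) One (v n) x - avg k (\<lambda>y. y) (- One) One V x)
        \<le> I * (2 * (1/2) ^ n)"
      using eventually_ge_at_top[of n0]
    proof eventually_elim
      case (elim n)
      have "avg k (\<lambda>y. y) (- One) One (v n) x - avg k (\<lambda>y. y) (- One) One V x
          = avg k (\<lambda>y. y) (- One) One (\<lambda>y. v n y - V y) x"
        by (rule avg_diff[OF ck continuous_on_id _ cV, symmetric]) (rule smooth_continuous_on[OF v(1)])
      also have "norm \<dots> \<le> I * (2 * (1/2) ^ n)"
        unfolding I_def
      proof (rule norm_avg_le[OF ck continuous_on_id])
        show "continuous_on UNIV (\<lambda>y. v n y - V y)"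
          by (intro continuous_intros cV smooth_continuous_on v)
        fix y :: 'a assume "y \<in> cbox (- One) One"
        then have "norm (x - y) \<le> norm x + r" using r[of y] norm_triangle_ineq4[of x y] by simp
        also have "\<dots> \<le> c * R n" using n0 Rmono[OF elim] c by (meson mult_left_mono less_imp_le order_trans)
        finally show "norm (v n (x - y) - V (x - y)) \<le> 2 * (1/2) ^ n"
          using dV[of "x - y" n] by (simp add: norm_minus_commute)
      qed
      finally show ?case .
    qed
    then have "(\<lambda>n. avg k (\<lambda>y. y) (- One) One (v n) x - avg k (\<lambda>y. y) (- One) One V x) \<longlonglongrightarrow> 0"
      by (rule Lim_null_comparison) (intro tendsto_mult_right_zero half)
    then show ?thesis by (simp add: LIM_zero_iff)
  qed
  have Veq: "V x = moll 1 V x + parametrix 1 f x" for x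
  proof (rule LIMSEQ_unique[OF V])
    have "(\<lambda>n. moll 1 (v n) x + parametrix 1 f x) \<longlonglongrightarrow> moll 1 V x + parametrix 1 f x"
      unfolding moll_one by (intro tendsto_add tendsto_const lim smooth_rho)
    moreover have "\<forall>\<^sub>F n in sequentially. moll 1 (v n) x + parametrix 1 f x = v n x"
      using ev[of x]
    proof eventually_elim
      case (elim n)
      have "parametrix 1 (lap (v n)) x = parametrix 1 f x"
        by (rule parametrix_cong) (use elim in auto)
      then show ?case using moll_parametrix[OF v(1), of 1 n x] by simp
    qed
    ultimately show "(\<lambda>n. v n x) \<longlonglongrightarrow> moll 1 V x + parametrix 1 f x"
      by (rule Lim_transform_eventually)
  qed
  have smV: "smooth (moll 1 V)" by (rule smooth_moll_one[OF cV])
  \<comment> \<open>Both derivatives fall on rho, so \<open>lap (moll 1 V)\<close> is a limit that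
    involves no convergence of derivatives of \<open>v n\<close>.\<close>
  have lapm: "lap (moll 1 g) x = (\<Sum>i\<in>Basis. avg (pd i (pd i rho)) (\<lambda>y. y) (- One) One g x)"
    if "continuous_on UNIV g" for g :: "'a \<Rightarrow> 'b" and x
  proof -
    have z: "pd i rho y = 0" if "y \<notin> cbox (- One) One" for i y :: 'a
      using pd_zero_outside[OF closed_cbox rho_outside that] .
    show ?thesis unfolding lap_def moll_one
      by (intro sum.cong refl)
        (simp add: pd_conv[OF smooth_rho rho_outside that] pd_conv[OF smooth_pd[OF smooth_rho] z that])
  qed
  show ?thesis
  proof (rule that)
    have VV: "V = (\<lambda>x. moll 1 V x + parametrix 1 f x)" using Veq by blast
    show "smooth V" by (subst VV) (intro smooth_add smV smooth_parametrix f)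
    fix x
    \<comment> \<open>With \<open>lap_parametrix\<close> this gives lap V = moll 1 f + (f - moll 1
      f).\<close>
    have "lap (moll 1 V) x = moll 1 f x"
    proof (rule LIMSEQ_unique)
      show "(\<lambda>n. lap (moll 1 (v n)) x) \<longlonglongrightarrow> lap (moll 1 V) x"
        unfolding lapm[OF cV] lapm[OF smooth_continuous_on[OF v(1)]]
        by (intro tendsto_sum lim smooth_pd smooth_rho)
      have "\<forall>\<^sub>F n in sequentially. moll 1 f x = lap (moll 1 (v n)) x"
        using ev[of x]
      proof eventually_elim
        case (elim n)
        have "lap (moll 1 (v n)) x = moll 1 (lap (v n)) x"
          unfolding moll_def by (rule lap_avg[OF moll_weight v(1)])
        also have "\<dots> = moll 1 f x" by (rule moll_cong) (use elim in auto)
        finally show ?case by simp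
      qed
      then show "(\<lambda>n. lap (moll 1 (v n)) x) \<longlonglongrightarrow> moll 1 f x"
        by (rule Lim_transform_eventually[OF tendsto_const])
    qed
    then show "lap V x = f x"
      by (subst VV) (simp add: lap_add smV smooth_parametrix f lap_parametrix)
  qed
qed

subsection \<open>Test functions and continuous functionals\<close>

lemma supp_subset_iff: "closed K \<Longrightarrow> supp f \<subseteq> K \<longleftrightarrow> (\<forall>x. x \<notin> K \<longrightarrow> f x = 0)"
proof
  assume "supp f \<subseteq> K"
  then show "\<forall>x. x \<notin> K \<longrightarrow> f x = 0"
    using closure_subset[of "{x. f x \<noteq> 0}"] unfolding supp_def by blast
next
  assume "closed K" "\<forall>x. x \<notin> K \<longrightarrow> f x = 0"
  then show "supp f \<subseteq> K"
    unfolding supp_def by (intro closure_minimal) auto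
qed

lemma outside_supp: "x \<notin> supp f \<Longrightarrow> f x = 0"
  unfolding supp_def using closure_subset[of "{x. f x \<noteq> 0}"] by blast

lemma test_functionsI:
  assumes "smooth \<phi>" "\<And>x. \<phi> x \<in> V" "compact K" "\<And>x. x \<notin> K \<Longrightarrow> \<phi> x = 0"
  shows "\<phi> \<in> test_functions V"
proof -
  have "supp \<phi> \<subseteq> K" using assms by (subst supp_subset_iff) (auto simp: compact_imp_closed)
  moreover have "closed (supp \<phi>)" by (simp add: supp_def)
  ultimately have "compact (supp \<phi>)"
    using assms(3) compact_Int_closed[of K "supp \<phi>"] by (simp add: inf.absorb2)
  then show ?thesis using assms by (auto simp: test_functions_def smooth_functions_def)
qed

lemma test_functionsD:
  assumes "\<phi> \<in> test_functions V"
  shows "smooth \<phi>" "\<phi> x \<in> V" "compact (supp \<phi>)"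
  using assms by (auto simp: test_functions_def smooth_functions_def)

lemma test_functions_mono: "V \<subseteq> W \<Longrightarrow> test_functions V \<subseteq> test_functions W"
  by (auto simp: test_functions_def smooth_functions_def)

text \<open>A real \<open>SUP\<close> is meaningful only over a bounded family; compact support
  provides this for every summand of \<open>C_norm\<close>.\<close>

lemma test_pds_bounded:
  assumes "\<phi> \<in> test_functions V" "set bs \<subseteq> Basis"
  shows "bdd_above (range (\<lambda>x. norm (pds bs \<phi> x)))"
proof -
  have "bounded (pds bs \<phi> ` supp \<phi>)"
    by (intro compact_imp_bounded compact_continuous_image smooth_continuous_on smooth_pds
        test_functionsD[OF assms(1)] assms(2))
  then obtain B where B: "\<And>x. x \<in> supp \<phi> \<Longrightarrow> norm (pds bs \<phi> x) \<le> B" "B > 0"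
    by (auto simp: bounded_pos)
  have "norm (pds bs \<phi> x) \<le> B" for x
  proof (cases "x \<in> supp \<phi>")
    case False
    then have "pds bs \<phi> x = 0"
      by (intro pds_zero_outside[of "supp \<phi>"]) (auto simp: supp_def intro: outside_supp[unfolded supp_def])
    then show ?thesis using B by simp
  qed (use B in auto)
  then show ?thesis by (auto intro!: bdd_aboveI)
qed

lemma finite_multiindices: "finite {bs. set bs \<subseteq> (Basis :: 'a::euclidean_space set) \<and> length bs \<le> N}"
  by (rule finite_lists_length_le) simp

lemma norm_pds_le_C_norm:
  assumes "\<phi> \<in> test_functions V" "set bs \<subseteq> Basis" "length bs \<le> N"
  shows "norm (pds bs \<phi> x) \<le> C_norm N \<phi>"
proof -
  have "norm (pds bs \<phi> x) \<le> (SUP x. norm (pds bs \<phi> x))"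
    by (rule cSUP_upper) (use test_pds_bounded[OF assms(1,2)] in auto)
  also have "\<dots> \<le> C_norm N \<phi>"
    unfolding C_norm_def
  proof (rule member_le_sum[of bs])
    fix cs :: "'a list" assume "cs \<in> {bs. set bs \<subseteq> Basis \<and> length bs \<le> N} - {bs}"
    then have "norm (pds cs \<phi> 0) \<le> (SUP x. norm (pds cs \<phi> x))"
      by (intro cSUP_upper) (use test_pds_bounded[OF assms(1)] in auto)
    then show "0 \<le> (SUP x. norm (pds cs \<phi> x))" using norm_ge_zero order_trans by blast
  qed (use assms finite_multiindices in auto)
  finally show ?thesis .
qed

lemma C_norm_nonneg: "\<phi> \<in> test_functions V \<Longrightarrow> 0 \<le> C_norm N \<phi>"
  by (rule order_trans[OF norm_ge_zero norm_pds_le_C_norm[of \<phi> V "[]"]]) auto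

lemma C_norm_le:
  fixes f :: "'a::euclidean_space \<Rightarrow> 'b::euclidean_space"
  assumes "\<And>bs x. set bs \<subseteq> Basis \<Longrightarrow> length bs \<le> N \<Longrightarrow> norm (pds bs f x) \<le> B"
  shows "C_norm N f \<le> real (card {bs. set bs \<subseteq> (Basis :: 'a set) \<and> length bs \<le> N}) * B"
  unfolding C_norm_def by (rule sum_bounded_above) (auto intro!: cSUP_least assms)

text \<open>The conditions of \<open>distributions\<close> apart from the normalisation outside the
  test functions, which need not survive composition with operators.
  \<open>dist_on_distributions\<close> restores it at the end.\<close>

definition dist_on :: "(complex ^ 'k::finite) set \<Rightarrow> (('a::euclidean_space \<Rightarrow> complex ^ 'k) \<Rightarrow> complex) \<Rightarrow> bool" where
  "dist_on V u \<longleftrightarrow>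
     (\<forall>\<phi>\<in>test_functions V. \<forall>\<psi>\<in>test_functions V. u (\<lambda>x. \<phi> x + \<psi> x) = u \<phi> + u \<psi>) \<and>
     (\<forall>c. \<forall>\<phi>\<in>test_functions V. u (\<lambda>x. c *s \<phi> x) = c * u \<phi>) \<and>
     (\<forall>K. compact K \<longrightarrow> (\<exists>C N. \<forall>\<phi>\<in>test_functions V. supp \<phi> \<subseteq> K \<longrightarrow> norm (u \<phi>) \<le> C * C_norm N \<phi>))"

definition linear_space :: "(complex ^ 'k::finite) set \<Rightarrow> bool" where
  "linear_space V \<longleftrightarrow> 0 \<in> V \<and> (\<forall>v\<in>V. \<forall>w\<in>V. v + w \<in> V) \<and> (\<forall>c. \<forall>v\<in>V. c *s v \<in> V)"

lemma scaleR_vec_scale: "c *\<^sub>R v = complex_of_real c *s (v :: complex ^ 'k::finite)"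
proof (rule vec_eq_iff[THEN iffD2], rule allI)
  show "(c *\<^sub>R v) $ i = (complex_of_real c *s v) $ i" for i
    unfolding vector_scaleR_component vector_smult_component by (rule scaleR_conv_of_real)
qed

lemma bounded_linear_vec_scale: "bounded_linear (\<lambda>v :: complex ^ 'k::finite. c *s v)"
  by (rule linear_conv_bounded_linear[THEN iffD1], rule linearI)
     (auto simp: vec_eq_iff algebra_simps)

lemma test_add:
  assumes "linear_space V" "\<phi> \<in> test_functions V" "\<psi> \<in> test_functions V"
  shows "(\<lambda>x. \<phi> x + \<psi> x) \<in> test_functions V"
  by (rule test_functionsI[of _ _ "supp \<phi> \<union> supp \<psi>"])
     (use assms test_functionsD[OF assms(2)] test_functionsD[OF assms(3)] in
       \<open>auto simp: outside_supp linear_space_def intro: smooth_add\<close>)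

lemma test_scale:
  assumes "linear_space V" "\<phi> \<in> test_functions V"
  shows "(\<lambda>x. c *s \<phi> x) \<in> test_functions V"
  by (rule test_functionsI[of _ _ "supp \<phi>"])
     (use assms test_functionsD[OF assms(2)] in
       \<open>auto simp: outside_supp linear_space_def intro: smooth_linear[OF bounded_linear_vec_scale]\<close>)

lemma test_zero: "linear_space V \<Longrightarrow> (\<lambda>x. 0) \<in> test_functions V"
  by (rule test_functionsI[of _ _ "{}"]) (auto simp: linear_space_def)

lemma test_sum:
  assumes "linear_space V" "finite I" "\<And>i. i \<in> I \<Longrightarrow> \<phi> i \<in> test_functions V"
  shows "(\<lambda>x. \<Sum>i\<in>I. \<phi> i x) \<in> test_functions V"
  using assms(2,3)
proof (induction I)
  case (insert j I)
  then show ?case using test_add[OF assms(1), of "\<phi> j" "\<lambda>x. \<Sum>i\<in>I. \<phi> i x"] by simp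
qed (simp add: test_zero assms)

lemma dist_on_plus:
  "dist_on V u \<Longrightarrow> \<phi> \<in> test_functions V \<Longrightarrow> \<psi> \<in> test_functions V \<Longrightarrow> u (\<lambda>x. \<phi> x + \<psi> x) = u \<phi> + u \<psi>"
  unfolding dist_on_def by blast

lemma dist_on_mult: "dist_on V u \<Longrightarrow> \<phi> \<in> test_functions V \<Longrightarrow> u (\<lambda>x. c *s \<phi> x) = c * u \<phi>"
  unfolding dist_on_def by blast

lemma dist_on_bound:
  "dist_on V u \<Longrightarrow> compact K \<Longrightarrow>
     \<exists>C N. \<forall>\<phi>\<in>test_functions V. supp \<phi> \<subseteq> K \<longrightarrow> norm (u \<phi>) \<le> C * C_norm N \<phi>"
  by (simp add: dist_on_def)

lemma dist_on_zero: "dist_on V u \<Longrightarrow> linear_space V \<Longrightarrow> u (\<lambda>x. 0) = 0"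
  using dist_on_plus[of V u "\<lambda>x. 0" "\<lambda>x. 0"] test_zero[of V] by simp

lemma dist_on_sum:
  assumes "dist_on V u" "linear_space V" "finite I" "\<And>i. i \<in> I \<Longrightarrow> \<phi> i \<in> test_functions V"
  shows "u (\<lambda>x. \<Sum>i\<in>I. \<phi> i x) = (\<Sum>i\<in>I. u (\<phi> i))"
  using assms(3,4)
proof (induction I)
  case empty then show ?case using dist_on_zero assms by simp
next
  case (insert j I)
  have "(\<lambda>x. \<Sum>i\<in>I. \<phi> i x) \<in> test_functions V" "\<phi> j \<in> test_functions V"
    using insert assms by (auto intro: test_sum)
  then show ?case using insert dist_on_plus[OF assms(1), of "\<phi> j" "\<lambda>x. \<Sum>i\<in>I. \<phi> i x"] by simp
qed

lemma dist_on_scaleR: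
  fixes V :: "(complex ^ 'k::finite) set" and u :: "('a::euclidean_space \<Rightarrow> complex ^ 'k) \<Rightarrow> complex"
  assumes "dist_on V u" "\<phi> \<in> test_functions V"
  shows "u (\<lambda>x. c *\<^sub>R \<phi> x) = c *\<^sub>R u \<phi>"
proof -
  show ?thesis unfolding scaleR_vec_scale dist_on_mult[OF assms] by (simp add: scaleR_conv_of_real)
qed

lemma dist_on_diff:
  assumes "dist_on V u" "linear_space V" "\<phi> \<in> test_functions V" "\<psi> \<in> test_functions V"
  shows "(\<lambda>x. \<phi> x - \<psi> x) \<in> test_functions V" "u (\<lambda>x. \<phi> x - \<psi> x) = u \<phi> - u \<psi>"
proof -
  have "(\<lambda>x. (-1) *s \<psi> x) \<in> test_functions V" by (rule test_scale[OF assms(2,4)])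
  moreover have "(\<lambda>x. \<phi> x + (-1) *s \<psi> x) = (\<lambda>x. \<phi> x - \<psi> x)" by (auto simp: vec_eq_iff)
  ultimately show "(\<lambda>x. \<phi> x - \<psi> x) \<in> test_functions V" "u (\<lambda>x. \<phi> x - \<psi> x) = u \<phi> - u \<psi>"
    using test_add[OF assms(2,3), of "\<lambda>x. (-1) *s \<psi> x"] dist_on_plus[OF assms(1,3), of "\<lambda>x. (-1) *s \<psi> x"]
      dist_on_mult[OF assms(1,4), of "-1"] by simp_all
qed

lemma distributions_dist_on: "u \<in> distributions V \<Longrightarrow> dist_on V u"
  unfolding distributions_def dist_on_def mem_Collect_eq by (elim conjE, intro conjI)

lemma dist_on_cong:
  fixes V :: "(complex ^ 'k::finite) set" and u :: "('a::euclidean_space \<Rightarrow> complex ^ 'k) \<Rightarrow> complex"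
  assumes "dist_on V u" "linear_space V" "\<And>\<phi>. \<phi> \<in> test_functions V \<Longrightarrow> u \<phi> = v \<phi>"
  shows "dist_on V v"
  unfolding dist_on_def
proof (intro conjI allI impI ballI)
  fix K :: "'a set" assume "compact K"
  then obtain C N where "\<forall>\<phi>\<in>test_functions V. supp \<phi> \<subseteq> K \<longrightarrow> norm (u \<phi>) \<le> C * C_norm N \<phi>"
    using dist_on_bound[OF assms(1)] by blast
  then show "\<exists>C N. \<forall>\<phi>\<in>test_functions V. supp \<phi> \<subseteq> K \<longrightarrow> norm (v \<phi>) \<le> C * C_norm N \<phi>"
    using assms(3) by (intro exI[of _ C] exI[of _ N]) auto
next
  fix \<phi> \<psi> :: "'a \<Rightarrow> complex ^ 'k" and c :: complex
  assume t: "\<phi> \<in> test_functions V"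
  show "v (\<lambda>x. c *s \<phi> x) = c * v \<phi>"
    unfolding assms(3)[OF test_scale[OF assms(2) t], symmetric] assms(3)[OF t, symmetric]
    by (rule dist_on_mult[OF assms(1) t])
  assume t': "\<psi> \<in> test_functions V"
  show "v (\<lambda>x. \<phi> x + \<psi> x) = v \<phi> + v \<psi>"
    unfolding assms(3)[OF test_add[OF assms(2) t t'], symmetric] assms(3)[OF t, symmetric] assms(3)[OF t', symmetric]
    by (rule dist_on_plus[OF assms(1) t t'])
qed

lemma dist_on_distributions:
  assumes "dist_on V u" "linear_space V"
  shows "(\<lambda>\<phi>. if \<phi> \<in> test_functions V then u \<phi> else 0) \<in> distributions V"
proof -
  have "dist_on V (\<lambda>\<phi>. if \<phi> \<in> test_functions V then u \<phi> else 0)"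
    by (rule dist_on_cong[OF assms]) simp
  then show ?thesis
    unfolding distributions_def dist_on_def mem_Collect_eq by (elim conjE, intro conjI) auto
qed

lemma dist_on_add:
  fixes V :: "(complex ^ 'k::finite) set" and u :: "('a::euclidean_space \<Rightarrow> complex ^ 'k) \<Rightarrow> complex"
  assumes "dist_on V u" "dist_on V v"
  shows "dist_on V (\<lambda>\<phi>. u \<phi> + v \<phi>)"
  unfolding dist_on_def
proof (intro conjI allI impI ballI)
  fix K :: "'a set" assume K: "compact K"
  obtain C N where 1: "\<And>\<phi>. \<phi> \<in> test_functions V \<Longrightarrow> supp \<phi> \<subseteq> K \<Longrightarrow> norm (u \<phi>) \<le> C * C_norm N \<phi>"
    using dist_on_bound[OF assms(1) K] by blast
  obtain D M where 2: "\<And>\<phi>. \<phi> \<in> test_functions V \<Longrightarrow> supp \<phi> \<subseteq> K \<Longrightarrow> norm (v \<phi>) \<le> D * C_norm M \<phi>"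
    using dist_on_bound[OF assms(2) K] by blast
  \<comment> \<open>The two functionals have estimates of different orders, and both are raised to
    the larger one. The number of multi-indices enters because \<open>C_norm\<close> is a
    sum.\<close>
  have mono: "C_norm L \<phi> \<le> real (card {bs. set bs \<subseteq> (Basis :: 'a set) \<and> length bs \<le> L}) * C_norm (max N M) \<phi>"
    if "\<phi> \<in> test_functions V" "L \<le> max N M" for \<phi> :: "'a \<Rightarrow> complex ^ 'k" and L
    by (rule C_norm_le, rule norm_pds_le_C_norm[OF that(1)]) (use that in auto)
  let ?c = "\<lambda>L. real (card {bs. set bs \<subseteq> (Basis :: 'a set) \<and> length bs \<le> L})"
  have "norm (u \<phi> + v \<phi>) \<le> (\<bar>C\<bar> * ?c N + \<bar>D\<bar> * ?c M) * C_norm (max N M) \<phi>"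
    if t: "\<phi> \<in> test_functions V" and s: "supp \<phi> \<subseteq> K" for \<phi>
  proof -
    have "norm (u \<phi> + v \<phi>) \<le> \<bar>C\<bar> * C_norm N \<phi> + \<bar>D\<bar> * C_norm M \<phi>"
      using 1[OF t s] 2[OF t s] C_norm_nonneg[OF t]
        mult_right_mono[of C "\<bar>C\<bar>" "C_norm N \<phi>"] mult_right_mono[of D "\<bar>D\<bar>" "C_norm M \<phi>"]
      by (intro norm_triangle_le) (smt (verit) abs_ge_self)
    also have "\<dots> \<le> \<bar>C\<bar> * (?c N * C_norm (max N M) \<phi>) + \<bar>D\<bar> * (?c M * C_norm (max N M) \<phi>)"
      by (intro add_mono mult_left_mono mono t) auto
    finally show ?thesis by (simp add: algebra_simps)
  qed
  then show "\<exists>C N. \<forall>\<phi>\<in>test_functions V. supp \<phi> \<subseteq> K \<longrightarrow> norm (u \<phi> + v \<phi>) \<le> C * C_norm N \<phi>"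
    by blast
qed (use assms in \<open>auto simp: dist_on_def algebra_simps\<close>)

lemma dist_on_scale:
  fixes V :: "(complex ^ 'k::finite) set" and u :: "('a::euclidean_space \<Rightarrow> complex ^ 'k) \<Rightarrow> complex"
  assumes "dist_on V u"
  shows "dist_on V (\<lambda>\<phi>. c * u \<phi>)"
  unfolding dist_on_def
proof (intro conjI allI impI ballI)
  fix K :: "'a set" assume K: "compact K"
  obtain C N where 1: "\<And>\<phi>. \<phi> \<in> test_functions V \<Longrightarrow> supp \<phi> \<subseteq> K \<Longrightarrow> norm (u \<phi>) \<le> C * C_norm N \<phi>"
    using dist_on_bound[OF assms(1) K] by blast
  have "norm (c * u \<phi>) \<le> (norm c * C) * C_norm N \<phi>" if "\<phi> \<in> test_functions V" "supp \<phi> \<subseteq> K" for \<phi>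
    using mult_left_mono[OF 1[OF that], of "norm c"] by (simp add: norm_mult mult_ac)
  then show "\<exists>C N. \<forall>\<phi>\<in>test_functions V. supp \<phi> \<subseteq> K \<longrightarrow> norm (c * u \<phi>) \<le> C * C_norm N \<phi>"
    by blast
qed (use assms in \<open>auto simp: dist_on_def algebra_simps\<close>)

lemma dist_on_const_zero: "dist_on V (\<lambda>\<phi>. 0)"
  unfolding dist_on_def by (auto intro!: exI[of _ 0])

lemma dist_on_sums: "(\<And>i. i \<in> I \<Longrightarrow> dist_on V (u i)) \<Longrightarrow> dist_on V (\<lambda>\<phi>. \<Sum>i\<in>I. u i \<phi>)"
  by (induction I rule: infinite_finite_induct) (auto intro: dist_on_add dist_on_const_zero)

subsection \<open>Continuous operators on test functions\<close>

text \<open>Continuous linear operators between spaces of test functions: exactly what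
  precomposition of a distribution needs. The last clause bounds derivatives pointwise and leaves
  the suprema to \<open>C_norm_le\<close>.\<close>

definition test_map :: "(complex ^ 'k::finite) set \<Rightarrow> (complex ^ 'l::finite) set \<Rightarrow>
    (('a::euclidean_space \<Rightarrow> complex ^ 'k) \<Rightarrow> 'a \<Rightarrow> complex ^ 'l) \<Rightarrow> bool" where
  "test_map V W P \<longleftrightarrow>
     (\<forall>\<phi>\<in>test_functions V. smooth (P \<phi>) \<and> (\<forall>x. P \<phi> x \<in> W)) \<and>
     (\<forall>\<phi>\<in>test_functions V. \<forall>\<psi>\<in>test_functions V. P (\<lambda>x. \<phi> x + \<psi> x) = (\<lambda>x. P \<phi> x + P \<psi> x)) \<and>
     (\<forall>c. \<forall>\<phi>\<in>test_functions V. P (\<lambda>x. c *s \<phi> x) = (\<lambda>x. c *s P \<phi> x)) \<and>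
     (\<forall>K. compact K \<longrightarrow> (\<exists>K'. compact K' \<and>
        (\<forall>\<phi>\<in>test_functions V. supp \<phi> \<subseteq> K \<longrightarrow> (\<forall>x. x \<notin> K' \<longrightarrow> P \<phi> x = 0)))) \<and>
     (\<forall>N. \<exists>C M. \<forall>\<phi>\<in>test_functions V. \<forall>bs x. set bs \<subseteq> Basis \<longrightarrow> length bs \<le> N \<longrightarrow>
        norm (pds bs (P \<phi>) x) \<le> C * C_norm M \<phi>)"

lemma test_map_test:
  assumes "test_map V W P" "\<phi> \<in> test_functions V"
  shows "P \<phi> \<in> test_functions W"
proof -
  obtain K' where "compact K'" "\<forall>x. x \<notin> K' \<longrightarrow> P \<phi> x = 0"
    using assms test_functionsD(3)[OF assms(2)] unfolding test_map_def by (metis order_refl)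
  then show ?thesis using assms unfolding test_map_def by (intro test_functionsI[of _ _ K']) auto
qed

lemma dist_on_test_map:
  fixes P :: "('a::euclidean_space \<Rightarrow> complex ^ 'k::finite) \<Rightarrow> 'a \<Rightarrow> complex ^ 'l::finite"
  assumes u: "dist_on W u" and P: "test_map V W P"
  shows "dist_on V (\<lambda>\<phi>. u (P \<phi>))"
  unfolding dist_on_def
proof (intro conjI allI impI ballI)
  fix K :: "'a set" assume "compact K"
  then obtain K' where K': "compact K'"
      "\<And>\<phi> x. \<phi> \<in> test_functions V \<Longrightarrow> supp \<phi> \<subseteq> K \<Longrightarrow> x \<notin> K' \<Longrightarrow> P \<phi> x = 0"
    using P unfolding test_map_def by meson
  obtain C N where C: "\<And>\<phi>. \<phi> \<in> test_functions W \<Longrightarrow> supp \<phi> \<subseteq> K' \<Longrightarrow> norm (u \<phi>) \<le> C * C_norm N \<phi>"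
    using dist_on_bound[OF u K'(1)] by blast
  obtain D M where D: "\<And>\<phi> bs x. \<phi> \<in> test_functions V \<Longrightarrow> set bs \<subseteq> Basis \<Longrightarrow> length bs \<le> N \<Longrightarrow>
        norm (pds bs (P \<phi>) x) \<le> D * C_norm M \<phi>"
    using P unfolding test_map_def by meson
  let ?c = "real (card {bs. set bs \<subseteq> (Basis :: 'a set) \<and> length bs \<le> N})"
  have "norm (u (P \<phi>)) \<le> (\<bar>C\<bar> * ?c * D) * C_norm M \<phi>" if t: "\<phi> \<in> test_functions V" and s: "supp \<phi> \<subseteq> K" for \<phi>
  proof -
    have "supp (P \<phi>) \<subseteq> K'" using K'(2)[OF t s] K'(1) by (subst supp_subset_iff) (auto simp: compact_imp_closed)
    then have "norm (u (P \<phi>)) \<le> C * C_norm N (P \<phi>)" by (intro C test_map_test[OF P t])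
    also have "\<dots> \<le> \<bar>C\<bar> * C_norm N (P \<phi>)"
      by (intro mult_right_mono C_norm_nonneg[OF test_map_test[OF P t]]) auto
    also have "\<dots> \<le> \<bar>C\<bar> * (?c * (D * C_norm M \<phi>))"
      by (intro mult_left_mono C_norm_le D t) auto
    finally show ?thesis by (simp add: mult_ac)
  qed
  then show "\<exists>C N. \<forall>\<phi>\<in>test_functions V. supp \<phi> \<subseteq> K \<longrightarrow> norm (u (P \<phi>)) \<le> C * C_norm N \<phi>"
    by blast
qed (use u P test_map_test[OF P] in \<open>auto simp: dist_on_def test_map_def\<close>)

lemma test_map_linear:
  fixes L :: "complex ^ 'k::finite \<Rightarrow> complex ^ 'l::finite"
  assumes add: "\<And>v w. L (v + w) = L v + L w" and scale: "\<And>c v. L (c *s v) = c *s L v"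
    and V: "\<And>v. v \<in> V \<Longrightarrow> L v \<in> W"
  shows "test_map V W (\<lambda>\<phi> (x::'a::euclidean_space). L (\<phi> x))"
proof -
  have L: "bounded_linear L"
    by (rule linear_conv_bounded_linear[THEN iffD1], rule linearI)
       (simp_all add: add scaleR_vec_scale scale)
  obtain B where B: "\<And>v. norm (L v) \<le> norm v * B" "B \<ge> 0"
    using bounded_linear.nonneg_bounded[OF L] by blast
  have L0: "L 0 = 0" by (rule linear_0[OF bounded_linear.linear[OF L]])
  show ?thesis unfolding test_map_def
  proof (intro conjI allI impI ballI)
    fix K :: "'a set" assume "compact K"
    then show "\<exists>K'. compact K' \<and> (\<forall>\<phi>\<in>test_functions V. supp \<phi> \<subseteq> K \<longrightarrow> (\<forall>x. x \<notin> K' \<longrightarrow> L (\<phi> x) = 0))"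
      by (intro exI[of _ K]) (auto simp: supp_subset_iff compact_imp_closed L0)
  next
    fix N
    show "\<exists>C M. \<forall>\<phi>\<in>test_functions V. \<forall>bs (x::'a). set bs \<subseteq> Basis \<longrightarrow> length bs \<le> N \<longrightarrow>
        norm (pds bs (\<lambda>x. L (\<phi> x)) x) \<le> C * C_norm M \<phi>"
    proof (intro exI ballI allI impI)
      fix \<phi> :: "'a \<Rightarrow> complex ^ 'k" and bs :: "'a list" and x
      assume t: "\<phi> \<in> test_functions V" and bs: "set bs \<subseteq> Basis" "length bs \<le> N"
      have "norm (L (pds bs \<phi> x)) \<le> norm (pds bs \<phi> x) * B" by (rule B)
      also have "\<dots> \<le> C_norm N \<phi> * B" by (intro mult_right_mono B norm_pds_le_C_norm[OF t] bs)
      finally show "norm (pds bs (\<lambda>x. L (\<phi> x)) x) \<le> B * C_norm N \<phi>"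
        by (simp add: pds_linear[OF L test_functionsD(1)[OF t] bs(1)] mult.commute)
    qed
  qed (auto simp: add scale test_functionsD intro: V test_functionsD(2) smooth_linear[OF L])
qed

text \<open>The spinor modules, \<open>V2\<close> and \<open>V3\<close> all have this form. It is
  preserved by partial derivatives, and the coordinate projection onto it commutes with
  them.\<close>

definition coord_space :: "'k::finite set \<Rightarrow> (complex ^ 'k) set" where
  "coord_space J = {v. \<forall>k\<in>J. v $ k = 0}"

lemma linear_space_coord_space: "linear_space (coord_space J)"
  by (auto simp: linear_space_def coord_space_def)

lemma linear_space_UNIV: "linear_space UNIV"
  by (auto simp: linear_space_def)

lemma pd_vec_nth: "smooth f \<Longrightarrow> pd i f x $ k = pd i (\<lambda>x. f x $ k) x"
  using pd_linear[OF bounded_linear_vec_nth smooth_differentiable] by metis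

lemma pd_coord_space:
  assumes "smooth f" "\<And>x. f x \<in> coord_space J"
  shows "pd i f x \<in> coord_space J"
  using assms(2) unfolding coord_space_def by (auto simp: pd_vec_nth[OF assms(1)])

lemma test_map_pd:
  assumes i: "i \<in> Basis"
  shows "test_map (coord_space (J :: 'k::finite set)) (coord_space J) (pd (i :: 'a::euclidean_space))"
  unfolding test_map_def
proof (intro conjI allI impI ballI)
  fix K :: "'a set" assume "compact K"
  then show "\<exists>K'. compact K' \<and> (\<forall>\<phi>\<in>test_functions (coord_space J). supp \<phi> \<subseteq> K \<longrightarrow> (\<forall>x. x \<notin> K' \<longrightarrow> pd i \<phi> x = 0))"
    by (intro exI[of _ K]) (auto simp: supp_subset_iff compact_imp_closed intro!: pd_zero_outside[of K])
next
  fix N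
  show "\<exists>C M. \<forall>\<phi>\<in>test_functions (coord_space J). \<forall>bs x. set bs \<subseteq> Basis \<longrightarrow> length bs \<le> N \<longrightarrow>
      norm (pds bs (pd i \<phi>) x) \<le> C * C_norm M \<phi>"
  proof (intro exI ballI allI impI)
    fix \<phi> :: "'a \<Rightarrow> complex ^ 'k" and bs :: "'a list" and x
    assume "\<phi> \<in> test_functions (coord_space J)" "set bs \<subseteq> Basis" "length bs \<le> N"
    then show "norm (pds bs (pd i \<phi>) x) \<le> 1 * C_norm (Suc N) \<phi>"
      using norm_pds_le_C_norm[of \<phi> "coord_space J" "bs @ [i]" "Suc N" x] i by (simp add: pds_snoc)
  qed
next
  fix \<phi> \<psi> :: "'a \<Rightarrow> complex ^ 'k" and c :: complex
  assume t: "\<phi> \<in> test_functions (coord_space J)"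
  note sm = test_functionsD(1)[OF t]
  show "smooth (pd i \<phi>)" by (rule smooth_pd[OF sm i])
  show "pd i \<phi> x \<in> coord_space J" for x by (rule pd_coord_space[OF sm test_functionsD(2)[OF t]])
  show "pd i (\<lambda>x. c *s \<phi> x) = (\<lambda>x. c *s pd i \<phi> x)"
    using pd_linear[OF bounded_linear_vec_scale smooth_differentiable[OF sm]] by blast
  assume "\<psi> \<in> test_functions (coord_space J)"
  then show "pd i (\<lambda>x. \<phi> x + \<psi> x) = (\<lambda>x. pd i \<phi> x + pd i \<psi> x)"
    using pd_add[OF smooth_differentiable[OF sm] smooth_differentiable[OF test_functionsD(1)]] by blast
qed

lemma coord_space_empty [simp]: "coord_space {} = UNIV"
  by (simp add: coord_space_def)

lemma test_map_comp:
  fixes P :: "('a::euclidean_space \<Rightarrow> complex ^ 'k::finite) \<Rightarrow> 'a \<Rightarrow> complex ^ 'l::finite"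
  assumes P: "test_map V W P" and Q: "test_map W X Q"
  shows "test_map V X (\<lambda>\<phi>. Q (P \<phi>))"
  unfolding test_map_def
proof (intro conjI allI impI ballI)
  fix K :: "'a set" assume "compact K"
  then obtain K' where K': "compact K'"
      "\<And>\<phi> x. \<phi> \<in> test_functions V \<Longrightarrow> supp \<phi> \<subseteq> K \<Longrightarrow> x \<notin> K' \<Longrightarrow> P \<phi> x = 0"
    using P unfolding test_map_def by meson
  obtain K'' where K'': "compact K''"
      "\<And>\<phi> x. \<phi> \<in> test_functions W \<Longrightarrow> supp \<phi> \<subseteq> K' \<Longrightarrow> x \<notin> K'' \<Longrightarrow> Q \<phi> x = 0"
    using Q K'(1) unfolding test_map_def by meson
  have "supp (P \<phi>) \<subseteq> K'" if "\<phi> \<in> test_functions V" "supp \<phi> \<subseteq> K" for \<phi>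
    using K'(2)[OF that] K'(1) by (subst supp_subset_iff) (auto simp: compact_imp_closed)
  then show "\<exists>K'. compact K' \<and> (\<forall>\<phi>\<in>test_functions V. supp \<phi> \<subseteq> K \<longrightarrow> (\<forall>x. x \<notin> K' \<longrightarrow> Q (P \<phi>) x = 0))"
    using K'' test_map_test[OF P] by (intro exI[of _ K'']) blast
next
  fix N
  obtain C M where C: "\<And>\<phi> bs x. \<phi> \<in> test_functions W \<Longrightarrow> set bs \<subseteq> Basis \<Longrightarrow> length bs \<le> N \<Longrightarrow>
        norm (pds bs (Q \<phi>) x) \<le> C * C_norm M \<phi>"
    using Q unfolding test_map_def by meson
  obtain D L where D: "\<And>\<phi> bs x. \<phi> \<in> test_functions V \<Longrightarrow> set bs \<subseteq> Basis \<Longrightarrow> length bs \<le> M \<Longrightarrow>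
        norm (pds bs (P \<phi>) x) \<le> D * C_norm L \<phi>"
    using P unfolding test_map_def by meson
  let ?c = "real (card {bs. set bs \<subseteq> (Basis :: 'a set) \<and> length bs \<le> M})"
  show "\<exists>C M. \<forall>\<phi>\<in>test_functions V. \<forall>bs x. set bs \<subseteq> Basis \<longrightarrow> length bs \<le> N \<longrightarrow>
        norm (pds bs (Q (P \<phi>)) x) \<le> C * C_norm M \<phi>"
  proof (intro exI ballI allI impI)
    fix \<phi> :: "'a \<Rightarrow> complex ^ 'k" and bs :: "'a list" and x
    assume t: "\<phi> \<in> test_functions V" and bs: "set bs \<subseteq> Basis" "length bs \<le> N"
    have "norm (pds bs (Q (P \<phi>)) x) \<le> C * C_norm M (P \<phi>)"
      by (intro C test_map_test[OF P t] bs)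
    also have "\<dots> \<le> \<bar>C\<bar> * C_norm M (P \<phi>)"
      by (intro mult_right_mono C_norm_nonneg[OF test_map_test[OF P t]]) auto
    also have "\<dots> \<le> \<bar>C\<bar> * (?c * (D * C_norm L \<phi>))"
      by (intro mult_left_mono C_norm_le D t) auto
    finally show "norm (pds bs (Q (P \<phi>)) x) \<le> (\<bar>C\<bar> * ?c * D) * C_norm L \<phi>" by (simp add: mult_ac)
  qed
qed (use P Q test_map_test[OF P] in \<open>auto simp: test_map_def\<close>)

lemma parametrix_outside:
  fixes f :: "'a::euclidean_space \<Rightarrow> 'b::euclidean_space"
  assumes "\<And>x. x \<notin> cball 0 r \<Longrightarrow> f x = 0" "x \<notin> cball 0 (r + 1)"
  shows "parametrix 1 f x = 0"
proof -
  have "parametrix 1 f x = parametrix 1 (\<lambda>x. 0) x"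
  proof (rule parametrix_cong)
    fix y assume "y \<in> ball x 1"
    then have "y \<notin> cball 0 r"
      using assms(2) norm_triangle_ineq2[of x y] by (auto simp: dist_norm)
    then show "f y = 0" by (rule assms(1))
  qed simp
  then show ?thesis by simp
qed

text \<open>Averaging commutes with derivatives, so the order of the estimate is kept; supports grow
  by the radius 1.\<close>

lemma test_map_parametrix:
  "test_map UNIV UNIV (parametrix 1 :: ('a::euclidean_space \<Rightarrow> complex ^ 'k::finite) \<Rightarrow> _)"
  unfolding test_map_def
proof (intro conjI allI impI ballI)
  fix K :: "'a set" assume K: "compact K"
  obtain r where r: "K \<subseteq> cball 0 r"
    using compact_imp_bounded[OF K] by (auto simp: bounded_iff subset_iff)
  have "parametrix 1 \<phi> x = 0" if "supp \<phi> \<subseteq> K" "x \<notin> cball 0 (r + 1)" for \<phi> :: "'a \<Rightarrow> complex ^ 'k" and x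
    by (rule parametrix_outside[OF _ that(2)], rule outside_supp) (use that(1) r in auto)
  then show "\<exists>K'. compact K' \<and> (\<forall>\<phi>\<in>test_functions UNIV. supp \<phi> \<subseteq> K \<longrightarrow>
      (\<forall>x. x \<notin> K' \<longrightarrow> parametrix 1 (\<phi> :: 'a \<Rightarrow> complex ^ 'k) x = 0))"
    by (intro exI[of _ "cball 0 (r + 1)"]) auto
next
  fix N
  let ?I = "integral (cbox (0, - One) (1, One)) (\<lambda>z::real \<times> 'a. \<bar>case z of (t, y) \<Rightarrow> t * sigma y\<bar>)"
  show "\<exists>C M. \<forall>\<phi>\<in>test_functions UNIV. \<forall>bs x. set bs \<subseteq> Basis \<longrightarrow> length bs \<le> N \<longrightarrow>
      norm (pds bs (parametrix 1 (\<phi> :: 'a \<Rightarrow> complex ^ 'k)) x) \<le> C * C_norm M \<phi>"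
  proof (intro exI ballI allI impI)
    fix \<phi> :: "'a \<Rightarrow> complex ^ 'k" and bs :: "'a list" and x
    assume t: "\<phi> \<in> test_functions UNIV" and bs: "set bs \<subseteq> Basis" "length bs \<le> N"
    show "norm (pds bs (parametrix 1 \<phi>) x) \<le> ?I * C_norm N \<phi>"
      unfolding parametrix_def pds_avg[OF parametrix_weight test_functionsD(1)[OF t] bs(1)]
      by (rule norm_avg_le[OF parametrix_weight])
         (use norm_pds_le_C_norm[OF t bs] smooth_continuous_on[OF smooth_pds[OF test_functionsD(1)[OF t] bs(1)]] in auto)
  qed
next
  fix \<phi> \<psi> :: "'a \<Rightarrow> complex ^ 'k" and c :: complex
  assume t: "\<phi> \<in> test_functions UNIV"
  note c\<phi> = smooth_continuous_on[OF test_functionsD(1)[OF t]]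
  show "smooth (parametrix 1 \<phi>)" by (rule smooth_parametrix[OF test_functionsD(1)[OF t]])
  show "parametrix 1 (\<lambda>x. c *s \<phi> x) = (\<lambda>x. c *s parametrix 1 \<phi> x)"
    unfolding parametrix_def using avg_linear[OF parametrix_weight c\<phi> bounded_linear_vec_scale] by blast
  assume "\<psi> \<in> test_functions UNIV"
  then show "parametrix 1 (\<lambda>x. \<phi> x + \<psi> x) = (\<lambda>x. parametrix 1 \<phi> x + parametrix 1 \<psi> x)"
    unfolding parametrix_def
    using avg_add[OF parametrix_weight c\<phi> smooth_continuous_on[OF test_functionsD(1)]] by blast
qed simp

subsection \<open>Regularisation of distributions\<close>

lemma pds_pd:
  assumes "smooth f" "set bs \<subseteq> Basis" "i \<in> Basis"
  shows "pds bs (pd i f) = pd i (pds bs f)"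
  using assms(2)
proof (induction bs)
  case (Cons b bs)
  then have sm: "smooth (pds bs f)" using assms by (auto intro: smooth_pds)
  have "pd b (pd i (pds bs f)) = pd i (pd b (pds bs f))"
    using pd_commute[OF sm _ assms(3)] Cons.prems by auto
  then show ?case using Cons by simp
qed simp

lemma pds_diff:
  assumes "smooth f" "smooth g" "set bs \<subseteq> Basis"
  shows "pds bs (\<lambda>x. f x - g x) = (\<lambda>x. pds bs f x - pds bs g x)"
  using pds_add[OF assms(1) smooth_minus[OF assms(2)] assms(3)]
    pds_linear[OF bounded_linear_minus[OF bounded_linear_ident] assms(2,3)] by simp

lemma smooth_shift:
  fixes f :: "'a::euclidean_space \<Rightarrow> 'b::euclidean_space"
  shows "smooth f \<Longrightarrow> smooth (\<lambda>y. f (y - x))"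
  using smooth_affine[of f "- x" 1] by simp

lemma pds_shift:
  fixes f :: "'a::euclidean_space \<Rightarrow> 'b::euclidean_space"
  assumes "smooth f" "set bs \<subseteq> Basis"
  shows "pds bs (\<lambda>y. f (y - x)) = (\<lambda>y. pds bs f (y - x))"
  using pds_affine[OF assms, of "- x" 1] by simp

lemma test_shift:
  fixes \<psi> :: "'a::euclidean_space \<Rightarrow> 'b::euclidean_space"
  assumes \<psi>: "\<psi> \<in> test_functions UNIV" and z: "\<And>y. y \<notin> cball 0 1 \<Longrightarrow> \<psi> y = 0"
  shows "(\<lambda>y. \<psi> (y - x)) \<in> test_functions UNIV"
  by (rule test_functionsI[OF smooth_shift[OF test_functionsD(1)[OF \<psi>]], where K = "cball x 1"])
     (auto intro!: z simp: dist_norm norm_minus_commute)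

lemma test_pd:
  fixes \<psi> :: "'a::euclidean_space \<Rightarrow> complex ^ 'k::finite"
  shows "i \<in> Basis \<Longrightarrow> \<psi> \<in> test_functions UNIV \<Longrightarrow> pd i \<psi> \<in> test_functions UNIV"
  using test_map_test[OF test_map_pd[of i "{} :: 'k set"]] by simp

text \<open>The bound is quadratic in h and uniform in z. This uniformity makes translation
  differentiable in \<open>C_norm\<close>, hence also under a distribution.\<close>

lemma shift_remainder:
  fixes q :: "'a::euclidean_space \<Rightarrow> 'b::euclidean_space"
  assumes q: "smooth q" and M: "\<And>cs z. set cs \<subseteq> Basis \<Longrightarrow> length cs = 2 \<Longrightarrow> norm (pds cs q z) \<le> M"
  shows "norm (q (z - h) - (q z - (\<Sum>i\<in>Basis. (h \<bullet> i) *\<^sub>R pd i q z))) \<le> (real DIM('a) * norm h)\<^sup>2 * M"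
proof -
  define w where "w y = q (z + (- 1) *\<^sub>R y)" for y
  have w: "smooth w" unfolding w_def by (rule smooth_affine[OF q])
  have M0: "0 \<le> M"
  proof -
    obtain b :: 'a where "b \<in> Basis" using nonempty_Basis by blast
    then show ?thesis using order_trans[OF norm_ge_zero M[of "[b, b]"]] by simp
  qed
  have "norm (w h - (\<Sum>j<2. (1 / fact j) *\<^sub>R taylor_term j w 0 h)) \<le> (real DIM('a) * norm h)\<^sup>2 * M"
  proof (rule taylor_remainder[OF w])
    fix t :: real
    have "norm (taylor_term 2 w (t *\<^sub>R h) h) \<le> (real DIM('a) * norm h)\<^sup>2 * M"
      unfolding w_def
    proof (rule norm_taylor_term_le)
      fix cs :: "'a list" assume cs: "set cs \<subseteq> Basis" "length cs = 2"
      show "norm (pds cs (\<lambda>y. q (z + (- 1) *\<^sub>R y)) (t *\<^sub>R h)) \<le> M"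
        unfolding pds_affine[OF q cs(1)] using M[OF cs] cs(2) by simp
    qed
    moreover have "norm (taylor_term 2 w (t *\<^sub>R h) h) / fact 2 \<le> norm (taylor_term 2 w (t *\<^sub>R h) h)"
      by simp
    ultimately show "norm (taylor_term 2 w (t *\<^sub>R h) h) / fact 2 \<le> (real DIM('a) * norm h)\<^sup>2 * M"
      by linarith
  qed simp
  moreover have "(\<Sum>j<2. (1 / fact j) *\<^sub>R taylor_term j w 0 h) = q z - (\<Sum>i\<in>Basis. (h \<bullet> i) *\<^sub>R pd i q z)"
  proof -
    have "pd i w 0 = - pd i q z" if "i \<in> Basis" for i
      using pd_affine[OF smooth_differentiable[OF q] that, of z "- 1" 0] by (simp add: w_def[abs_def])
    then show ?thesis by (simp add: numeral_2_eq_2 sum_negf w_def)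
  qed
  ultimately show ?thesis by (simp add: w_def)
qed

text \<open>The first-order remainder \<open>D h\<close> is of size |h|^2 in
  \<open>C_norm N\<close>, by \<open>shift_remainder\<close> applied to every derivative of psi, and
  the continuity estimate of F passes this on. The minus sign comes from the shift by -x.\<close>

lemma dist_shift_has_derivative:
  fixes F :: "('a::euclidean_space \<Rightarrow> complex ^ 'k::finite) \<Rightarrow> complex"
  assumes F: "dist_on UNIV F" and \<psi>: "\<psi> \<in> test_functions UNIV"
    and z: "\<And>y. y \<notin> cball 0 1 \<Longrightarrow> \<psi> y = 0"
  shows "((\<lambda>x. F (\<lambda>y. \<psi> (y - x))) has_derivative
     (\<lambda>h. \<Sum>i\<in>Basis. (h \<bullet> i) *\<^sub>R - F (\<lambda>y. pd i \<psi> (y - x)))) (at x)"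
proof -
  note sm = test_functionsD(1)[OF \<psi>]
  have z': "pd i \<psi> y = 0" if "y \<notin> cball 0 1" for i y
    by (rule pd_zero_outside[OF closed_cball z that])
  have tp: "(\<lambda>y. pd i \<psi> (y - x)) \<in> test_functions UNIV" if "i \<in> Basis" for i
    by (rule test_shift[OF test_pd[OF that \<psi>] z'])
  have t: "(\<lambda>y. \<psi> (y - u)) \<in> test_functions UNIV" for u
    by (rule test_shift[OF \<psi> z])
  \<comment> \<open>One compact set contains the supports of \<open>D h\<close> for all h of norm
    below 1.\<close>
  obtain C N where C: "\<And>\<phi>. \<phi> \<in> test_functions UNIV \<Longrightarrow> supp \<phi> \<subseteq> cball x 2 \<Longrightarrow> norm (F \<phi>) \<le> C * C_norm N \<phi>"
    using dist_on_bound[OF F compact_cball[of x 2]] by blast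
  \<comment> \<open>Two orders more than N, since the remainder of each derivative is controlled by
    its second derivatives.\<close>
  define B where "B = C_norm (N + 2) \<psi>"
  let ?c = "real (card {bs. set bs \<subseteq> (Basis :: 'a set) \<and> length bs \<le> N})"
  define A where "A = \<bar>C\<bar> * (?c * ((real DIM('a))\<^sup>2 * B))"
  define D where "D h y = \<psi> (y - (x + h)) - (\<psi> (y - x) - (\<Sum>i\<in>Basis. (h \<bullet> i) *\<^sub>R pd i \<psi> (y - x)))" for h y
  have ts: "(\<lambda>y. \<Sum>i\<in>Basis. (h \<bullet> i) *\<^sub>R pd i \<psi> (y - x)) \<in> test_functions UNIV" for h
    unfolding scaleR_vec_scale by (intro test_sum test_scale tp linear_space_UNIV finite_Basis)
  have tD: "D h \<in> test_functions UNIV"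
    and FD: "F (D h) = F (\<lambda>y. \<psi> (y - (x + h))) - F (\<lambda>y. \<psi> (y - x)) - (\<Sum>i\<in>Basis. (h \<bullet> i) *\<^sub>R - F (\<lambda>y. pd i \<psi> (y - x)))" for h
  proof -
    note d1 = dist_on_diff[OF F linear_space_UNIV t ts, of x h]
    note d2 = dist_on_diff[OF F linear_space_UNIV t d1(1), of "x + h"]
    show "D h \<in> test_functions UNIV" using d2(1) unfolding D_def[abs_def] .
    have "F (\<lambda>y. \<Sum>i\<in>Basis. (h \<bullet> i) *\<^sub>R pd i \<psi> (y - x)) = (\<Sum>i\<in>Basis. F (\<lambda>y. (h \<bullet> i) *\<^sub>R pd i \<psi> (y - x)))"
      unfolding scaleR_vec_scale by (rule dist_on_sum[OF F linear_space_UNIV finite_Basis]) (intro test_scale tp linear_space_UNIV)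
    also have "\<dots> = (\<Sum>i\<in>Basis. (h \<bullet> i) *\<^sub>R F (\<lambda>y. pd i \<psi> (y - x)))"
      by (intro sum.cong refl dist_on_scaleR[OF F] tp)
    finally show "F (D h) = F (\<lambda>y. \<psi> (y - (x + h))) - F (\<lambda>y. \<psi> (y - x)) - (\<Sum>i\<in>Basis. (h \<bullet> i) *\<^sub>R - F (\<lambda>y. pd i \<psi> (y - x)))"
      using d1(2) d2(2) unfolding D_def[abs_def] by (simp add: sum_negf)
  qed
  have bound: "norm (F (D h)) \<le> A * (norm h)\<^sup>2" if "norm h < 1" for h
  proof -
    have sup: "D h y = 0" if "y \<notin> cball x 2" for y
    proof -
      have "norm (y - x) > 2" using that by (simp add: dist_norm norm_minus_commute)
      then have "y - x \<notin> cball 0 1" "y - (x + h) \<notin> cball 0 1"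
        using \<open>norm h < 1\<close> norm_triangle_ineq2[of "y - x" h] by (auto simp: algebra_simps)
      then show ?thesis by (simp add: D_def z z')
    qed
    have "norm (pds bs (D h) y) \<le> (real DIM('a) * norm h)\<^sup>2 * B" if bs: "set bs \<subseteq> Basis" "length bs \<le> N" for bs y
    proof -
      have smp: "smooth (pd i \<psi>)" if "i \<in> Basis" for i by (rule smooth_pd[OF sm that])
      have smh: "smooth (\<lambda>y. (h \<bullet> i) *\<^sub>R pd i \<psi> (y - x))" if "i \<in> Basis" for i
        by (intro smooth_linear[OF bounded_linear_scaleR_right] smooth_shift[OF smp[OF that]])
      have ph: "pds bs (\<lambda>y. (h \<bullet> i) *\<^sub>R pd i \<psi> (y - x)) = (\<lambda>y. (h \<bullet> i) *\<^sub>R pd i (pds bs \<psi>) (y - x))" if "i \<in> Basis" for i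
        using pds_linear[OF bounded_linear_scaleR_right smooth_shift[OF smp[OF that]] bs(1)]
          pds_shift[OF smp[OF that] bs(1)] pds_pd[OF sm bs(1) that] by simp
      have pdsD: "pds bs (D h) = (\<lambda>y. pds bs (\<lambda>y. \<psi> (y - (x + h))) y -
          (pds bs (\<lambda>y. \<psi> (y - x)) y - (\<Sum>i\<in>Basis. pds bs (\<lambda>y. (h \<bullet> i) *\<^sub>R pd i \<psi> (y - x)) y)))"
        unfolding D_def[abs_def]
        by (simp only: pds_diff pds_sum smooth_diff smooth_sum smh smooth_shift[OF sm] bs(1))
      have eq: "pds bs (D h) y = pds bs \<psi> (y - x - h) - (pds bs \<psi> (y - x) - (\<Sum>i\<in>Basis. (h \<bullet> i) *\<^sub>R pd i (pds bs \<psi>) (y - x)))"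
        unfolding pdsD by (simp add: ph pds_shift[OF sm bs(1)] diff_diff_eq)
      show ?thesis unfolding eq
      proof (rule shift_remainder[OF smooth_pds[OF sm bs(1)]])
        fix cs :: "'a list" and z assume "set cs \<subseteq> Basis" "length cs = 2"
        then show "norm (pds cs (pds bs \<psi>) z) \<le> B"
          using norm_pds_le_C_norm[OF \<psi>, of "cs @ bs" "N + 2" z] bs by (simp add: B_def pds_append)
      qed
    qed
    then have "C_norm N (D h) \<le> ?c * ((real DIM('a) * norm h)\<^sup>2 * B)" by (rule C_norm_le)
    then have "\<bar>C\<bar> * C_norm N (D h) \<le> \<bar>C\<bar> * (?c * ((real DIM('a) * norm h)\<^sup>2 * B))"
      by (rule mult_left_mono) simp
    also have "\<dots> = A * (norm h)\<^sup>2" by (simp add: A_def power_mult_distrib mult_ac)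
    finally have "\<bar>C\<bar> * C_norm N (D h) \<le> A * (norm h)\<^sup>2" .
    moreover have "norm (F (D h)) \<le> C * C_norm N (D h)"
      by (rule C[OF tD]) (use sup in \<open>simp add: supp_subset_iff del: mem_cball\<close>)
    moreover have "C * C_norm N (D h) \<le> \<bar>C\<bar> * C_norm N (D h)"
      by (intro mult_right_mono C_norm_nonneg[OF tD]) auto
    ultimately show ?thesis by linarith
  qed
  show ?thesis
  proof (rule has_derivativeI_sandwich[of 1 _ _ _ _ "\<lambda>y. A * norm (y - x)"])
    show "bounded_linear (\<lambda>h. \<Sum>i\<in>Basis. (h \<bullet> i) *\<^sub>R - F (\<lambda>y. pd i \<psi> (y - x)))"
      by (intro bounded_linear_intros)
    fix u assume "u \<noteq> x" "dist u x < 1"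
    then have "norm (F (D (u - x))) / norm (u - x) \<le> A * (norm (u - x))\<^sup>2 / norm (u - x)"
      by (intro divide_right_mono bound) (auto simp: dist_norm)
    also have "\<dots> = A * norm (u - x)" using \<open>u \<noteq> x\<close> by (simp add: power2_eq_square)
    finally show "norm (F (\<lambda>y. \<psi> (y - u)) - F (\<lambda>y. \<psi> (y - x)) -
        (\<Sum>i\<in>Basis. ((u - x) \<bullet> i) *\<^sub>R - F (\<lambda>y. pd i \<psi> (y - x)))) / norm (u - x) \<le> A * norm (u - x)"
      unfolding FD by simp
  next
    have "((\<lambda>y. A * norm (y - x)) \<longlongrightarrow> A * norm (x - x)) (at x)"
      by (intro tendsto_intros)
    then show "((\<lambda>y. A * norm (y - x)) \<longlongrightarrow> 0) (at x)" by simp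
  qed simp
qed

lemma smooth_dist_shift:
  fixes F :: "('a::euclidean_space \<Rightarrow> complex ^ 'k::finite) \<Rightarrow> complex"
  assumes F: "dist_on UNIV F" and \<psi>: "\<psi> \<in> test_functions UNIV"
    and z: "\<And>y. y \<notin> cball 0 1 \<Longrightarrow> \<psi> y = 0"
  shows "smooth (\<lambda>x. F (\<lambda>y. \<psi> (y - x)))"
proof -
  have "\<lbrakk>\<psi> \<in> test_functions UNIV; \<And>y. y \<notin> cball 0 1 \<Longrightarrow> \<psi> y = 0\<rbrakk> \<Longrightarrow>
      smooth_upto n (\<lambda>x. F (\<lambda>y. \<psi> (y - x)))" for n \<psi>
  proof (induction n arbitrary: \<psi>)
    case 0
    show ?case by (rule smooth_upto_0I, rule dist_shift_has_derivative[OF F 0])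
  next
    case (Suc n)
    show ?case
    proof (rule smooth_upto_SucI, rule dist_shift_has_derivative[OF F Suc.prems])
      fix b :: 'a assume b: "b \<in> Basis"
      have "smooth_upto n (\<lambda>x. F (\<lambda>y. pd b \<psi> (y - x)))"
        by (rule Suc.IH[OF test_pd[OF b Suc.prems(1)] pd_zero_outside[OF closed_cball Suc.prems(2)]])
      then show "smooth_upto n (\<lambda>x. \<Sum>i\<in>Basis. (b \<bullet> i) *\<^sub>R - F (\<lambda>y. pd i \<psi> (y - x)))"
        unfolding sum_inner_Basis[OF b]
        by (rule smooth_upto_linear[OF bounded_linear_minus[OF bounded_linear_ident]])
    qed
  qed
  then show ?thesis using assms by (simp add: smooth_iff_upto)
qed

text \<open>The mesh enters only through the modulus of continuity, so one partition serves a whole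
  family of integrands. In \<open>dist_moll\<close> these are indexed by the point y and the
  derivative.\<close>

lemma riemann_sum_bound:
  fixes H :: "'a::euclidean_space \<Rightarrow> 'b::euclidean_space"
  assumes H: "continuous_on (cbox a b) H" and p: "p tagged_division_of cbox a b"
    and fine: "(\<lambda>x. ball x \<delta>) fine p"
    and e: "\<And>x x'. x \<in> cbox a b \<Longrightarrow> x' \<in> cbox a b \<Longrightarrow> dist x x' < \<delta> \<Longrightarrow> norm (H x - H x') \<le> e" "0 \<le> e"
  shows "norm ((\<Sum>(x, K)\<in>p. measure lborel K *\<^sub>R H x) - integral (cbox a b) H) \<le> e * measure lborel (cbox a b)"
proof -
  have bd: "norm (measure lborel K *\<^sub>R H x - integral K H) \<le> e * measure lborel K" if xK: "(x, K) \<in> p" for x K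
  proof -
    obtain u v where K: "K = cbox u v" "x \<in> K" "K \<subseteq> cbox a b"
      using tagged_division_ofD(2,3,4)[OF p xK] by blast
    have int: "H integrable_on cbox u v"
      using K by (intro integrable_continuous continuous_on_subset[OF H]) auto
    have "measure lborel K *\<^sub>R H x - integral K H = integral (cbox u v) (\<lambda>y. H x - H y)"
      using integral_diff[OF integrable_const int, of "H x"] K by simp
    also have "norm \<dots> \<le> e * measure lborel (cbox u v)"
    proof (rule has_integral_bound[OF e(2) integrable_integral])
      show "(\<lambda>y. H x - H y) integrable_on cbox u v" by (intro integrable_diff integrable_const int)
      fix y assume "y \<in> cbox u v"
      then have "y \<in> ball x \<delta>" using fine xK K unfolding fine_def by blast
      then show "norm (H x - H y) \<le> e"
        using \<open>y \<in> cbox u v\<close> K by (intro e(1)) auto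
    qed
    finally show ?thesis using K by simp
  qed
  have "(\<Sum>(x, K)\<in>p. measure lborel K *\<^sub>R H x) - integral (cbox a b) H
      = (\<Sum>(x, K)\<in>p. measure lborel K *\<^sub>R H x - integral K H)"
    unfolding integral_combine_tagged_division_topdown[OF integrable_continuous[OF H] p]
    by (simp add: sum_subtractf[symmetric] case_prod_unfold)
  also have "norm \<dots> \<le> (\<Sum>(x, K)\<in>p. e * measure lborel K)"
    by (rule sum_norm_le) (use bd in auto)
  also have "\<dots> = e * measure lborel (cbox a b)"
    using additive_content_tagged_division[OF p] by (simp add: sum_distrib_left[symmetric] case_prod_unfold)
  finally show ?thesis .
qed

lemma test_rho_axis:
  "(\<lambda>y::'a::euclidean_space. rho y *\<^sub>R (v :: complex ^ 'k::finite)) \<in> test_functions UNIV"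
  by (rule test_functionsI[where K = "cball 0 1"])
     (use rho_support in \<open>force intro!: smooth_scaleR smooth_rho\<close>)+

text \<open>Phrased as an eventuality in delta so that finitely many moduli can be combined.\<close>

lemma uniform_modulus:
  fixes f :: "'a::metric_space \<Rightarrow> 'b::metric_space"
  assumes "continuous_on S f" "compact S" "0 < e"
  shows "\<forall>\<^sub>F \<delta> in at_right (0::real). \<forall>x\<in>S. \<forall>x'\<in>S. dist x x' < \<delta> \<longrightarrow> dist (f x) (f x') \<le> e"
proof -
  obtain d where d: "0 < d" "\<And>x x'. x \<in> S \<Longrightarrow> x' \<in> S \<Longrightarrow> dist x' x < d \<Longrightarrow> dist (f x') (f x) < e"
    using compact_uniformly_continuous[OF assms(1,2)] assms(3) unfolding uniformly_continuous_on_def by metis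
  show ?thesis
    unfolding eventually_at_right_field using d
    by (intro exI[of _ d]) (metis less_imp_le order_less_trans)
qed

text \<open>F is taken under the integral by Riemann sums. The sums R are finite combinations of
  translates of rho, to which linearity applies; they approach the average in
  \<open>C_norm N\<close> with supports in one compact set, while F R approaches the integral on the
  right.\<close>

lemma dist_moll:
  fixes F :: "('a::euclidean_space \<Rightarrow> complex ^ 'k::finite) \<Rightarrow> complex"
  assumes F: "dist_on UNIV F" and \<phi>: "\<phi> \<in> test_functions UNIV"
    and Q: "\<And>x. x \<notin> cbox a b \<Longrightarrow> \<phi> x = 0"
  shows "F (moll 1 \<phi>) = integral (cbox a b)
     (\<lambda>x. \<Sum>k\<in>UNIV. \<phi> x $ k * F (\<lambda>y. rho (y - x) *\<^sub>R axis k 1))"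
proof -
  note sm\<phi> = test_functionsD(1)[OF \<phi>]
  have c\<phi>: "continuous_on S \<phi>" for S by (rule smooth_continuous_on[OF sm\<phi>])
  have rz: "rho y = 0" if "y \<notin> cball 0 1" for y :: 'a using rho_support[of y] that by auto
  have tr: "(\<lambda>y. rho (y - x) *\<^sub>R v) \<in> test_functions UNIV" for x :: 'a and v :: "complex ^ 'k"
    using test_shift[OF test_rho_axis[of v], of x] rz by simp
  define g where "g k x = F (\<lambda>y. rho (y - x) *\<^sub>R axis k 1)" for k x
  have smg: "smooth (g k)" for k
    unfolding g_def by (rule smooth_dist_shift[OF F test_rho_axis]) (simp add: rz)
  define T where "T x = (\<Sum>k\<in>UNIV. \<phi> x $ k * g k x)" for x
  have FT: "F (\<lambda>y. rho (y - x) *\<^sub>R \<phi> x) = T x" for x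
  proof -
    have eq: "(\<lambda>y. rho (y - x) *\<^sub>R \<phi> x) = (\<lambda>y. \<Sum>k\<in>UNIV. (\<phi> x $ k) *s (rho (y - x) *\<^sub>R axis k 1))"
    proof
      fix y
      have "rho (y - x) *\<^sub>R \<phi> x = rho (y - x) *\<^sub>R (\<Sum>k\<in>UNIV. (\<phi> x $ k) *s axis k 1)"
        by (simp add: basis_expansion)
      also have "\<dots> = (\<Sum>k\<in>UNIV. (\<phi> x $ k) *s (rho (y - x) *\<^sub>R axis k 1))"
        by (rule trans[OF scaleR_sum_right], intro sum.cong refl)
           (simp only: scaleR_vec_scale vector_smult_assoc mult.commute)
      finally show "rho (y - x) *\<^sub>R \<phi> x = (\<Sum>k\<in>UNIV. (\<phi> x $ k) *s (rho (y - x) *\<^sub>R axis k 1))" .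
    qed
    have "F (\<lambda>y. rho (y - x) *\<^sub>R \<phi> x) = (\<Sum>k\<in>UNIV. F (\<lambda>y. (\<phi> x $ k) *s (rho (y - x) *\<^sub>R axis k 1)))"
      unfolding eq by (rule dist_on_sum[OF F linear_space_UNIV finite]) (rule test_scale[OF linear_space_UNIV tr])
    also have "\<dots> = T x"
      unfolding T_def g_def by (intro sum.cong refl dist_on_mult[OF F tr])
    finally show ?thesis .
  qed
  have cT: "continuous_on (cbox a b) T"
    unfolding T_def
    by (intro continuous_intros smooth_continuous_on[OF smg] continuous_on_component c\<phi>)
  obtain r where r: "\<And>x. x \<in> cbox a b \<Longrightarrow> norm x \<le> r"
    using bounded_cbox[of a b] by (auto simp: bounded_iff)
  \<comment> \<open>Translates of rho by points of the box vanish outside K, and so do all Riemann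
    sums.\<close>
  define K where "K = cball (0::'a) (r + 1)"
  have out: "pds bs rho (y - x) = 0" if "x \<in> cbox a b" "y \<notin> K" for x y and bs :: "'a list"
  proof (rule pds_zero_outside[OF closed_cball rz])
    show "y - x \<notin> cball 0 1"
      using r[OF that(1)] that(2) norm_triangle_ineq2[of y x] by (simp add: K_def)
  qed
  have moll_pds: "pds bs (moll 1 \<phi>) y = integral (cbox a b) (\<lambda>x. pds bs rho (y - x) *\<^sub>R \<phi> x)"
    if bs: "set bs \<subseteq> Basis" for bs y
  proof -
    have "pds bs rho y = 0" if "y \<notin> cbox (- One) One" for y
      by (rule pds_zero_outside[OF closed_cbox rho_outside that])
    note eq = conv_eq_support(2)[OF smooth_continuous_on[OF smooth_pds[OF smooth_rho bs]] this c\<phi> Q]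
    have "pds bs (moll 1 \<phi>) = avg (pds bs rho) (\<lambda>y. y) (- One) One \<phi>"
      unfolding moll_one by (rule pds_conv[OF smooth_rho rho_outside c\<phi> bs])
    then show ?thesis using eq by simp
  qed
  have moll_K: "moll 1 \<phi> y = 0" if "y \<notin> K" for y
  proof -
    have "moll 1 \<phi> y = integral (cbox a b) (\<lambda>x. 0)"
      using moll_pds[of "[]" y] out[OF _ that, of _ "[]"] by (simp cong: integral_cong)
    then show ?thesis by simp
  qed
  have tm: "moll 1 \<phi> \<in> test_functions UNIV"
    by (rule test_functionsI[OF smooth_moll_one[OF c\<phi>], where K = K]) (simp_all add: moll_K, simp add: K_def)
  obtain C N where C: "\<And>\<psi>. \<psi> \<in> test_functions UNIV \<Longrightarrow> supp \<psi> \<subseteq> K \<Longrightarrow> norm (F \<psi>) \<le> C * C_norm N \<psi>"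
    using dist_on_bound[OF F, of K] by (auto simp: K_def)
  let ?S = "{bs. set bs \<subseteq> (Basis :: 'a set) \<and> length bs \<le> N}"
  let ?V = "measure lborel (cbox a b)"
  have "norm (T' - F (moll 1 \<phi>)) \<le> e * ((\<bar>C\<bar> * card ?S + 1) * ?V)"
    if e: "0 < e" and T': "T' = integral (cbox a b) T" for e T'
  proof -
    \<comment> \<open>The modulus is joint in y and x on K times the box, so that one mesh is good
      for every y and every derivative up to order N.\<close>
    have "\<forall>\<^sub>F \<delta> in at_right (0::real). \<forall>bs\<in>?S. \<forall>u\<in>K \<times> cbox a b. \<forall>u'\<in>K \<times> cbox a b. dist u u' < \<delta> \<longrightarrow>
       dist (pds bs rho (fst u - snd u) *\<^sub>R \<phi> (snd u)) (pds bs rho (fst u' - snd u') *\<^sub>R \<phi> (snd u')) \<le> e"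
    proof (rule eventually_ball_finite[OF finite_multiindices], rule ballI, rule uniform_modulus[OF _ _ e])
      fix bs assume "bs \<in> ?S"
      then show "continuous_on (K \<times> cbox a b) (\<lambda>u. pds bs rho (fst u - snd u) *\<^sub>R \<phi> (snd u))"
        by (intro continuous_intros continuous_on_smooth_comp[OF smooth_pds[OF smooth_rho]]
            continuous_on_smooth_comp[OF sm\<phi>]) auto
    qed (auto simp: K_def intro: compact_Times)
    moreover have "\<forall>\<^sub>F \<delta> in at_right (0::real). \<forall>x\<in>cbox a b. \<forall>x'\<in>cbox a b. dist x x' < \<delta> \<longrightarrow> dist (T x) (T x') \<le> e"
      by (rule uniform_modulus[OF cT compact_cbox e])
    moreover have "\<forall>\<^sub>F \<delta> in at_right (0::real). \<delta> > 0" by (rule eventually_at_right_less)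
    ultimately have "\<forall>\<^sub>F \<delta> in at_right (0::real). \<delta> > 0 \<and>
      (\<forall>bs\<in>?S. \<forall>u\<in>K \<times> cbox a b. \<forall>u'\<in>K \<times> cbox a b. dist u u' < \<delta> \<longrightarrow>
        dist (pds bs rho (fst u - snd u) *\<^sub>R \<phi> (snd u)) (pds bs rho (fst u' - snd u') *\<^sub>R \<phi> (snd u')) \<le> e) \<and>
      (\<forall>x\<in>cbox a b. \<forall>x'\<in>cbox a b. dist x x' < \<delta> \<longrightarrow> dist (T x) (T x') \<le> e)"
      by eventually_elim (intro conjI)
    from eventually_happens'[OF trivial_limit_at_right_real this]
    obtain \<delta> where "\<delta> > 0 \<and>
      (\<forall>bs\<in>?S. \<forall>u\<in>K \<times> cbox a b. \<forall>u'\<in>K \<times> cbox a b. dist u u' < \<delta> \<longrightarrow>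
        dist (pds bs rho (fst u - snd u) *\<^sub>R \<phi> (snd u)) (pds bs rho (fst u' - snd u') *\<^sub>R \<phi> (snd u')) \<le> e) \<and>
      (\<forall>x\<in>cbox a b. \<forall>x'\<in>cbox a b. dist x x' < \<delta> \<longrightarrow> dist (T x) (T x') \<le> e)"
      by (rule exE)
    then have \<delta>: "\<delta> > 0"
      "\<And>bs u u'. bs \<in> ?S \<Longrightarrow> u \<in> K \<times> cbox a b \<Longrightarrow> u' \<in> K \<times> cbox a b \<Longrightarrow> dist u u' < \<delta> \<Longrightarrow>
        dist (pds bs rho (fst u - snd u) *\<^sub>R \<phi> (snd u)) (pds bs rho (fst u' - snd u') *\<^sub>R \<phi> (snd u')) \<le> e"
      "\<And>x x'. x \<in> cbox a b \<Longrightarrow> x' \<in> cbox a b \<Longrightarrow> dist x x' < \<delta> \<Longrightarrow> dist (T x) (T x') \<le> e"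
      by blast+
    have gauge: "gauge (\<lambda>x::'a. ball x \<delta>)" using \<delta>(1) by (rule gauge_ball)
    obtain p where p: "p tagged_division_of cbox a b" "(\<lambda>x. ball x \<delta>) fine p"
      by (rule fine_division_exists[OF gauge])
    have fp: "finite p" using p(1) by blast
    have tag: "x \<in> cbox a b" if "(x, L) \<in> p" for x L
      using tagged_division_ofD(2,3)[OF p(1) that] by blast
    define R where "R y = (\<Sum>(x, L)\<in>p. measure lborel L *\<^sub>R (rho (y - x) *\<^sub>R \<phi> x))" for y
    have tterm: "(\<lambda>y. measure lborel L *\<^sub>R (rho (y - x) *\<^sub>R \<phi> x)) \<in> test_functions UNIV" for x and L :: "'a set"
      unfolding scaleR_vec_scale[of "measure lborel L"] by (rule test_scale[OF linear_space_UNIV tr])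
    have tR: "R \<in> test_functions UNIV"
      unfolding R_def[abs_def] case_prod_unfold by (intro test_sum linear_space_UNIV fp tterm)
    have FR: "F R = (\<Sum>(x, L)\<in>p. measure lborel L *\<^sub>R T x)"
      unfolding R_def[abs_def] case_prod_unfold
      by (subst dist_on_sum[OF F linear_space_UNIV fp tterm])
         (intro sum.cong refl, simp only: dist_on_scaleR[OF F tr] FT)
    have pR: "pds bs R y = (\<Sum>(x, L)\<in>p. measure lborel L *\<^sub>R (pds bs rho (y - x) *\<^sub>R \<phi> x))"
      if bs: "set bs \<subseteq> Basis" for bs y
    proof -
      have "bounded_linear (\<lambda>c. m *\<^sub>R (c *\<^sub>R v))" for m and v :: "complex ^ 'k"
        by (intro bounded_linear_intros)
      from pds_linear[OF this smooth_shift[OF smooth_rho] bs]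
      have eqm: "pds bs (\<lambda>y. m *\<^sub>R (rho (y - x) *\<^sub>R v)) = (\<lambda>y. m *\<^sub>R (pds bs rho (y - x) *\<^sub>R v))" for m x and v :: "complex ^ 'k"
        unfolding pds_shift[OF smooth_rho bs] .
      then show ?thesis
        unfolding R_def[abs_def] case_prod_unfold
        by (subst pds_sum[OF test_functionsD(1)[OF tterm] bs]) (simp only: eqm)
    qed
    have "norm (pds bs (\<lambda>y. R y - moll 1 \<phi> y) y) \<le> e * ?V" if bs: "set bs \<subseteq> Basis" "length bs \<le> N" for bs y
    proof -
      have "pds bs (\<lambda>y. R y - moll 1 \<phi> y) y
          = (\<Sum>(x, L)\<in>p. measure lborel L *\<^sub>R (pds bs rho (y - x) *\<^sub>R \<phi> x))
            - integral (cbox a b) (\<lambda>x. pds bs rho (y - x) *\<^sub>R \<phi> x)"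
        unfolding pds_diff[OF test_functionsD(1)[OF tR] test_functionsD(1)[OF tm] bs(1)] pR[OF bs(1)] moll_pds[OF bs(1)] ..
      also have "norm \<dots> \<le> e * ?V"
      proof (rule riemann_sum_bound[OF _ p])
        show "continuous_on (cbox a b) (\<lambda>x. pds bs rho (y - x) *\<^sub>R \<phi> x)"
          by (intro continuous_intros continuous_on_smooth_comp[OF smooth_pds[OF smooth_rho bs(1)]] c\<phi>)
        fix x x' assume x: "x \<in> cbox a b" "x' \<in> cbox a b" "dist x x' < \<delta>"
        show "norm (pds bs rho (y - x) *\<^sub>R \<phi> x - pds bs rho (y - x') *\<^sub>R \<phi> x') \<le> e"
        proof (cases "y \<in> K")
          case True
          then show ?thesis
            using \<delta>(2)[of bs "(y, x)" "(y, x')"] bs x by (simp add: dist_Pair_Pair dist_norm)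
        qed (use out x e in simp)
      qed (use e in simp)
      finally show ?thesis .
    qed
    then have CN: "C_norm N (\<lambda>y. R y - moll 1 \<phi> y) \<le> card ?S * (e * ?V)" by (rule C_norm_le)
    note d = dist_on_diff[OF F linear_space_UNIV tR tm]
    have "supp (\<lambda>y. R y - moll 1 \<phi> y) \<subseteq> K"
    proof (subst supp_subset_iff)
      show "closed K" by (simp add: K_def)
      show "\<forall>y. y \<notin> K \<longrightarrow> R y - moll 1 \<phi> y = 0"
      proof (intro allI impI)
        fix y assume y: "y \<notin> K"
        have "R y = 0" unfolding R_def
          by (intro sum.neutral ballI) (use out[OF tag y, of _ _ "[]"] in \<open>auto split: prod.splits\<close>)
        then show "R y - moll 1 \<phi> y = 0" using moll_K[OF y] by simp
      qed
    qed
    then have "norm (F R - F (moll 1 \<phi>)) \<le> C * C_norm N (\<lambda>y. R y - moll 1 \<phi> y)"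
      using C[OF d(1)] d(2) by simp
    also have "\<dots> \<le> \<bar>C\<bar> * C_norm N (\<lambda>y. R y - moll 1 \<phi> y)"
      by (intro mult_right_mono C_norm_nonneg[OF d(1)]) auto
    also have "\<dots> \<le> \<bar>C\<bar> * (card ?S * (e * ?V))" by (intro mult_left_mono CN) auto
    finally have 1: "norm (F R - F (moll 1 \<phi>)) \<le> \<bar>C\<bar> * (card ?S * (e * ?V))" .
    have 2: "norm (F R - T') \<le> e * ?V"
      unfolding FR T' by (rule riemann_sum_bound[OF cT p]) (use \<delta>(3) e in \<open>auto simp: dist_norm\<close>)
    have "norm (T' - F (moll 1 \<phi>)) \<le> norm (F R - F (moll 1 \<phi>)) + norm (F R - T')"
      using norm_triangle_ineq4[of "F R - F (moll 1 \<phi>)" "F R - T'"] by simp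
    also have "\<dots> \<le> \<bar>C\<bar> * (card ?S * (e * ?V)) + e * ?V" using 1 2 by linarith
    finally show ?thesis by (simp add: algebra_simps)
  qed
  then have le: "norm (integral (cbox a b) T - F (moll 1 \<phi>)) \<le> e * ((\<bar>C\<bar> * card ?S + 1) * ?V)" if "0 < e" for e
    using that by blast
  have "norm (integral (cbox a b) T - F (moll 1 \<phi>)) \<le> 0"
  proof (rule field_le_epsilon)
    fix e :: real assume e: "0 < e"
    let ?A = "(\<bar>C\<bar> * card ?S + 1) * ?V"
    have A: "?A \<ge> 0" by simp
    \<comment> \<open>Dividing by A + 1 instead of A also covers a box of measure zero, where A =
      0.\<close>
    have "norm (integral (cbox a b) T - F (moll 1 \<phi>)) \<le> e / (?A + 1) * ?A"
      by (rule le, rule divide_pos_pos[OF e]) (use A in linarith)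
    also have "\<dots> \<le> e"
    proof -
      have "e / (s + 1) * s \<le> e" if "0 \<le> s" for s using that e by (simp add: field_simps)
      then show ?thesis using A .
    qed
    finally show "norm (integral (cbox a b) T - F (moll 1 \<phi>)) \<le> 0 + e" by simp
  qed
  then show ?thesis by (simp add: T_def[abs_def] g_def)
qed

subsection \<open>Solvability of the Laplace equation for distributions\<close>

lemma integral_UNIV_cbox:
  fixes f :: "'a::euclidean_space \<Rightarrow> 'b::euclidean_space"
  assumes "continuous_on UNIV f" "\<And>x. x \<notin> cbox a b \<Longrightarrow> f x = 0"
  shows "(f has_integral integral (cbox a b) f) UNIV"
  by (rule has_integral_on_superset[OF integrable_integral])
     (use assms in \<open>auto intro!: integrable_continuous intro: continuous_on_subset\<close>)

lemma compact_in_cbox: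
  assumes "compact (K :: 'a::euclidean_space set)"
  obtains a b where "K \<subseteq> cbox a b"
  using bounded_subset_cbox_symmetric[OF compact_imp_bounded[OF assms]] by metis

text \<open>The regular distribution of v in the k-th slot. Integration over the whole space avoids
  the choice of a box, which would differ between test functions.\<close>

definition pairing :: "'k::finite \<Rightarrow> ('a::euclidean_space \<Rightarrow> complex) \<Rightarrow> ('a \<Rightarrow> complex ^ 'k) \<Rightarrow> complex" where
  "pairing k v \<phi> = integral UNIV (\<lambda>x. v x * \<phi> x $ k)"

lemma continuous_on_nth: "smooth f \<Longrightarrow> continuous_on S (\<lambda>x. f x $ k)"
  by (intro continuous_on_component smooth_continuous_on)

lemma pairing_has_integral:
  fixes v :: "'a::euclidean_space \<Rightarrow> complex"
  assumes v: "continuous_on UNIV v" and \<phi>: "\<phi> \<in> test_functions UNIV" "\<And>x. x \<notin> cbox a b \<Longrightarrow> \<phi> x = 0"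
  shows "((\<lambda>x. v x * \<phi> x $ k) has_integral pairing k v \<phi>) UNIV"
    "pairing k v \<phi> = integral (cbox a b) (\<lambda>x. v x * \<phi> x $ k)"
proof -
  have "((\<lambda>x. v x * \<phi> x $ k) has_integral integral (cbox a b) (\<lambda>x. v x * \<phi> x $ k)) UNIV"
    by (rule integral_UNIV_cbox[OF continuous_on_mult[OF v continuous_on_nth[OF test_functionsD(1)[OF \<phi>(1)]]]])
       (simp add: \<phi>(2))
  then show "((\<lambda>x. v x * \<phi> x $ k) has_integral pairing k v \<phi>) UNIV"
    "pairing k v \<phi> = integral (cbox a b) (\<lambda>x. v x * \<phi> x $ k)"
    unfolding pairing_def by (auto simp: integral_unique)
qed

lemma test_support_cbox:
  fixes \<phi> :: "'a::euclidean_space \<Rightarrow> 'b::euclidean_space"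
  assumes "\<phi> \<in> test_functions V"
  obtains a b where "\<And>x. x \<notin> cbox a b \<Longrightarrow> \<phi> x = 0"
proof -
  obtain a b where "supp \<phi> \<subseteq> cbox a b" using compact_in_cbox[OF test_functionsD(3)[OF assms]] .
  then show ?thesis using that outside_supp[of _ \<phi>] by (metis in_mono)
qed

lemma dist_on_pairing:
  fixes v :: "'a::euclidean_space \<Rightarrow> complex"
  assumes v: "continuous_on UNIV v"
  shows "dist_on UNIV (pairing k v)"
  unfolding dist_on_def
proof (intro conjI allI impI ballI)
  fix \<phi> \<psi> :: "'a \<Rightarrow> complex ^ 'b" and c
  assume \<phi>: "\<phi> \<in> test_functions UNIV"
  obtain a b where ab: "\<And>x. x \<notin> cbox a b \<Longrightarrow> \<phi> x = 0" by (rule test_support_cbox[OF \<phi>]) blast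
  have h: "((\<lambda>x. v x * \<phi> x $ k) has_integral pairing k v \<phi>) UNIV"
    by (rule pairing_has_integral(1)[OF v \<phi> ab])
  show "pairing k v (\<lambda>x. c *s \<phi> x) = c * pairing k v \<phi>"
    using integral_unique[OF h]
    unfolding pairing_def[of k v "\<lambda>x. c *s \<phi> x"] by (simp add: mult.left_commute)
  assume \<psi>: "\<psi> \<in> test_functions UNIV"
  obtain a' b' where ab': "\<And>x. x \<notin> cbox a' b' \<Longrightarrow> \<psi> x = 0" by (rule test_support_cbox[OF \<psi>]) blast
  have h': "((\<lambda>x. v x * \<psi> x $ k) has_integral pairing k v \<psi>) UNIV"
    by (rule pairing_has_integral(1)[OF v \<psi> ab'])
  show "pairing k v (\<lambda>x. \<phi> x + \<psi> x) = pairing k v \<phi> + pairing k v \<psi>"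
    using has_integral_add[OF h h']
    unfolding pairing_def[of k v "\<lambda>x. \<phi> x + \<psi> x"] by (simp add: integral_unique distrib_left)
next
  fix K :: "'a set" assume "compact K"
  then obtain a b where ab: "K \<subseteq> cbox a b" by (rule compact_in_cbox)
  have "bounded (v ` cbox a b)"
    by (intro compact_imp_bounded compact_continuous_image continuous_on_subset[OF v]) auto
  then obtain B where B: "B > 0" "\<And>x. x \<in> cbox a b \<Longrightarrow> norm (v x) \<le> B" by (auto simp: bounded_pos)
  have "norm (pairing k v \<phi>) \<le> (B * measure lborel (cbox a b)) * C_norm 0 \<phi>"
    if \<phi>: "\<phi> \<in> test_functions UNIV" and s: "supp \<phi> \<subseteq> K" for \<phi> :: "'a \<Rightarrow> complex ^ 'b"
  proof -
    have out: "\<phi> x = 0" if "x \<notin> cbox a b" for x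
      by (rule outside_supp) (use s ab that in auto)
    have int: "(\<lambda>x. v x * \<phi> x $ k) integrable_on cbox a b"
      by (intro integrable_continuous continuous_on_mult continuous_on_subset[OF v]
          continuous_on_nth[OF test_functionsD(1)[OF \<phi>]]) auto
    have "norm (integral (cbox a b) (\<lambda>x. v x * \<phi> x $ k)) \<le> (B * C_norm 0 \<phi>) * measure lborel (cbox a b)"
    proof (rule has_integral_bound[OF _ integrable_integral[OF int]])
      fix x assume x: "x \<in> cbox a b"
      have "norm (\<phi> x $ k) \<le> norm (\<phi> x)" by (rule Finite_Cartesian_Product.norm_nth_le)
      also have "\<dots> \<le> C_norm 0 \<phi>" using norm_pds_le_C_norm[OF \<phi>, of "[]" 0 x] by simp
      finally show "norm (v x * \<phi> x $ k) \<le> B * C_norm 0 \<phi>"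
        unfolding norm_mult using B x by (intro mult_mono) auto
    qed (use B C_norm_nonneg[OF \<phi>] in auto)
    then show ?thesis using pairing_has_integral(2)[OF v \<phi> out] by (simp add: mult_ac)
  qed
  then show "\<exists>C N. \<forall>\<phi>\<in>test_functions UNIV. supp \<phi> \<subseteq> K \<longrightarrow> norm (pairing k v (\<phi> :: 'a \<Rightarrow> complex ^ 'b)) \<le> C * C_norm N \<phi>"
    by blast
qed

lemma test_lap:
  fixes \<phi> :: "'a::euclidean_space \<Rightarrow> complex ^ 'k::finite"
  shows "\<phi> \<in> test_functions UNIV \<Longrightarrow> lap \<phi> \<in> test_functions UNIV"
  unfolding lap_def[abs_def] by (intro test_sum linear_space_UNIV finite_Basis test_pd)

text \<open>Green's identity: the difference of the two integrands is the sum over i of the i-th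
  derivative of v * pd i psi - pd i v * psi, and these integrals vanish.\<close>

lemma pairing_lap:
  fixes v :: "'a::euclidean_space \<Rightarrow> complex"
  assumes v: "smooth v" and \<phi>: "\<phi> \<in> test_functions UNIV"
  shows "pairing k v (lap \<phi>) = pairing k (lap v) \<phi>"
proof -
  obtain a b where ab: "\<And>x. x \<notin> cbox a b \<Longrightarrow> \<phi> x = 0" by (rule test_support_cbox[OF \<phi>]) blast
  define \<psi> where "\<psi> x = \<phi> x $ k" for x
  have \<psi>: "smooth \<psi>" unfolding \<psi>_def[abs_def] by (rule smooth_linear[OF bounded_linear_vec_nth test_functionsD(1)[OF \<phi>]])
  have \<psi>0: "\<psi> x = 0" if "x \<notin> cbox a b" for x using ab[OF that] by (simp add: \<psi>_def)
  have p0: "pd i f x = 0" if "\<And>x. x \<notin> cbox a b \<Longrightarrow> f x = 0" "x \<notin> cbox a b" for i x and f :: "'a \<Rightarrow> complex"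
    by (rule pd_zero_outside[OF closed_cbox that])
  have lap\<psi>: "lap \<phi> x $ k = lap \<psi> x" for x
    using lap_linear[OF bounded_linear_vec_nth test_functionsD(1)[OF \<phi>], of k x] by (simp add: \<psi>_def[abs_def])
  have "integral (cbox a b) (\<lambda>x. v x * pd i (pd i \<psi>) x - pd i (pd i v) x * \<psi> x) = 0" if i: "i \<in> Basis" for i
  proof -
    note d = smooth_pd[OF v i] smooth_pd[OF \<psi> i]
    have sm: "smooth (\<lambda>x. v x * pd i \<psi> x)" "smooth (\<lambda>x. pd i v x * \<psi> x)"
      by (intro smooth_bilinear[OF bounded_bilinear_mult] v \<psi> d)+
    have "pd i (\<lambda>x. v x * pd i \<psi> x - pd i v x * \<psi> x) = (\<lambda>x. v x * pd i (pd i \<psi>) x - pd i (pd i v) x * \<psi> x)"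
      using pd_diff[OF smooth_differentiable[OF sm(1)] smooth_differentiable[OF sm(2)]]
        pd_bilinear[OF bounded_bilinear_mult smooth_differentiable[OF v] smooth_differentiable[OF d(2)]]
        pd_bilinear[OF bounded_bilinear_mult smooth_differentiable[OF d(1)] smooth_differentiable[OF \<psi>]]
      by auto
    moreover have "integral (cbox a b) (pd i (\<lambda>x. v x * pd i \<psi> x - pd i v x * \<psi> x)) = 0"
      by (rule integral_pd_zero[OF smooth_diff[OF sm] _ i]) (simp add: \<psi>0 p0)
    ultimately show ?thesis by simp
  qed
  then have "integral (cbox a b) (\<lambda>x. \<Sum>i\<in>Basis. v x * pd i (pd i \<psi>) x - pd i (pd i v) x * \<psi> x) = 0"
    by (subst integral_sum)
       (auto intro!: integrable_continuous continuous_on_diff continuous_on_mult smooth_continuous_on[OF v]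
          smooth_continuous_on[OF \<psi>] smooth_continuous_on[OF smooth_pd[OF smooth_pd[OF v]]]
          smooth_continuous_on[OF smooth_pd[OF smooth_pd[OF \<psi>]]])
  then have "integral (cbox a b) (\<lambda>x. v x * lap \<psi> x - lap v x * \<psi> x) = 0"
    by (simp add: lap_def sum_subtractf sum_distrib_left sum_distrib_right)
  then have "integral (cbox a b) (\<lambda>x. v x * lap \<psi> x) = integral (cbox a b) (\<lambda>x. lap v x * \<psi> x)"
    by (subst (asm) integral_diff)
       (auto intro!: integrable_continuous continuous_on_mult smooth_continuous_on[OF v]
          smooth_continuous_on[OF \<psi>] smooth_continuous_on[OF smooth_lap[OF v]]
          smooth_continuous_on[OF smooth_lap[OF \<psi>]])
  moreover have "lap \<phi> x = 0" if "x \<notin> cbox a b" for x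
    using lap_cong_open[OF open_Compl[OF closed_cbox[of a b]], of x \<phi> "\<lambda>x. 0"] ab that by (simp add: lap_def)
  ultimately show ?thesis
    using pairing_has_integral(2)[OF smooth_continuous_on[OF v] test_lap[OF \<phi>], where a = a and b = b and k = k]
      pairing_has_integral(2)[OF smooth_continuous_on[OF smooth_lap[OF v]] \<phi> ab, where k = k]
    by (simp add: lap\<psi> \<psi>_def)
qed

lemma dist_on_mono: "dist_on V u \<Longrightarrow> W \<subseteq> V \<Longrightarrow> dist_on W u"
  using test_functions_mono[of W V] unfolding dist_on_def by (meson subsetD)

theorem lap_surj_distributions:
  fixes f :: "('a::euclidean_space \<Rightarrow> complex ^ 'k::finite) \<Rightarrow> complex"
  assumes f: "f \<in> distributions (coord_space J)"
  obtains u where "u \<in> distributions (coord_space J)"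
    "\<And>\<phi>. \<phi> \<in> test_functions (coord_space J) \<Longrightarrow> u (lap \<phi>) = f \<phi>"
proof -
  \<comment> \<open>Extending f through the coordinate projection lifts the constraint on values, so
    that rho times any basis vector is a test function for F.\<close>
  define P :: "complex ^ 'k \<Rightarrow> complex ^ 'k" where "P v = (\<chi> k. if k \<in> J then 0 else v $ k)" for v
  have P: "test_map UNIV (coord_space J) (\<lambda>\<phi> (x::'a). P (\<phi> x))"
    by (rule test_map_linear) (auto simp: P_def vec_eq_iff coord_space_def)
  have P_id: "P v = v" if "v \<in> coord_space J" for v
    using that by (auto simp: P_def vec_eq_iff coord_space_def)
  define F where "F \<phi> = f (\<lambda>x. P (\<phi> x))" for \<phi>
  have F: "dist_on UNIV F"
    unfolding F_def[abs_def] by (rule dist_on_test_map[OF distributions_dist_on[OF f] P])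
  define g where "g k x = F (\<lambda>y. rho (y - x) *\<^sub>R axis k 1)" for k x
  have "smooth (g k)" for k
    unfolding g_def by (rule smooth_dist_shift[OF F test_rho_axis]) (use rho_support in force)
  then have "\<exists>v. smooth v \<and> (\<forall>x. lap v x = g k x)" for k
    by (rule lap_surj_smooth) blast
  then obtain v where v: "\<And>k. smooth (v k)" "\<And>k x. lap (v k) x = g k x" by metis
  \<comment> \<open>As K_1 (lap phi) = phi - rho * phi, the first term at \<open>lap phi\<close> is
    F phi - F (rho * phi). The pairings with the solutions of lap (v k) = g k give back F (rho *
    phi).\<close>
  define u where "u \<phi> = F (parametrix 1 \<phi>) + (\<Sum>k\<in>UNIV. pairing k (v k) \<phi>)" for \<phi>
  have u: "dist_on UNIV u"
    unfolding u_def[abs_def]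
    by (intro dist_on_add dist_on_sums dist_on_test_map[OF F test_map_parametrix] dist_on_pairing
        smooth_continuous_on v)
  have uJ: "dist_on (coord_space J) u" by (rule dist_on_mono[OF u]) simp
  show ?thesis
  proof (rule that[OF dist_on_distributions[OF uJ linear_space_coord_space]])
    fix \<phi> :: "'a \<Rightarrow> complex ^ 'k" assume \<phi>J: "\<phi> \<in> test_functions (coord_space J)"
    then have \<phi>: "\<phi> \<in> test_functions UNIV" using test_functions_mono[of "coord_space J" UNIV] by auto
    note sm = test_functionsD(1)[OF \<phi>]
    have "lap \<phi> \<in> test_functions (coord_space J)"
      unfolding lap_def[abs_def]
      by (intro test_sum linear_space_coord_space finite_Basis test_map_test[OF test_map_pd] \<phi>J)
    moreover have "u (lap \<phi>) = f \<phi>"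
    proof -
      obtain a b where ab: "\<And>x. x \<notin> cbox a b \<Longrightarrow> \<phi> x = 0" by (rule test_support_cbox[OF \<phi>]) blast
      have "parametrix 1 (lap \<phi>) = (\<lambda>x. \<phi> x - moll 1 \<phi> x)"
      proof
        show "parametrix 1 (lap \<phi>) x = \<phi> x - moll 1 \<phi> x" for x
          using moll_parametrix[OF sm, of 1 x] by (simp add: algebra_simps)
      qed
      then have moll: "moll 1 \<phi> = (\<lambda>x. \<phi> x - parametrix 1 (lap \<phi>) x)" by auto
      have tp: "parametrix 1 (lap \<phi>) \<in> test_functions UNIV"
        by (rule test_map_test[OF test_map_parametrix test_lap[OF \<phi>]])
      have "F (moll 1 \<phi>) = F \<phi> - F (parametrix 1 (lap \<phi>))"
        unfolding moll by (rule dist_on_diff(2)[OF F linear_space_UNIV \<phi> tp])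
      moreover have "F (moll 1 \<phi>) = (\<Sum>k\<in>UNIV. pairing k (v k) (lap \<phi>))"
      proof -
        have "F (moll 1 \<phi>) = integral (cbox a b) (\<lambda>x. \<Sum>k\<in>UNIV. g k x * \<phi> x $ k)"
          using dist_moll[OF F \<phi> ab] by (simp add: g_def mult.commute)
        also have "\<dots> = (\<Sum>k\<in>UNIV. integral (cbox a b) (\<lambda>x. g k x * \<phi> x $ k))"
          by (rule integral_sum)
             (auto intro!: integrable_continuous continuous_on_mult continuous_on_nth sm
               smooth_continuous_on[OF smooth_lap[OF v(1)]] simp flip: v(2))
        also have "\<dots> = (\<Sum>k\<in>UNIV. pairing k (v k) (lap \<phi>))"
        proof (rule sum.cong[OF refl])
          fix k
          have "lap (v k) = g k" using v(2) by blast
          then show "integral (cbox a b) (\<lambda>x. g k x * \<phi> x $ k) = pairing k (v k) (lap \<phi>)"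
            using pairing_lap[OF v(1)[of k] \<phi>, where k = k]
              pairing_has_integral(2)[OF smooth_continuous_on[OF smooth_lap[OF v(1)[of k]]] \<phi> ab, where k = k] by simp
        qed
        finally show ?thesis .
      qed
      moreover have "F \<phi> = f \<phi>"
        unfolding F_def using P_id test_functionsD(2)[OF \<phi>J] by simp
      ultimately show ?thesis by (simp add: u_def)
    qed
    ultimately show "(if lap \<phi> \<in> test_functions (coord_space J) then u (lap \<phi>) else 0) = f \<phi>" by simp
  qed
qed

subsection \<open>The Clifford relations\<close>

text \<open>\<open>gamma k\<close> sends \<open>f\<^sub>\<alpha>\<close> to \<open>gamma_coeff N k \<alpha>\<close> times \<open>f\<^sub>\<beta>\<close>,
  \<open>\<beta> = gamma_flip N k \<alpha>\<close>; the argument \<open>N\<close> only carries the dimension.\<close>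

definition flip :: "'a \<Rightarrow> 'a set \<Rightarrow> 'a set" where
  "flip j \<alpha> = (if j \<in> \<alpha> then \<alpha> - {j} else insert j \<alpha>)"

definition pos_sign :: "nat \<Rightarrow> nat set \<Rightarrow> complex" where
  "pos_sign j \<alpha> = (-1) ^ card {i \<in> \<alpha>. i < j}"

definition gamma_flip :: "'n::finite itself \<Rightarrow> nat \<Rightarrow> nat set \<Rightarrow> nat set" where
  "gamma_flip N k \<alpha> = (if odd CARD('n) \<and> k = CARD('n) then \<alpha> else flip ((k + 1) div 2) \<alpha>)"

definition gamma_coeff :: "'n::finite itself \<Rightarrow> nat \<Rightarrow> nat set \<Rightarrow> complex" where
  "gamma_coeff N k \<alpha> =
     (if odd CARD('n) \<and> k = CARD('n) then - \<i> * (-1) ^ card \<alpha>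
      else if odd k then (if (k + 1) div 2 \<in> \<alpha> then - 1 else 1) * pos_sign ((k + 1) div 2) \<alpha>
      else - \<i> * pos_sign ((k + 1) div 2) \<alpha>)"

lemma flip_flip [simp]: "flip j (flip j \<alpha>) = \<alpha>"
  by (auto simp: flip_def)

lemma flip_commute: "flip j (flip k \<alpha>) = flip k (flip j \<alpha>)"
  by (auto simp: flip_def)

lemma mem_flip: "i \<in> flip j \<alpha> \<longleftrightarrow> (if i = j then i \<notin> \<alpha> else i \<in> \<alpha>)"
  by (auto simp: flip_def)

lemma card_flip: "finite \<alpha> \<Longrightarrow> card \<alpha> = Suc (card (flip j \<alpha>)) \<or> card (flip j \<alpha>) = Suc (card \<alpha>)"
  using card_Suc_Diff1[of \<alpha> j] by (auto simp: flip_def)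

lemma sign_card_flip: "finite \<alpha> \<Longrightarrow> (-1) ^ card (flip j \<alpha>) = - ((-1) ^ card \<alpha> :: complex)"
  using card_flip[of \<alpha> j] by auto

lemma even_card_flip: "finite \<alpha> \<Longrightarrow> even (card (flip j \<alpha>)) \<longleftrightarrow> odd (card \<alpha>)"
  using card_flip[of \<alpha> j] by auto

lemma pos_sign_flip:
  assumes "finite \<alpha>"
  shows "pos_sign j (flip k \<alpha>) = (if k < j then - pos_sign j \<alpha> else pos_sign j \<alpha>)"
proof -
  have "{i \<in> flip k \<alpha>. i < j} = (if k < j then flip k {i \<in> \<alpha>. i < j} else {i \<in> \<alpha>. i < j})"
    by (auto simp: flip_def)
  then show ?thesis using assms by (simp add: pos_sign_def sign_card_flip)
qed

lemma pos_sign_square: "pos_sign j \<alpha> * pos_sign j \<alpha> = 1"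
  by (simp add: pos_sign_def flip: power_add)

lemma gamma_flip_flip [simp]: "gamma_flip N k (gamma_flip N k \<alpha>) = \<alpha>"
  by (simp add: gamma_flip_def)

lemma gamma_flip_commute: "gamma_flip N k (gamma_flip N l \<alpha>) = gamma_flip N l (gamma_flip N k \<alpha>)"
  by (simp add: gamma_flip_def flip_commute)

text \<open>For different indices i and j, flipping the smaller one reverses the position sign of
  the larger and changes no other sign. For equal indices the odd-numbered map carries an extra sign
  that the flip reverses. The last map for odd n is a parity sign, reversed by every flip.\<close>

lemma gamma_coeff_anticommute:
  fixes N :: "'n::finite itself"
  assumes fin: "finite \<alpha>"
  shows "gamma_coeff N k (gamma_flip N l \<alpha>) * gamma_coeff N l \<alpha>
       + gamma_coeff N l (gamma_flip N k \<alpha>) * gamma_coeff N k \<alpha> = (if k = l then - 2 else 0)"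
proof -
  define j where "j = (k + 1) div 2"
  define i where "i = (l + 1) div 2"
  have sq: "x * pos_sign j \<alpha> * (y * pos_sign j \<alpha>) = x * y" for x y j
    using pos_sign_square[of j \<alpha>] by (metis (no_types, opaque_lifting) mult.assoc mult.commute mult.right_neutral)
  have sgn: "(- 1) ^ card \<alpha> * (- 1) ^ card \<alpha> = (1::complex)"
    by (simp flip: power_add)
  consider "odd CARD('n) \<and> k = CARD('n)" "l = k" | "odd CARD('n) \<and> k = CARD('n)" "l \<noteq> k"
    | "odd CARD('n) \<and> l = CARD('n)" "l \<noteq> k" | "\<not> (odd CARD('n) \<and> k = CARD('n))" "\<not> (odd CARD('n) \<and> l = CARD('n))"
    by blast
  then show ?thesis
  proof cases
    case 1
    then show ?thesis using sgn by (simp add: gamma_coeff_def gamma_flip_def algebra_simps)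
  next
    case 2
    then show ?thesis
      by (simp add: gamma_coeff_def gamma_flip_def sign_card_flip[OF fin])
  next
    case 3
    then show ?thesis
      by (simp add: gamma_coeff_def gamma_flip_def sign_card_flip[OF fin])
  next
    case 4
    have fl: "gamma_flip N k \<alpha> = flip j \<alpha>" "gamma_flip N l \<alpha> = flip i \<alpha>"
      using 4 by (auto simp: gamma_flip_def i_def j_def)
    have co: "gamma_coeff N k \<beta> = (if odd k then (if j \<in> \<beta> then - 1 else 1) else - \<i>) * pos_sign j \<beta>"
      "gamma_coeff N l \<beta> = (if odd l then (if i \<in> \<beta> then - 1 else 1) else - \<i>) * pos_sign i \<beta>" for \<beta>
      using 4 by (auto simp: gamma_coeff_def i_def j_def)
    show ?thesis
    proof (cases "i = j")
      case True
      \<comment> \<open>Since k and l share the index j, both are among 2j - 1 and 2j, and parity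
        tells them apart.\<close>
      have par: "k = l \<longleftrightarrow> (odd k \<longleftrightarrow> odd l)" using True unfolding i_def j_def by presburger
      show ?thesis
        unfolding fl co True pos_sign_flip[OF fin] mem_flip using par
        by (auto simp: sq)
    next
      case False
      then have "k \<noteq> l" by (auto simp: i_def j_def)
      then show ?thesis using False
        unfolding fl co pos_sign_flip[OF fin] mem_flip
        by (cases i j rule: linorder_cases) auto
    qed
  qed
qed

text \<open>For k between 1 and n the flipped index lies between 1 and n div 2, so
  \<open>Subset\<close> is applied inside its domain; k = 0 would flip the index 0.\<close>

lemma elems_Subset:
  fixes \<alpha> :: "'n::finite subsets"
  assumes "1 \<le> k" "k \<le> CARD('n)"
  shows "elems (Subset (gamma_flip TYPE('n) k (elems \<alpha>)) :: 'n subsets) = gamma_flip TYPE('n) k (elems \<alpha>)"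
proof (rule Subset_inverse)
  have "elems \<alpha> \<in> Pow {1..CARD('n) div 2}" by (rule elems)
  moreover have "\<not> (odd CARD('n) \<and> k = CARD('n)) \<Longrightarrow> (k + 1) div 2 \<in> {1..CARD('n) div 2}"
    using assms by (auto elim!: oddE evenE)
  ultimately show "gamma_flip TYPE('n) k (elems \<alpha>) \<in> Pow {1..CARD('n) div 2}"
    by (auto simp: gamma_flip_def flip_def)
qed

lemma finite_elems: "finite (elems (\<alpha> :: 'n::finite subsets))"
  using elems[of \<alpha>] finite_subset by blast

section \<open>The gamma maps and their transposes as signed permutations\<close>

definition gamma_target :: "nat \<Rightarrow> 'n::finite subsets \<Rightarrow> 'n subsets" where
  "gamma_target k \<alpha> = Subset (gamma_flip TYPE('n) k (elems \<alpha>))"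

definition gamma_weight :: "nat \<Rightarrow> 'n::finite subsets \<Rightarrow> complex" where
  "gamma_weight k \<alpha> = gamma_coeff TYPE('n) k (elems \<alpha>)"

lemma elems_gamma_target:
  fixes \<alpha> :: "'n::finite subsets"
  shows "1 \<le> k \<Longrightarrow> k \<le> CARD('n) \<Longrightarrow> elems (gamma_target k \<alpha>) = gamma_flip TYPE('n) k (elems \<alpha>)"
  by (simp add: gamma_target_def elems_Subset)

lemma gamma_target_involution:
  fixes \<alpha> :: "'n::finite subsets"
  shows "1 \<le> k \<Longrightarrow> k \<le> CARD('n) \<Longrightarrow> gamma_target k (gamma_target k \<alpha>) = \<alpha>"
  by (simp add: gamma_target_def[of k "gamma_target k \<alpha>"] elems_gamma_target elems_inverse)

lemma gamma_target_commute:
  fixes \<alpha> :: "'n::finite subsets"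
  assumes "1 \<le> k" "k \<le> CARD('n)" "1 \<le> l" "l \<le> CARD('n)"
  shows "gamma_target k (gamma_target l \<alpha>) = gamma_target l (gamma_target k \<alpha>)"
  using assms by (simp add: gamma_target_def[of k "gamma_target l \<alpha>"] gamma_target_def[of l "gamma_target k \<alpha>"]
      elems_gamma_target gamma_flip_commute)

lemma gamma_weight_anticommute:
  fixes \<alpha> :: "'n::finite subsets"
  assumes "1 \<le> k" "k \<le> CARD('n)" "1 \<le> l" "l \<le> CARD('n)"
  shows "gamma_weight k (gamma_target l \<alpha>) * gamma_weight l \<alpha>
       + gamma_weight l (gamma_target k \<alpha>) * gamma_weight k \<alpha> = (if k = l then - 2 else 0)"
  using gamma_coeff_anticommute[OF finite_elems[of \<alpha>], of "TYPE('n)" k l] assms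
  by (simp add: gamma_weight_def elems_gamma_target)

lemma gamma_expansion:
  fixes v :: "complex ^ 'n::finite subsets"
  shows "gamma k v = (\<Sum>\<alpha>\<in>UNIV. v $ \<alpha> *s (gamma_weight k \<alpha> *s axis (gamma_target k \<alpha>) 1))"
proof -
  define j where "j = (k + 1) div 2"
  \<comment> \<open>The position t of j is one more than the number of smaller elements, so
    contraction carries the same sign as exterior multiplication. Only one of the two acts on a
    given basis element.\<close>
  have con: "(-1) ^ (card {i \<in> \<alpha>. i \<le> j} + 1) = pos_sign j \<alpha>" if "j \<in> \<alpha>" "finite \<alpha>" for \<alpha>
  proof -
    have "{i \<in> \<alpha>. i \<le> j} = insert j {i \<in> \<alpha>. i < j}" using that by auto
    then show ?thesis using that by (simp add: pos_sign_def)
  qed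
  show ?thesis
  proof (cases "odd CARD('n) \<and> k = CARD('n)")
    case True
    then show ?thesis
      by (simp add: gamma_def lin_ext_def gamma_weight_def gamma_target_def gamma_coeff_def gamma_flip_def basis_form_def)
  next
    case False
    have tgt: "gamma_target k \<alpha> = Subset (flip j (elems \<alpha>))" for \<alpha> :: "'n subsets"
      using False by (auto simp: gamma_target_def gamma_flip_def j_def)
    have wt: "gamma_weight k \<alpha> = (if odd k then (if j \<in> elems \<alpha> then - 1 else 1) else - \<i>) * pos_sign j (elems \<alpha>)"
      for \<alpha> :: "'n subsets"
      using False by (auto simp: gamma_weight_def gamma_coeff_def j_def)
    have ext: "(if j \<in> elems \<alpha> then 0 else ((-1) ^ card {i \<in> elems \<alpha>. i < j}) *s (basis_form (insert j (elems \<alpha>)) :: complex ^ 'n subsets))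
        = (if j \<in> elems \<alpha> then 0 else pos_sign j (elems \<alpha>)) *s axis (gamma_target k \<alpha>) 1" for \<alpha> :: "'n subsets"
      by (simp add: pos_sign_def basis_form_def tgt flip_def)
    have contr: "(if j \<in> elems \<alpha> then ((-1) ^ (card {i \<in> elems \<alpha>. i \<le> j} + 1)) *s (basis_form (elems \<alpha> - {j}) :: complex ^ 'n subsets) else 0)
        = (if j \<in> elems \<alpha> then pos_sign j (elems \<alpha>) else 0) *s axis (gamma_target k \<alpha>) 1" for \<alpha> :: "'n subsets"
      using con[OF _ finite_elems, of \<alpha>] by (simp add: basis_form_def tgt flip_def del: power_Suc)
    have "gamma k v = (if odd k then ext_mult j v - contraction j v else (- \<i>) *s (ext_mult j v + contraction j v))"
      using False by (auto simp: gamma_def j_def)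
    also have "\<dots> = (\<Sum>\<alpha>\<in>UNIV. v $ \<alpha> *s (gamma_weight k \<alpha> *s axis (gamma_target k \<alpha>) 1))"
      unfolding ext_mult_def contraction_def lin_ext_def ext contr
      by (auto simp: wt vec_eq_iff sum_subtractf[symmetric] sum.distrib[symmetric] sum_negf[symmetric]
          sum_distrib_left algebra_simps intro!: sum.cong)
    finally show ?thesis .
  qed
qed

text \<open>The target map is an involution, so exactly one basis element is sent to the given
  one.\<close>

lemma gamma_nth:
  fixes v :: "complex ^ 'n::finite subsets"
  assumes k: "1 \<le> k" "k \<le> CARD('n)"
  shows "gamma k v $ \<beta> = gamma_weight k (gamma_target k \<beta>) * v $ gamma_target k \<beta>"
proof -
  have "gamma k v $ \<beta> = (\<Sum>\<alpha>\<in>UNIV. v $ \<alpha> * (gamma_weight k \<alpha> * axis (gamma_target k \<alpha>) 1 $ \<beta>))"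
    unfolding gamma_expansion by (simp add: mult.assoc)
  also have "\<dots> = (\<Sum>\<alpha>\<in>UNIV. if \<alpha> = gamma_target k \<beta> then v $ \<alpha> * gamma_weight k \<alpha> else 0)"
  proof (rule sum.cong[OF refl])
    fix \<alpha>
    have "gamma_target k \<alpha> = \<beta> \<longleftrightarrow> \<alpha> = gamma_target k \<beta>"
      using gamma_target_involution[OF k] by metis
    then show "v $ \<alpha> * (gamma_weight k \<alpha> * axis (gamma_target k \<alpha>) 1 $ \<beta>)
        = (if \<alpha> = gamma_target k \<beta> then v $ \<alpha> * gamma_weight k \<alpha> else 0)"
      by (auto simp: axis_def)
  qed
  finally show ?thesis by simp
qed

text \<open>Distributions are acted on through transposes. These are again signed permutations, with
  the weight read at the index itself instead of at its target.\<close>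

definition gamma_tr :: "nat \<Rightarrow> complex ^ ('n::finite) subsets \<Rightarrow> complex ^ 'n subsets" where
  "gamma_tr k v = transpose (matrix (gamma k)) *v v"

lemma gamma_tr_nth:
  fixes v :: "complex ^ 'n::finite subsets"
  assumes k: "1 \<le> k" "k \<le> CARD('n)"
  shows "gamma_tr k v $ \<beta> = gamma_weight k \<beta> * v $ gamma_target k \<beta>"
proof -
  have inv: "\<beta> = gamma_target k \<alpha> \<longleftrightarrow> \<alpha> = gamma_target k \<beta>" for \<alpha>
    using gamma_target_involution[OF k] by metis
  have "gamma_tr k v $ \<beta> = (\<Sum>\<alpha>\<in>UNIV. gamma k (axis \<beta> 1) $ \<alpha> * v $ \<alpha>)"
    by (simp add: gamma_tr_def matrix_vector_mult_def transpose_def matrix_def)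
  also have "\<dots> = (\<Sum>\<alpha>\<in>UNIV. if \<alpha> = gamma_target k \<beta> then gamma_weight k \<beta> * v $ \<alpha> else 0)"
    using inv gamma_target_involution[OF k] by (intro sum.cong refl) (auto simp: gamma_nth[OF k] axis_def)
  finally show ?thesis by simp
qed

lemma coord_bounds: "1 \<le> coord (j :: 'n::{finite,linorder})" "coord (j :: 'n) \<le> CARD('n)"
  using bij_betwE[OF bij_betw_coord[where 'n='n]] by auto

lemma coord_eq_iff: "coord i = coord j \<longleftrightarrow> i = (j :: 'n::{finite,linorder})"
  using bij_betw_imp_inj_on[OF bij_betw_coord[where 'n='n]] by (auto simp: inj_on_def)

lemma gamma_clifford:
  fixes v :: "complex ^ ('n::{finite,linorder}) subsets"
  shows "gamma (coord i) (gamma (coord j) v) + gamma (coord j) (gamma (coord i) v)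
      = (if i = (j::'n) then - 2 else 0) *s v"
proof (rule vec_eq_iff[THEN iffD2], rule allI)
  fix \<beta> :: "'n subsets"
  note b = coord_bounds[of i] coord_bounds[of j]
  \<comment> \<open>The one index whose coordinate of v reaches the given coordinate, for either
    order of the two maps.\<close>
  define \<alpha> where "\<alpha> = gamma_target (coord i) (gamma_target (coord j) \<beta>)"
  have t: "gamma_target (coord i) \<beta> = gamma_target (coord j) \<alpha>" "gamma_target (coord j) \<beta> = gamma_target (coord i) \<alpha>"
    "gamma_target (coord j) (gamma_target (coord i) \<beta>) = \<alpha>"
    unfolding \<alpha>_def using b gamma_target_involution gamma_target_commute by metis+
  have "i = j \<Longrightarrow> \<alpha> = \<beta>" unfolding \<alpha>_def using b gamma_target_involution by metis
  moreover have "gamma (coord i) (gamma (coord j) v) $ \<beta> + gamma (coord j) (gamma (coord i) v) $ \<beta>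
      = (gamma_weight (coord i) (gamma_target (coord j) \<alpha>) * gamma_weight (coord j) \<alpha>
       + gamma_weight (coord j) (gamma_target (coord i) \<alpha>) * gamma_weight (coord i) \<alpha>) * v $ \<alpha>"
  proof -
    have "gamma (coord i) (gamma (coord j) v) $ \<beta> = gamma_weight (coord i) (gamma_target (coord j) \<alpha>) * (gamma_weight (coord j) \<alpha> * v $ \<alpha>)"
      unfolding gamma_nth[OF b(1,2)] gamma_nth[OF b(3,4)] t(3) unfolding t(1) ..
    moreover have "gamma (coord j) (gamma (coord i) v) $ \<beta> = gamma_weight (coord j) (gamma_target (coord i) \<alpha>) * (gamma_weight (coord i) \<alpha> * v $ \<alpha>)"
      unfolding gamma_nth[OF b(1,2)] gamma_nth[OF b(3,4)] \<alpha>_def[symmetric] unfolding t(2) ..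
    ultimately show ?thesis by (simp add: algebra_simps)
  qed
  ultimately show "(gamma (coord i) (gamma (coord j) v) + gamma (coord j) (gamma (coord i) v)) $ \<beta>
      = ((if i = j then - 2 else 0) *s v) $ \<beta>"
    unfolding gamma_weight_anticommute[OF b] by (auto simp: coord_eq_iff)
qed

lemma gamma_tr_clifford:
  fixes v :: "complex ^ ('n::{finite,linorder}) subsets"
  shows "gamma_tr (coord i) (gamma_tr (coord j) v) + gamma_tr (coord j) (gamma_tr (coord i) v)
      = (if i = (j::'n) then - 2 else 0) *s v"
proof (rule vec_eq_iff[THEN iffD2], rule allI)
  fix \<beta> :: "'n subsets"
  note b = coord_bounds[of i] coord_bounds[of j]
  define \<alpha> where "\<alpha> = gamma_target (coord i) (gamma_target (coord j) \<beta>)"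
  have t: "gamma_target (coord j) (gamma_target (coord i) \<beta>) = \<alpha>"
    unfolding \<alpha>_def using b gamma_target_commute by metis
  have "i = j \<Longrightarrow> \<alpha> = \<beta>" unfolding \<alpha>_def using b gamma_target_involution by metis
  moreover have "gamma_tr (coord i) (gamma_tr (coord j) v) $ \<beta> + gamma_tr (coord j) (gamma_tr (coord i) v) $ \<beta>
      = (gamma_weight (coord i) (gamma_target (coord j) \<beta>) * gamma_weight (coord j) \<beta>
       + gamma_weight (coord j) (gamma_target (coord i) \<beta>) * gamma_weight (coord i) \<beta>) * v $ \<alpha>"
  proof -
    have "gamma_tr (coord i) (gamma_tr (coord j) v) $ \<beta> = gamma_weight (coord i) \<beta> * (gamma_weight (coord j) (gamma_target (coord i) \<beta>) * v $ \<alpha>)"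
      unfolding gamma_tr_nth[OF b(1,2)] gamma_tr_nth[OF b(3,4)] t ..
    moreover have "gamma_tr (coord j) (gamma_tr (coord i) v) $ \<beta> = gamma_weight (coord j) \<beta> * (gamma_weight (coord i) (gamma_target (coord j) \<beta>) * v $ \<alpha>)"
      unfolding gamma_tr_nth[OF b(1,2)] gamma_tr_nth[OF b(3,4)] \<alpha>_def[symmetric] ..
    ultimately show ?thesis by (simp add: algebra_simps)
  qed
  ultimately show "(gamma_tr (coord i) (gamma_tr (coord j) v) + gamma_tr (coord j) (gamma_tr (coord i) v)) $ \<beta>
      = ((if i = j then - 2 else 0) *s v) $ \<beta>"
    unfolding gamma_weight_anticommute[OF b] by (auto simp: coord_eq_iff)
qed

lemma gamma_linear:
  fixes k :: nat
  assumes "1 \<le> k" "k \<le> CARD('n::finite)"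
  shows "gamma k (v + w) = gamma k v + gamma k (w :: complex ^ 'n subsets)" "gamma k (c *s v) = c *s gamma k v"
  by (simp_all add: vec_eq_iff gamma_nth[OF assms] algebra_simps)

lemma gamma_tr_linear:
  fixes k :: nat
  assumes "1 \<le> k" "k \<le> CARD('n::finite)"
  shows "gamma_tr k (v + w) = gamma_tr k v + gamma_tr k (w :: complex ^ 'n subsets)"
    "gamma_tr k (c *s v) = c *s gamma_tr k v"
  by (simp_all add: vec_eq_iff gamma_tr_nth[OF assms] algebra_simps)

text \<open>The coordinates that vanish on \<open>spinor_plus\<close>. For odd n there are none, and
  the spinor module is the whole exterior algebra.\<close>

definition odd_index :: "'n::finite subsets set" where
  "odd_index = {\<alpha>. even CARD('n) \<and> odd (card (elems \<alpha>))}"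

definition even_index :: "'n::finite subsets set" where
  "even_index = {\<alpha>. even CARD('n) \<and> even (card (elems \<alpha>))}"

lemma spinor_plus_coord: "spinor_plus = coord_space odd_index"
  by (auto simp: spinor_plus_def coord_space_def odd_index_def)

lemma spinor_minus_coord: "spinor_minus = coord_space even_index"
  by (auto simp: spinor_minus_def coord_space_def even_index_def)

lemma gamma_target_index:
  fixes \<alpha> :: "'n::finite subsets"
  assumes "1 \<le> k" "k \<le> CARD('n)"
  shows "\<alpha> \<in> odd_index \<Longrightarrow> gamma_target k \<alpha> \<in> even_index" "\<alpha> \<in> even_index \<Longrightarrow> gamma_target k \<alpha> \<in> odd_index"
  using elems_gamma_target[OF assms, of \<alpha>] even_card_flip[OF finite_elems, of "(k + 1) div 2" \<alpha>]
  by (auto simp: odd_index_def even_index_def gamma_flip_def)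

lemma gamma_spinor:
  fixes v :: "complex ^ 'n::finite subsets"
  assumes "1 \<le> k" "k \<le> CARD('n)"
  shows "v \<in> spinor_plus \<Longrightarrow> gamma k v \<in> spinor_minus" "v \<in> spinor_minus \<Longrightarrow> gamma k v \<in> spinor_plus"
    "v \<in> spinor_plus \<Longrightarrow> gamma_tr k v \<in> spinor_minus" "v \<in> spinor_minus \<Longrightarrow> gamma_tr k v \<in> spinor_plus"
  unfolding spinor_plus_coord spinor_minus_coord coord_space_def
  using gamma_target_index[OF assms] by (auto simp: gamma_nth[OF assms] gamma_tr_nth[OF assms])

subsection \<open>The operators on functions\<close>

lemma direction_Basis: "direction A j \<in> Basis"
  by (simp add: direction_def axis_in_Basis_iff)

lemma sum_Basis_direction:
  fixes g :: "real ^ ('n::finite) ^ 2 \<Rightarrow> 'b::comm_monoid_add"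
  shows "sum g Basis = (\<Sum>j\<in>UNIV. g (direction 0 j)) + (\<Sum>j\<in>UNIV. g (direction 1 j))"
proof -
  have inj: "inj (\<lambda>(A, j). direction A (j :: 'n))"
    by (auto simp: inj_on_def direction_def axis_eq_axis)
  have Basis: "(Basis :: (real ^ 'n ^ 2) set) = range (\<lambda>(A, j). direction A j)"
    by (auto simp: Basis_vec_def direction_def)
  have "sum g Basis = (\<Sum>p\<in>UNIV \<times> UNIV. g (case p of (A, j) \<Rightarrow> direction A j))"
    unfolding Basis UNIV_Times_UNIV by (subst sum.reindex[OF inj]) (simp add: o_def)
  also have "\<dots> = (\<Sum>A\<in>UNIV. \<Sum>j\<in>UNIV. g (direction A j))"
    by (simp only: sum.cartesian_product case_prod_unfold)
  also have "\<dots> = (\<Sum>j\<in>UNIV. g (direction 1 j)) + (\<Sum>j\<in>UNIV. g (direction 2 j))"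
    by (rule sum_2)
  \<comment> \<open>\<open>sum_2\<close> lists the two elements of the type \<open>2\<close> as 1
    and 2, and 2 = 0 in that type.\<close>
  also have "(2 :: 2) = 0" by simp
  finally show ?thesis by (simp add: add.commute)
qed

text \<open>Interchanging the two indices and using the symmetry of D shows that twice the sum is a
  sum of anticommutators. Keeping L abstract serves both \<open>gamma\<close> and
  \<open>gamma_tr\<close>.\<close>

lemma clifford_sum:
  fixes L :: "'i::finite \<Rightarrow> complex ^ 'k::finite \<Rightarrow> complex ^ 'k"
  assumes cl: "\<And>i j v. L i (L j v) + L j (L i v) = (if i = j then - 2 else 0) *s v"
    and D: "\<And>i j. D i j = D j i"
  shows "(\<Sum>i\<in>UNIV. \<Sum>j\<in>UNIV. L i (L j (D i j))) = - (\<Sum>i\<in>UNIV. D i i)"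
proof -
  let ?X = "\<Sum>i\<in>UNIV. \<Sum>j\<in>UNIV. L i (L j (D i j))"
  have "?X = (\<Sum>i\<in>UNIV. \<Sum>j\<in>UNIV. L j (L i (D i j)))"
    by (subst sum.swap) (simp add: D)
  then have "?X + ?X = (\<Sum>i\<in>UNIV. \<Sum>j\<in>UNIV. L i (L j (D i j)) + L j (L i (D i j)))"
    by (simp add: sum.distrib)
  also have "\<dots> = (\<Sum>i\<in>UNIV. \<Sum>j\<in>UNIV. if j = i then - 2 *s D i i else 0)"
    unfolding cl by (intro sum.cong refl) auto
  also have "\<dots> = - 2 *s (\<Sum>i\<in>UNIV. D i i)"
    by (simp add: vec.scale_sum_right)
  finally have XX: "?X + ?X = - 2 *s (\<Sum>i\<in>UNIV. D i i)" .
  have half: "x = - y" if "x + x = - 2 *s y" for x y :: "complex ^ 'k"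
  proof (rule vec_eq_iff[THEN iffD2], rule allI)
    fix k
    have xx: "x $ k + x $ k = - 2 * y $ k"
      using arg_cong[OF that, of "\<lambda>v. v $ k"] by simp
    have "x $ k = (x $ k + x $ k) / 2" by simp
    then show "x $ k = (- y) $ k" unfolding xx by simp
  qed
  show ?thesis by (rule half[OF XX])
qed

lemma vec_linear_bounded:
  fixes L :: "complex ^ 'k::finite \<Rightarrow> complex ^ 'l::finite"
  assumes "\<And>v w. L (v + w) = L v + L w" "\<And>c v. L (c *s v) = c *s L v"
  shows "bounded_linear L"
  by (rule linear_conv_bounded_linear[THEN iffD1], rule linearI) (simp_all add: assms scaleR_vec_scale)

lemma bounded_linear_gamma: "bounded_linear (gamma (coord (j :: 'n::{finite,linorder})) :: complex ^ 'n subsets \<Rightarrow> _)"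
  by (rule vec_linear_bounded) (simp_all add: gamma_linear[OF coord_bounds])

lemma bounded_linear_gamma_tr: "bounded_linear (gamma_tr (coord (j :: 'n::{finite,linorder})) :: complex ^ 'n subsets \<Rightarrow> _)"
  by (rule vec_linear_bounded) (simp_all add: gamma_tr_linear[OF coord_bounds])

lemma bounded_linear_component: "bounded_linear (component A)"
  by (rule vec_linear_bounded) (simp_all add: component_def vec_eq_iff)

lemma bounded_linear_inject: "bounded_linear (inject A)"
  by (rule vec_linear_bounded) (simp_all add: inject_def vec_eq_iff)

lemma smooth_nabla: "smooth f \<Longrightarrow> smooth (nabla A f)"
  unfolding nabla_def[abs_def]
  by (intro smooth_sum smooth_linear[OF bounded_linear_gamma] smooth_pd direction_Basis)

lemma pd_nabla:
  assumes "smooth f" "b \<in> Basis"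
  shows "pd b (nabla A f) x = (\<Sum>j\<in>UNIV. gamma (coord j) (pd b (pd (direction A j) f) x))"
  unfolding nabla_def[abs_def]
  by (subst pd_sum)
     (auto intro!: smooth_differentiable smooth_linear[OF bounded_linear_gamma] smooth_pd direction_Basis assms
       simp: pd_linear[OF bounded_linear_gamma smooth_differentiable[OF smooth_pd[OF assms(1) direction_Basis]]])

lemma nabla_nabla:
  fixes f :: "real ^ ('n::{finite,linorder}) ^ 2 \<Rightarrow> complex ^ 'n subsets"
  assumes f: "smooth f"
  shows "nabla A (nabla A f) x = - (\<Sum>j\<in>UNIV. pd (direction A j) (pd (direction A j) f) x)"
proof -
  have lin: "gamma (coord i) (\<Sum>j\<in>UNIV. v j) = (\<Sum>j\<in>UNIV. gamma (coord i) (v j))"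
    for i :: 'n and v :: "'n \<Rightarrow> complex ^ 'n subsets"
    by (rule linear_sum[OF bounded_linear.linear[OF bounded_linear_gamma]])
  have "nabla A (nabla A f) x
      = (\<Sum>i\<in>UNIV. \<Sum>j\<in>UNIV. gamma (coord i) (gamma (coord j) (pd (direction A i) (pd (direction A j) f) x)))"
    unfolding nabla_def[of A "nabla A f"] pd_nabla[OF f direction_Basis] lin ..
  also have "\<dots> = - (\<Sum>j\<in>UNIV. pd (direction A j) (pd (direction A j) f) x)"
    by (rule clifford_sum[OF gamma_clifford pd_commute[OF f direction_Basis direction_Basis]])
  finally show ?thesis .
qed

lemma nabla_minus:
  fixes f :: "real ^ ('n::{finite,linorder}) ^ 2 \<Rightarrow> complex ^ 'n subsets"
  assumes "smooth f"
  shows "nabla A (\<lambda>x. - f x) x = - nabla A f x"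
proof -
  have "pd b (\<lambda>x. - f x) x = - pd b f x" for b
    by (rule pd_linear[OF bounded_linear_minus[OF bounded_linear_ident] smooth_differentiable[OF assms]])
  then show ?thesis
    by (simp add: nabla_def linear_neg[OF bounded_linear.linear[OF bounded_linear_gamma]] sum_negf)
qed

lemma coord_space_add: "v \<in> coord_space J \<Longrightarrow> w \<in> coord_space J \<Longrightarrow> v + w \<in> coord_space J"
  and coord_space_diff: "v \<in> coord_space J \<Longrightarrow> w \<in> coord_space J \<Longrightarrow> v - w \<in> coord_space J"
  and coord_space_minus: "v \<in> coord_space J \<Longrightarrow> - v \<in> coord_space J"
  and coord_space_sum: "(\<And>i. i \<in> I \<Longrightarrow> g i \<in> coord_space J) \<Longrightarrow> sum g I \<in> coord_space J"
  by (auto simp: coord_space_def)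

lemma nabla_spinor:
  fixes f :: "real ^ ('n::{finite,linorder}) ^ 2 \<Rightarrow> complex ^ 'n subsets"
  assumes "smooth f"
  shows "(\<And>x. f x \<in> spinor_plus) \<Longrightarrow> nabla A f x \<in> spinor_minus"
    "(\<And>x. f x \<in> spinor_minus) \<Longrightarrow> nabla A f x \<in> spinor_plus"
  unfolding spinor_plus_coord spinor_minus_coord nabla_def
  by (rule coord_space_sum, rule gamma_spinor(1,2)[OF coord_bounds, unfolded spinor_plus_coord spinor_minus_coord],
      rule pd_coord_space[OF assms], assumption)+

lemma V2_coord: "V2 = coord_space {p. snd p \<in> even_index}"
  by (auto simp: V2_def spinor_minus_coord coord_space_def component_def)

lemma V3_coord: "V3 = coord_space odd_index"
  by (simp add: V3_def spinor_plus_coord)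

lemma component_inject: "component A (inject B v) = (if A = B then v else 0)"
  by (auto simp: component_def inject_def vec_eq_iff)

lemma inject_V2: "v \<in> spinor_minus \<Longrightarrow> inject A v \<in> V2"
  by (auto simp: V2_def component_inject spinor_minus_def)

theorem D2_smooth_functions:
  "D2 ` smooth_functions V2 = (smooth_functions V3 :: (real ^ ('n::{finite,linorder}) ^ 2 \<Rightarrow> complex ^ 'n subsets) set)"
proof (intro equalityI subsetI)
  fix f :: "real ^ ('n::{finite,linorder}) ^ 2 \<Rightarrow> complex ^ 'n subsets"
  assume "f \<in> D2 ` smooth_functions V2"
  then obtain h :: "real ^ ('n::{finite,linorder}) ^ 2 \<Rightarrow> complex ^ (2 \<times> 'n subsets)"
    where h: "smooth h" "\<And>x. h x \<in> V2" "f = D2 h"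
    by (auto simp: smooth_functions_def)
  have sm: "smooth (component A \<circ> h)" for A
    unfolding o_def by (rule smooth_linear[OF bounded_linear_component h(1)])
  have S: "(component A \<circ> h) x \<in> spinor_minus" for A x using h(2) by (simp add: V2_def)
  have "D2 h = (\<lambda>x. nabla 0 (component 1 \<circ> h) x - nabla 1 (component 0 \<circ> h) x)"
    by (simp add: D2_def fun_eq_iff)
  then have "smooth (D2 h)" using smooth_diff[OF smooth_nabla[OF sm] smooth_nabla[OF sm]] by simp
  moreover have "D2 h x \<in> V3" for x
    unfolding D2_def V3_def spinor_plus_coord
    by (intro coord_space_diff nabla_spinor(2)[OF sm S, unfolded spinor_plus_coord])
  ultimately show "f \<in> smooth_functions V3" by (auto simp: smooth_functions_def h(3))
next
  fix f :: "real ^ ('n::{finite,linorder}) ^ 2 \<Rightarrow> complex ^ 'n subsets"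
  assume "f \<in> smooth_functions V3"
  then have f: "smooth f" "\<And>x. f x \<in> V3" by (auto simp: smooth_functions_def)
  obtain u0 where u0: "smooth u0" "\<And>x. lap u0 x = f x" by (rule lap_surj_smooth[OF f(1)]) blast
  \<comment> \<open>The solution u0 need not take values in the spinor module. The projection
    commutes with \<open>lap\<close> and fixes f, so it can be applied afterwards.\<close>
  define P :: "complex ^ 'n subsets \<Rightarrow> complex ^ 'n subsets"
    where "P v = (\<chi> k. if k \<in> odd_index then 0 else v $ k)" for v
  have P: "bounded_linear P" by (rule vec_linear_bounded) (simp_all add: P_def vec_eq_iff)
  have PV: "P v \<in> spinor_plus" for v by (simp add: P_def spinor_plus_coord coord_space_def)
  have Pid: "v \<in> V3 \<Longrightarrow> P v = v" for v by (auto simp: P_def V3_coord coord_space_def vec_eq_iff)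
  define u where "u x = P (u0 x)" for x
  have u: "smooth u" "u x \<in> spinor_plus" "lap u x = f x" for x
    unfolding u_def[abs_def] using lap_linear[OF P u0(1)] smooth_linear[OF P u0(1)] PV Pid f u0 by auto
  define h where "h x = inject 1 (- nabla 0 u x) + inject 0 (nabla 1 u x)" for x
  have smn: "smooth (nabla A u)" for A by (rule smooth_nabla[OF u(1)])
  have "smooth h" unfolding h_def[abs_def]
    by (intro smooth_add smooth_linear[OF bounded_linear_inject] smooth_minus smn)
  moreover have "h x \<in> V2" for x
    unfolding h_def V2_coord
    by (intro coord_space_add inject_V2[unfolded V2_coord])
       (use nabla_spinor(1)[OF u(1,2)] in \<open>auto simp: spinor_minus_coord intro: coord_space_minus\<close>)
  moreover have "D2 h = f"
  proof
    fix x
    have add: "component A (v + w) = component A v + component A w" for A and v w :: "complex ^ (2 \<times> 'n subsets)"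
      by (simp add: component_def vec_eq_iff)
    have "component 1 \<circ> h = (\<lambda>x. - nabla 0 u x)" "component 0 \<circ> h = nabla 1 u"
      by (simp_all add: fun_eq_iff h_def add component_inject)
    then have "D2 h x = - nabla 0 (nabla 0 u) x - nabla 1 (nabla 1 u) x"
      by (simp add: D2_def nabla_minus[OF smn])
    also have "\<dots> = lap u x"
      by (simp add: nabla_nabla[OF u(1)] lap_def sum_Basis_direction)
    finally show "D2 h x = f x" using u by simp
  qed
  ultimately show "f \<in> D2 ` smooth_functions V2"
    by (auto simp: smooth_functions_def intro!: image_eqI[of _ _ h])
qed

subsection \<open>The operators on distributions\<close>

text \<open>One summand of the transpose of \<open>nabla A\<close>, without the minus sign of
  \<open>dist_pd\<close>; that sign reverses the order of the two sums in
  \<open>dist_D2_eq\<close>.\<close>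

definition nabla_tr ::
  "2 \<Rightarrow> 'n \<Rightarrow> (real ^ ('n::{finite,linorder}) ^ 2 \<Rightarrow> complex ^ 'n subsets)
     \<Rightarrow> real ^ ('n::{finite,linorder}) ^ 2 \<Rightarrow> complex ^ 'n subsets" where
  "nabla_tr A j \<phi> = pd (direction A j) (\<lambda>x. gamma_tr (coord j) (\<phi> x))"

lemma test_map_nabla_tr:
  "test_map spinor_plus spinor_minus (nabla_tr A (j :: 'n::{finite,linorder}))"
  "test_map spinor_minus spinor_plus (nabla_tr A (j :: 'n::{finite,linorder}))"
proof -
  have lin: "test_map V W (\<lambda>\<phi> (x :: real ^ ('n::{finite,linorder}) ^ 2). gamma_tr (coord j) (\<phi> x))"
    if "\<And>v. v \<in> V \<Longrightarrow> gamma_tr (coord j) v \<in> W" for V W :: "(complex ^ 'n subsets) set"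
    by (rule test_map_linear) (simp_all add: gamma_tr_linear[OF coord_bounds] that)
  show "test_map spinor_plus spinor_minus (nabla_tr A j)"
    using test_map_comp[OF lin[OF gamma_spinor(3)[OF coord_bounds, of _ j], unfolded spinor_minus_coord]
        test_map_pd[OF direction_Basis[of A j]]]
    unfolding nabla_tr_def[abs_def] spinor_minus_coord .
  show "test_map spinor_minus spinor_plus (nabla_tr A j)"
    using test_map_comp[OF lin[OF gamma_spinor(4)[OF coord_bounds, of _ j], unfolded spinor_plus_coord]
        test_map_pd[OF direction_Basis[of A j]]]
    unfolding nabla_tr_def[abs_def] spinor_plus_coord .
qed

lemma test_map_inject: "test_map spinor_minus V2 (\<lambda>\<phi> (x :: 'a::euclidean_space). inject A (\<phi> x))"
  by (rule test_map_linear) (simp_all add: inject_V2, simp_all add: inject_def vec_eq_iff)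

lemma test_map_component: "test_map V2 spinor_minus (\<lambda>\<phi> (x :: 'a::euclidean_space). component A (\<phi> x))"
  by (rule test_map_linear) (auto simp: V2_def component_def vec_eq_iff)

lemma linear_space_spinor: "linear_space spinor_plus" "linear_space spinor_minus" "linear_space V2" "linear_space V3"
  by (simp_all add: spinor_plus_coord spinor_minus_coord V2_coord V3_coord linear_space_coord_space)

lemma dist_D2_eq:
  assumes "\<phi> \<in> test_functions V3"
  shows "dist_D2 h \<phi> = (\<Sum>j\<in>UNIV. h (\<lambda>x. inject 0 (nabla_tr 1 j \<phi> x))) - (\<Sum>j\<in>UNIV. h (\<lambda>x. inject 1 (nabla_tr 0 j \<phi> x)))"
  using assms
  by (simp add: dist_D2_def dist_nabla_def dist_lin_def dist_pd_def dist_component_def nabla_tr_def gamma_tr_def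
      o_def sum_negf)

lemma nabla_tr_nabla_tr:
  fixes \<phi> :: "real ^ ('n::{finite,linorder}) ^ 2 \<Rightarrow> complex ^ 'n subsets"
  assumes "smooth \<phi>"
  shows "nabla_tr A i (nabla_tr A j \<phi>) x
    = gamma_tr (coord i) (gamma_tr (coord j) (pd (direction A i) (pd (direction A j) \<phi>) x))"
proof -
  have 1: "nabla_tr A j \<phi> = (\<lambda>x. gamma_tr (coord j) (pd (direction A j) \<phi> x))"
    unfolding nabla_tr_def
    by (rule ext, rule pd_linear[OF bounded_linear_gamma_tr smooth_differentiable[OF assms]])
  have bl: "bounded_linear (\<lambda>v. gamma_tr (coord i) (gamma_tr (coord j) v :: complex ^ 'n subsets))"
    by (rule bounded_linear_compose[OF bounded_linear_gamma_tr bounded_linear_gamma_tr])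
  show ?thesis
    unfolding 1 unfolding nabla_tr_def
    by (rule pd_linear[OF bl smooth_differentiable[OF smooth_pd[OF assms direction_Basis]]])
qed

theorem dist_D2_distributions:
  "dist_D2 ` distributions V2 =
     (distributions V3 :: ((real ^ ('n::{finite,linorder}) ^ 2 \<Rightarrow> complex ^ 'n subsets) \<Rightarrow> complex) set)"
proof (intro equalityI subsetI)
  fix f :: "(real ^ ('n::{finite,linorder}) ^ 2 \<Rightarrow> complex ^ 'n subsets) \<Rightarrow> complex"
  assume "f \<in> dist_D2 ` distributions V2"
  then obtain h where h: "h \<in> distributions V2" "f = dist_D2 h" by blast
  have tm: "test_map V3 V2 (\<lambda>\<phi> x. inject A (nabla_tr B j \<phi> x))" for A B and j :: 'n
    unfolding V3_def by (rule test_map_comp[OF test_map_nabla_tr(1) test_map_inject])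
  have "dist_on V3 (\<lambda>\<phi>. (\<Sum>j\<in>UNIV. h (\<lambda>x. inject 0 (nabla_tr 1 j \<phi> x)))
      + (-1) * (\<Sum>j\<in>UNIV. h (\<lambda>x. inject 1 (nabla_tr 0 j \<phi> x))))"
    by (intro dist_on_add dist_on_scale dist_on_sums dist_on_test_map[OF distributions_dist_on[OF h(1)] tm])
  from dist_on_distributions[OF this linear_space_spinor(4)]
  have "(\<lambda>\<phi>. if \<phi> \<in> test_functions V3 then dist_D2 h \<phi> else 0) \<in> distributions V3"
    by (simp add: dist_D2_eq cong: if_cong)
  moreover have "(\<lambda>\<phi>. if \<phi> \<in> test_functions V3 then dist_D2 h \<phi> else 0) = dist_D2 h"
    by (auto simp: dist_D2_def)
  ultimately show "f \<in> distributions V3" using h(2) by simp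
next
  fix f :: "(real ^ ('n::{finite,linorder}) ^ 2 \<Rightarrow> complex ^ 'n subsets) \<Rightarrow> complex"
  assume f: "f \<in> distributions V3"
  obtain u where u: "u \<in> distributions V3" "\<And>\<phi>. \<phi> \<in> test_functions V3 \<Longrightarrow> u (lap \<phi>) = f \<phi>"
    using lap_surj_distributions[of f odd_index] f unfolding V3_coord by blast
  have du: "dist_on spinor_plus u" using distributions_dist_on[OF u(1)] by (simp add: V3_def)
  \<comment> \<open>The column (nabla_1 u, - nabla_0 u) tested against psi; transposing a derivative
    reverses both signs.\<close>
  define h0 where "h0 \<psi> = (\<Sum>j\<in>UNIV. u (nabla_tr 0 j (\<lambda>x. component 1 (\<psi> x))))
      + (-1) * (\<Sum>j\<in>UNIV. u (nabla_tr 1 j (\<lambda>x. component 0 (\<psi> x))))" for \<psi>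
  define h where "h \<psi> = (if \<psi> \<in> test_functions V2 then h0 \<psi> else 0)" for \<psi>
  have "dist_on V2 h0"
    unfolding h0_def[abs_def]
    by (intro dist_on_add dist_on_scale dist_on_sums
        dist_on_test_map[OF du test_map_comp[OF test_map_component test_map_nabla_tr(2)]])
  then have h: "h \<in> distributions V2"
    unfolding h_def[abs_def] by (rule dist_on_distributions[OF _ linear_space_spinor(3)])
  \<comment> \<open>The component that \<open>inject\<close> leaves empty contributes these
    terms.\<close>
  have zero: "u (nabla_tr A k (\<lambda>x. 0)) = 0" for A k
  proof -
    have "nabla_tr A k (\<lambda>x. 0) = (\<lambda>x. 0)"
      using linear_0[OF bounded_linear.linear[OF bounded_linear_gamma_tr[of k]]] by (simp add: nabla_tr_def)
    then show ?thesis using dist_on_zero[OF du linear_space_spinor(1)] by simp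
  qed
  have h_inject: "h (\<lambda>x. inject 1 (\<xi> x)) = (\<Sum>k\<in>UNIV. u (nabla_tr 0 k \<xi>))"
    "h (\<lambda>x. inject 0 (\<xi> x)) = - (\<Sum>k\<in>UNIV. u (nabla_tr 1 k \<xi>))"
    if "\<xi> \<in> test_functions spinor_minus" for \<xi>
    using test_map_test[OF test_map_inject that] by (simp_all add: h_def h0_def component_inject zero)
  have "dist_D2 h \<phi> = f \<phi>" if \<phi>: "\<phi> \<in> test_functions V3" for \<phi>
  proof -
    have \<phi>': "\<phi> \<in> test_functions spinor_plus" using \<phi> by (simp add: V3_def)
    note sm = test_functionsD(1)[OF \<phi>]
    \<comment> \<open>The Laplacian in the variables x_A only; the two of them add up to
      \<open>lap\<close>.\<close>
    define e where "e A x = (\<Sum>j\<in>UNIV. pd (direction A j) (pd (direction A j) \<phi>) x)" for A x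
    have te: "e A \<in> test_functions spinor_plus" for A
      unfolding e_def[abs_def] spinor_plus_coord
      by (intro test_sum linear_space_coord_space finite test_map_test[OF test_map_pd] direction_Basis
          \<phi>'[unfolded spinor_plus_coord])
    have t1: "nabla_tr A j \<phi> \<in> test_functions spinor_minus" for A j
      by (rule test_map_test[OF test_map_nabla_tr(1) \<phi>'])
    have t2: "nabla_tr A k (nabla_tr A j \<phi>) \<in> test_functions spinor_plus" for A j k
      by (rule test_map_test[OF test_map_nabla_tr(2) t1])
    have u_e: "(\<Sum>j\<in>UNIV. \<Sum>k\<in>UNIV. u (nabla_tr A k (nabla_tr A j \<phi>))) = - u (e A)" for A
    proof -
      have "(\<Sum>j\<in>UNIV. \<Sum>k\<in>UNIV. u (nabla_tr A k (nabla_tr A j \<phi>)))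
          = (\<Sum>j\<in>UNIV. u (\<lambda>x. \<Sum>k\<in>UNIV. nabla_tr A k (nabla_tr A j \<phi>) x))"
        by (intro sum.cong refl dist_on_sum[OF du linear_space_spinor(1) finite t2, symmetric])
      also have "\<dots> = u (\<lambda>x. \<Sum>j\<in>UNIV. \<Sum>k\<in>UNIV. nabla_tr A k (nabla_tr A j \<phi>) x)"
        by (rule dist_on_sum[OF du linear_space_spinor(1) finite, symmetric])
           (intro test_sum linear_space_spinor finite t2)
      also have "(\<lambda>x. \<Sum>j\<in>UNIV. \<Sum>k\<in>UNIV. nabla_tr A k (nabla_tr A j \<phi>) x) = (\<lambda>x. (- 1) *s e A x)"
      proof
        fix x
        have "(\<Sum>k\<in>UNIV. \<Sum>j\<in>UNIV. nabla_tr A k (nabla_tr A j \<phi>) x) = - e A x"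
          unfolding nabla_tr_nabla_tr[OF sm] e_def
          by (rule clifford_sum[OF gamma_tr_clifford pd_commute[OF sm direction_Basis direction_Basis]])
        then show "(\<Sum>j\<in>UNIV. \<Sum>k\<in>UNIV. nabla_tr A k (nabla_tr A j \<phi>) x) = (- 1) *s e A x"
          by (subst sum.swap) (simp add: vec_eq_iff)
      qed
      also have "u \<dots> = - u (e A)"
        using dist_on_mult[OF du te, of "-1"] by simp
      finally show ?thesis .
    qed
    have "dist_D2 h \<phi> = - (\<Sum>j\<in>UNIV. \<Sum>k\<in>UNIV. u (nabla_tr 1 k (nabla_tr 1 j \<phi>)))
        - (\<Sum>j\<in>UNIV. \<Sum>k\<in>UNIV. u (nabla_tr 0 k (nabla_tr 0 j \<phi>)))"
      by (simp add: dist_D2_eq[OF \<phi>] h_inject[OF t1] sum_negf)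
    also have "\<dots> = u (\<lambda>x. e 0 x + e 1 x)"
      unfolding u_e dist_on_plus[OF du te te] by simp
    also have "(\<lambda>x. e 0 x + e 1 x) = lap \<phi>"
      by (simp add: fun_eq_iff e_def lap_def sum_Basis_direction)
    finally show ?thesis using u(2)[OF \<phi>] by simp
  qed
  moreover have "dist_D2 h \<phi> = f \<phi>" if "\<phi> \<notin> test_functions V3" for \<phi>
    using that f by (simp add: dist_D2_def distributions_def)
  ultimately have "dist_D2 h = f" by blast
  then show "f \<in> dist_D2 ` distributions V2" using h by blast
qed

subsection \<open>Vanishing of the cohomology\<close>

text \<open>When every cocycle is a coboundary, the relation is all of Z times Z and leaves one
  class. A quotient space is zero exactly when it has a single element, hence the singleton.\<close>

lemma cohomology_self:
  assumes "z \<in> Z" "\<And>u v. u \<in> Z \<Longrightarrow> v \<in> Z \<Longrightarrow> u - v \<in> Z"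
  shows "is_singleton (cohomology Z Z)"
proof -
  have "{(u, v). u \<in> Z \<and> v \<in> Z \<and> u - v \<in> Z} = Z \<times> Z" using assms by auto
  then have "cohomology Z Z = {Z}" using assms(1) unfolding cohomology_def quotient_def by auto
  then show ?thesis by simp
qed

lemma smooth_functions_diff:
  assumes "u \<in> smooth_functions (coord_space J)" "v \<in> smooth_functions (coord_space J)"
  shows "u - v \<in> smooth_functions (coord_space J)"
  using assms
  by (auto simp: smooth_functions_def fun_diff_def image_subset_iff intro: smooth_diff coord_space_diff)

lemma distributions_diff:
  assumes "linear_space V" "u \<in> distributions V" "v \<in> distributions V"
  shows "u - v \<in> distributions V"
proof -
  have "dist_on V (\<lambda>\<phi>. u \<phi> + (-1) * v \<phi>)"
    by (intro dist_on_add dist_on_scale distributions_dist_on assms)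
  from dist_on_distributions[OF this assms(1)]
  have "(\<lambda>\<phi>. if \<phi> \<in> test_functions V then u \<phi> + (-1) * v \<phi> else 0) \<in> distributions V" .
  moreover have "(\<lambda>\<phi>. if \<phi> \<in> test_functions V then u \<phi> + (-1) * v \<phi> else 0) = u - v"
    using assms(2,3) by (auto simp: fun_eq_iff distributions_def)
  ultimately show ?thesis by simp
qed

theorem theorem1p3:
  shows "is_singleton
           (H3_smooth :: (real ^ ('n::{finite,linorder}) ^ 2 \<Rightarrow> complex ^ 'n subsets) set set) \<and>
         is_singleton
           (H3_distributions ::
             ((real ^ ('n::{finite,linorder}) ^ 2 \<Rightarrow> complex ^ 'n subsets) \<Rightarrow> complex) set set) \<and>
         D2 ` smooth_functions V2 =
           (smooth_functions V3 ::
             (real ^ ('n::{finite,linorder}) ^ 2 \<Rightarrow> complex ^ 'n subsets) set) \<and>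
         dist_D2 ` distributions V2 =
           (distributions V3 ::
             ((real ^ ('n::{finite,linorder}) ^ 2 \<Rightarrow> complex ^ 'n subsets) \<Rightarrow> complex) set)"
proof (intro conjI)
  show "is_singleton (H3_smooth :: (real ^ ('n::{finite,linorder}) ^ 2 \<Rightarrow> complex ^ 'n subsets) set set)"
    unfolding H3_smooth_def D2_smooth_functions
  proof (rule cohomology_self)
    show "(\<lambda>x. 0) \<in> smooth_functions V3"
      by (auto simp: smooth_functions_def V3_coord coord_space_def)
  qed (auto simp: V3_coord intro: smooth_functions_diff)
  show "is_singleton (H3_distributions :: ((real ^ ('n::{finite,linorder}) ^ 2 \<Rightarrow> complex ^ 'n subsets) \<Rightarrow> complex) set set)"
    unfolding H3_distributions_def dist_D2_distributions
  proof (rule cohomology_self)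
    show "(\<lambda>\<phi>. if \<phi> \<in> test_functions V3 then 0 else 0) \<in> distributions V3"
      by (rule dist_on_distributions[OF dist_on_const_zero linear_space_spinor(4)])
  qed (rule distributions_diff[OF linear_space_spinor(4)])
qed (fact D2_smooth_functions dist_D2_distributions)+

end
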